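(* From the proof of $\mathsf{UDNR}^{+}\leftrightarrow \Pi^0_1\text{-}\mathsf{TRANS}$ in $\mathsf{RCA}_0^{\Lambda}$, two terms $s,u$ can be extracted such that $\mathsf{RCA}_0^{\omega}$ proves $$(\forall \mu^{2})\big[\mathsf{MU}(\mu)\to \mathsf{UDNR}(s(\mu)) \big] \wedge (\forall \Psi^{1\to 1})\big[ \mathsf{UDNR}(\Psi)\to \mathsf{MU}(u(\Psi, \Phi)) \big],$$ where $\Phi$ is an extensionality functional for $\Psi$.
   Context: Types: $0$ is the type of natural numbers, $1=0\to 0$, $2=1\to 0$, and $\rho^*$ is the type of finite sequences of objects of type $\rho$. Internal base theory. $\mathsf{RCA}_0^\omega$ is Kohlenbach's base theory $\mathsf{E}\text{-}\mathsf{PRA}^\omega+\mathsf{QF}\text{-}\mathsf{AC}^{1,0}$. Here $\mathsf{E}\text{-}\mathsf{PRA}^\omega$ is classical primitive recursive arithmetic in all finite types with the axiom of extensionality, and $\mathsf{QF}\text{-}\mathsf{AC}^{1,0}$ is the axiom of choice limited to formulas $(\forall f^1)(\exists n^0)\varphi_0(f,n)$ with $\varphi_0$ quantifier-free. $\mathsf{E}\text{-}\mathsf{PRA}^{\omega*}$ is the extension of $\mathsf{E}\text{-}\mathsf{PRA}^{\omega}$ with types for finite sequences. Nonstandard base theory. Add to the language a predicate $\mathrm{st}$ ("is standard") for each finite type. Write $(\forall^{\mathrm{st}}x)\dots$ for $(\forall x)(\mathrm{st}(x)\to\dots)$ and $(\exists^{\mathrm{st}}x)\dots$ for $(\exists x)(\mathrm{st}(x)\wedge\dots)$.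 A formula is internal if it does not involve $\mathrm{st}$. $\mathsf{RCA}_0^\Lambda$ is $\mathsf{E}\text{-}\mathsf{PRA}^{\omega*}+\mathsf{QF}\text{-}\mathsf{AC}^{1,0}$ together with: (a) the schemas $\mathrm{st}(x)\wedge x=y\to\mathrm{st}(y)$; $\mathrm{st}(t)$ for each closed term $t$; and $\mathrm{st}(f)\wedge\mathrm{st}(x)\to\mathrm{st}(f(x))$; (b) $\mathsf{HAC}_{\mathrm{int}}$: $(\forall^{\mathrm{st}}x^\rho)(\exists^{\mathrm{st}}y^\tau)\varphi(x,y)\to(\exists^{\mathrm{st}}F^{\rho\to\tau^*})(\forall^{\mathrm{st}}x^\rho)(\exists y^\tau\in F(x))\varphi(x,y)$ for internal $\varphi$; (c) Idealisation $\mathsf{I}$: $(\forall^{\mathrm{st}}x^{\sigma^*})(\exists y^\tau)(\forall z^\sigma\in x)\varphi(z,y)\to(\exists y^\tau)(\forall^{\mathrm{st}}x^\sigma)\varphi(x,y)$ for internal $\varphi$. For $C,D$ of type $1$, $C\approx_1 D$ means $(\forall^{\mathrm{st}}n^0)(C(n)=D(n))$. $\Phi_e^A$ denotes the $e$-th partial computable function with oracle $A$, and $\Psi(A)(e)\neq\Phi_e^A(e)$ means that if $\Phi_e^A(e)$ halts with output $y$, then $\Psi(A)(e)\neq y$. $\mathsf{UDNR}^+$ is the statement $$(\exists^{\mathrm{st}}\Psi^{1\to1})\big[(\forall^{\mathrm{st}}A^1)(\forall e^0)(\Psi(A)(e)\neq\Phi_e^A(e))\wedge(\forall^{\mathrm{st}}C^1,D^1)(C\approx_1D\to\Psi(C)\approx_1\Psi(D))\big].$$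 $\Pi^0_1\text{-}\mathsf{TRANS}$ is the statement $(\forall^{\mathrm{st}}f^1)\big[(\forall^{\mathrm{st}}n^0)f(n)=0\to(\forall m)f(m)=0\big]$. The equivalence $\mathsf{UDNR}^+\leftrightarrow\Pi^0_1\text{-}\mathsf{TRANS}$ is provable in $\mathsf{RCA}_0^\Lambda$. Terms are extracted by bringing each implication into the normal form $(\forall^{\mathrm{st}}x)(\exists^{\mathrm{st}}y)\psi(x,y)$ with $\psi$ internal, and then applying to its proof a term extraction algorithm which yields a term $t$ such that $(\forall x)(\exists y\in t(x))\psi(x,y)$ is provable without the nonstandard axioms. $\mathsf{MU}(\mu)$ is the formula $(\forall f^1)[(\exists n^0)f(n)=0\to f(\mu(f))=0]$, i.e. $\mu$ is Feferman's mu-operator. $\mathsf{UDNR}(\Psi)$ is the formula $(\forall A^1)(\forall e^0)(\Psi(A)(e)\neq\Phi^A_e(e))$. A functional $\Xi$ (taking two arguments of type $1$ and one of type $0$, with values of type $0$) is an extensionality functional for $\varphi^{1\to1}$ if $$(\forall k^0,f^1,g^1)\big[\overline f\,\Xi(f,g,k)=\overline g\,\Xi(f,g,k)\to\overline{\varphi(f)}k=\overline{\varphi(g)}k\big],$$ where $\overline f n$ is the initial segment of $f$ of length $n$. *)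

theory Defs
  imports Main
begin

section \<open>Finite types, terms and formulas\<close>

text \<open>
  \<open>N\<close> is the type \<open>0\<close> of the paper, and \<open>Seq \<sigma>\<close> is the type \<open>\<sigma>*\<close> of finite sequences; the types of
  \<open>RCA\<^sub>0\<^sup>\<omega>\<close> are those without \<open>Seq\<close>.
\<close>

datatype ty = N | Fun ty ty (infixr "\<rightarrow>" 60) | Seq ty

abbreviation one :: ty where "one \<equiv> N \<rightarrow> N"
abbreviation two :: ty where "two \<equiv> one \<rightarrow> N"

fun star_free :: "ty \<Rightarrow> bool" where
  "star_free N = True"
| "star_free (\<rho> \<rightarrow> \<tau>) = (star_free \<rho> \<and> star_free \<tau>)"
| "star_free (Seq \<sigma>) = False"

text \<open>
  \<open>K\<close> and \<open>S\<close> are the combinators (often called \<open>\<Pi>\<close> and \<open>\<Sigma>\<close>). \<open>Rec\<close> is the only recursor of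
  \<open>E-PRA\<^sup>\<omega>\<close>: primitive recursion with values of type \<open>N\<close>, where base and step may be arbitrary terms
  and so may contain parameters of any type. \<open>Tab f n\<close> is the sequence \<open>\<langle>f 0, \<dots>, f (n - 1)\<rangle>\<close>, and
  \<open>Get s i\<close> is the entry of \<open>s\<close> at position \<open>i\<close>.
\<close>

datatype const =
    Zero | Succ | Rec
  | K ty ty | S ty ty ty
  | Len ty | Get ty | Tab ty

primrec ctype :: "const \<Rightarrow> ty" where
  "ctype Zero = N"
| "ctype Succ = N \<rightarrow> N"
| "ctype Rec = N \<rightarrow> N \<rightarrow> (N \<rightarrow> N \<rightarrow> N) \<rightarrow> N"
| "ctype (K \<rho> \<tau>) = \<rho> \<rightarrow> \<tau> \<rightarrow> \<rho>"
| "ctype (S \<delta> \<rho> \<tau>) = (\<delta> \<rightarrow> \<rho> \<rightarrow> \<tau>) \<rightarrow> (\<delta> \<rightarrow> \<rho>) \<rightarrow> \<delta> \<rightarrow> \<tau>"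
| "ctype (Len \<sigma>) = Seq \<sigma> \<rightarrow> N"
| "ctype (Get \<sigma>) = Seq \<sigma> \<rightarrow> N \<rightarrow> \<sigma>"
| "ctype (Tab \<sigma>) = (N \<rightarrow> \<sigma>) \<rightarrow> N \<rightarrow> Seq \<sigma>"

text \<open>A variable is a name together with its type; equal names of different types are different variables.\<close>

type_synonym var = "nat \<times> ty"

datatype tm = Var var | Cst const | App tm tm (infixl "\<cdot>" 90)

fun ttype :: "tm \<Rightarrow> ty" where
  "ttype (Var v) = snd v"
| "ttype (Cst c) = ctype c"
| "ttype (s \<cdot> t) = (case ttype s of \<rho> \<rightarrow> \<tau> \<Rightarrow> \<tau> | _ \<Rightarrow> N)"

fun wt :: "tm \<Rightarrow> bool" where
  "wt (Var v) = True"
| "wt (Cst c) = True"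
| "wt (s \<cdot> t) = (wt s \<and> wt t \<and> (case ttype s of \<rho> \<rightarrow> \<tau> \<Rightarrow> ttype t = \<rho> | _ \<Rightarrow> False))"

fun tvars :: "tm \<Rightarrow> var set" where
  "tvars (Var v) = {v}"
| "tvars (Cst c) = {}"
| "tvars (s \<cdot> t) = tvars s \<union> tvars t"

fun star_free_tm :: "tm \<Rightarrow> bool" where
  "star_free_tm (Var v) = star_free (snd v)"
| "star_free_tm (Cst c) = star_free (ctype c)"
| "star_free_tm (s \<cdot> t) = (star_free_tm s \<and> star_free_tm t)"

fun tsubst :: "var \<Rightarrow> tm \<Rightarrow> tm \<Rightarrow> tm" where
  "tsubst v r (Var w) = (if w = v then r else Var w)"
| "tsubst v r (Cst c) = Cst c"
| "tsubst v r (s \<cdot> t) = tsubst v r s \<cdot> tsubst v r t"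

text \<open>\<open>Eq\<close> is equality at type \<open>N\<close>, the only primitive equality.\<close>

datatype fm = Eq tm tm | St tm | Bot | Imp fm fm (infixr "\<^bold>\<longrightarrow>" 25) | All var fm

abbreviation Neg :: "fm \<Rightarrow> fm" where "Neg \<phi> \<equiv> \<phi> \<^bold>\<longrightarrow> Bot"
abbreviation And :: "fm \<Rightarrow> fm \<Rightarrow> fm" (infixr "\<^bold>\<and>" 35) where "\<phi> \<^bold>\<and> \<psi> \<equiv> Neg (\<phi> \<^bold>\<longrightarrow> Neg \<psi>)"
abbreviation Iff :: "fm \<Rightarrow> fm \<Rightarrow> fm" (infix "\<^bold>\<longleftrightarrow>" 25)
  where "\<phi> \<^bold>\<longleftrightarrow> \<psi> \<equiv> (\<phi> \<^bold>\<longrightarrow> \<psi>) \<^bold>\<and> (\<psi> \<^bold>\<longrightarrow> \<phi>)"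
abbreviation Ex :: "var \<Rightarrow> fm \<Rightarrow> fm" where "Ex v \<phi> \<equiv> Neg (All v (Neg \<phi>))"
abbreviation All_st :: "var \<Rightarrow> fm \<Rightarrow> fm" where "All_st v \<phi> \<equiv> All v (St (Var v) \<^bold>\<longrightarrow> \<phi>)"
abbreviation Ex_st :: "var \<Rightarrow> fm \<Rightarrow> fm" where "Ex_st v \<phi> \<equiv> Ex v (St (Var v) \<^bold>\<and> \<phi>)"

fun wff :: "fm \<Rightarrow> bool" where
  "wff (Eq s t) = (wt s \<and> wt t \<and> ttype s = N \<and> ttype t = N)"
| "wff (St t) = wt t"
| "wff Bot = True"
| "wff (\<phi> \<^bold>\<longrightarrow> \<psi>) = (wff \<phi> \<and> wff \<psi>)"
| "wff (All v \<phi>) = wff \<phi>"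

fun internal :: "fm \<Rightarrow> bool" where
  "internal (Eq s t) = True"
| "internal (St t) = False"
| "internal Bot = True"
| "internal (\<phi> \<^bold>\<longrightarrow> \<psi>) = (internal \<phi> \<and> internal \<psi>)"
| "internal (All v \<phi>) = internal \<phi>"

fun star_free_fm :: "fm \<Rightarrow> bool" where
  "star_free_fm (Eq s t) = (star_free_tm s \<and> star_free_tm t)"
| "star_free_fm (St t) = star_free_tm t"
| "star_free_fm Bot = True"
| "star_free_fm (\<phi> \<^bold>\<longrightarrow> \<psi>) = (star_free_fm \<phi> \<and> star_free_fm \<psi>)"
| "star_free_fm (All v \<phi>) = (star_free (snd v) \<and> star_free_fm \<phi>)"

text \<open>Quantifier-free means in particular internal.\<close>

fun quantifier_free :: "fm \<Rightarrow> bool" where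
  "quantifier_free (Eq s t) = True"
| "quantifier_free (St t) = False"
| "quantifier_free Bot = True"
| "quantifier_free (\<phi> \<^bold>\<longrightarrow> \<psi>) = (quantifier_free \<phi> \<and> quantifier_free \<psi>)"
| "quantifier_free (All v \<phi>) = False"

fun fvars :: "fm \<Rightarrow> var set" where
  "fvars (Eq s t) = tvars s \<union> tvars t"
| "fvars (St t) = tvars t"
| "fvars Bot = {}"
| "fvars (\<phi> \<^bold>\<longrightarrow> \<psi>) = fvars \<phi> \<union> fvars \<psi>"
| "fvars (All v \<phi>) = fvars \<phi> - {v}"

text \<open>Substitution does not rename bound variables; it is only used where \<open>free_for\<close> holds.\<close>

fun fsubst :: "var \<Rightarrow> tm \<Rightarrow> fm \<Rightarrow> fm" where
  "fsubst v r (Eq s t) = Eq (tsubst v r s) (tsubst v r t)"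
| "fsubst v r (St t) = St (tsubst v r t)"
| "fsubst v r Bot = Bot"
| "fsubst v r (\<phi> \<^bold>\<longrightarrow> \<psi>) = (fsubst v r \<phi> \<^bold>\<longrightarrow> fsubst v r \<psi>)"
| "fsubst v r (All w \<phi>) = (if w = v then All w \<phi> else All w (fsubst v r \<phi>))"

fun free_for :: "tm \<Rightarrow> var \<Rightarrow> fm \<Rightarrow> bool" where
  "free_for r v (Eq s t) = True"
| "free_for r v (St t) = True"
| "free_for r v Bot = True"
| "free_for r v (\<phi> \<^bold>\<longrightarrow> \<psi>) = (free_for r v \<phi> \<and> free_for r v \<psi>)"
| "free_for r v (All w \<phi>) = (v \<notin> fvars (All w \<phi>) \<or> (w \<notin> tvars r \<and> free_for r v \<phi>))"


section \<open>Lambda abstraction and primitive recursive arithmetic\<close>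

text \<open>Abstraction is defined from the combinators, so that \<open>lam v t \<cdot> s = tsubst v s t\<close> is provable.\<close>

fun lam :: "var \<Rightarrow> tm \<Rightarrow> tm" where
  "lam v (Var w) =
    (if w = v
     then Cst (S (snd v) (snd v \<rightarrow> snd v) (snd v)) \<cdot> Cst (K (snd v) (snd v \<rightarrow> snd v)) \<cdot> Cst (K (snd v) (snd v))
     else Cst (K (snd w) (snd v)) \<cdot> Var w)"
| "lam v (Cst c) = Cst (K (ctype c) (snd v)) \<cdot> Cst c"
| "lam v (s \<cdot> t) =
    (if v \<in> tvars (s \<cdot> t)
     then Cst (S (snd v) (ttype t) (ttype (s \<cdot> t))) \<cdot> lam v s \<cdot> lam v t
     else Cst (K (ttype (s \<cdot> t)) (snd v)) \<cdot> (s \<cdot> t))"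

definition lams :: "var list \<Rightarrow> tm \<Rightarrow> tm" where "lams vs t = foldr lam vs t"

abbreviation nv :: "nat \<Rightarrow> var" where "nv i \<equiv> (i, N)"
abbreviation fv :: "nat \<Rightarrow> var" where "fv i \<equiv> (i, one)"
abbreviation nt :: "nat \<Rightarrow> tm" where "nt i \<equiv> Var (nv i)"
abbreviation ft :: "nat \<Rightarrow> tm" where "ft i \<equiv> Var (fv i)"

abbreviation zero :: tm where "zero \<equiv> Cst Zero"
abbreviation suc :: "tm \<Rightarrow> tm" where "suc t \<equiv> Cst Succ \<cdot> t"
abbreviation rec :: "tm \<Rightarrow> tm \<Rightarrow> tm \<Rightarrow> tm" where "rec x y z \<equiv> Cst Rec \<cdot> x \<cdot> y \<cdot> z"

fun num :: "nat \<Rightarrow> tm" where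
  "num 0 = zero"
| "num (Suc k) = suc (num k)"

text \<open>
  Each closed term comes with the corresponding function on terms. The equations governing \<open>Rec\<close> are
  \<open>rec 0 y z = y\<close> and \<open>rec (suc x) y z = z (rec x y z) x\<close>.
\<close>

definition "prdT = lam (nv 0) (rec (nt 0) zero (lams [nv 1, nv 2] (nt 2)))"
abbreviation prd :: "tm \<Rightarrow> tm" where "prd x \<equiv> prdT \<cdot> x"

definition "addT = lams [nv 0, nv 1] (rec (nt 1) (nt 0) (lams [nv 2, nv 3] (suc (nt 2))))"
abbreviation add :: "tm \<Rightarrow> tm \<Rightarrow> tm" where "add x y \<equiv> addT \<cdot> x \<cdot> y"

definition "monusT = lams [nv 0, nv 1] (rec (nt 1) (nt 0) (lams [nv 2, nv 3] (prd (nt 2))))"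
abbreviation monus :: "tm \<Rightarrow> tm \<Rightarrow> tm" where "monus x y \<equiv> monusT \<cdot> x \<cdot> y"

text \<open>\<open>cond c x y\<close> is \<open>x\<close> if \<open>c = 0\<close>, and \<open>y\<close> otherwise.\<close>

definition "condT = lams [nv 0, nv 1, nv 2] (rec (nt 0) (nt 1) (lams [nv 3, nv 4] (nt 2)))"
abbreviation cond :: "tm \<Rightarrow> tm \<Rightarrow> tm \<Rightarrow> tm" where "cond c x y \<equiv> condT \<cdot> c \<cdot> x \<cdot> y"

abbreviation ifeq :: "tm \<Rightarrow> tm \<Rightarrow> tm \<Rightarrow> tm \<Rightarrow> tm" where
  "ifeq a b x y \<equiv> cond (add (monus a b) (monus b a)) x y"

text \<open>
  Cantor pairing \<open>pair x y = triangle (x + y) + x\<close>; \<open>diag z\<close> is the largest \<open>w\<close> with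
  \<open>triangle w \<le> z\<close>.
\<close>

definition "triangleT = lam (nv 0) (rec (nt 0) zero (lams [nv 1, nv 2] (add (nt 1) (suc (nt 2)))))"
abbreviation triangle :: "tm \<Rightarrow> tm" where "triangle x \<equiv> triangleT \<cdot> x"

definition "pairT = lams [nv 0, nv 1] (add (triangle (add (nt 0) (nt 1))) (nt 0))"
abbreviation pair :: "tm \<Rightarrow> tm \<Rightarrow> tm" where "pair x y \<equiv> pairT \<cdot> x \<cdot> y"

definition "diagT = lam (nv 0) (rec (nt 0) zero
  (lams [nv 1, nv 2] (cond (monus (triangle (suc (nt 1))) (suc (nt 2))) (suc (nt 1)) (nt 1))))"
abbreviation diag :: "tm \<Rightarrow> tm" where "diag x \<equiv> diagT \<cdot> x"

definition "pfstT = lam (nv 0) (monus (nt 0) (triangle (diag (nt 0))))"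
abbreviation pfst :: "tm \<Rightarrow> tm" where "pfst x \<equiv> pfstT \<cdot> x"

definition "psndT = lam (nv 0) (monus (diag (nt 0)) (pfst (nt 0)))"
abbreviation psnd :: "tm \<Rightarrow> tm" where "psnd x \<equiv> psndT \<cdot> x"

text \<open>
  Since \<open>pair 0 0 = 0\<close>, every number \<open>c = pair c\<^sub>0 (pair c\<^sub>1 (\<dots>))\<close> codes an infinite list
  \<open>c\<^sub>0, c\<^sub>1, \<dots>\<close> that is eventually \<open>0\<close>. \<open>skip c i\<close> removes the first \<open>i\<close> entries, \<open>get c i\<close> is
  \<open>c\<^sub>i\<close>, and \<open>upd c i x\<close> replaces \<open>c\<^sub>i\<close> by \<open>x\<close> (the recursion puts back \<open>c\<^sub>i\<^sub>-\<^sub>1, \<dots>, c\<^sub>0\<close> one by one).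
\<close>

definition "skipT = lams [nv 0, nv 1] (rec (nt 1) (nt 0) (lams [nv 2, nv 3] (psnd (nt 2))))"
abbreviation skip :: "tm \<Rightarrow> tm \<Rightarrow> tm" where "skip c i \<equiv> skipT \<cdot> c \<cdot> i"

definition "getT = lams [nv 0, nv 1] (pfst (skip (nt 0) (nt 1)))"
abbreviation get :: "tm \<Rightarrow> tm \<Rightarrow> tm" where "get c i \<equiv> getT \<cdot> c \<cdot> i"

definition "updT = lams [nv 0, nv 1, nv 2]
  (rec (nt 1) (pair (nt 2) (skip (nt 0) (suc (nt 1))))
    (lams [nv 3, nv 4] (pair (get (nt 0) (monus (nt 1) (suc (nt 4)))) (nt 3))))"
abbreviation upd :: "tm \<Rightarrow> tm \<Rightarrow> tm \<Rightarrow> tm" where "upd c i x \<equiv> updT \<cdot> c \<cdot> i \<cdot> x"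


section \<open>The partial computable functions with oracle\<close>

text \<open>
  \<open>\<Phi>\<^sub>e\<^sup>A\<close> is given by unlimited register machines with an oracle. The number \<open>e\<close> codes (in the above
  sense) the list of its instructions, each instruction being a code of \<open>op, a, b, q\<close>:

  \<^item> \<open>op = 0\<close>: halt;
  \<^item> \<open>op = 1\<close>: \<open>R\<^sub>a := 0\<close>;
  \<^item> \<open>op = 2\<close>: \<open>R\<^sub>a := R\<^sub>a + 1\<close>;
  \<^item> \<open>op = 3\<close>: \<open>R\<^sub>b := R\<^sub>a\<close>;
  \<^item> \<open>op = 4\<close>: if \<open>R\<^sub>a = R\<^sub>b\<close>, jump to instruction \<open>q\<close>;
  \<^item> \<open>op = 5\<close>: \<open>R\<^sub>a := A(R\<^sub>a)\<close>;
  \<^item> \<open>op > 5\<close>: loop forever.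

  A state is \<open>pair pc r\<close>, where \<open>pc\<close> is the position of the next instruction and \<open>r\<close> codes the
  registers. Input and output are in \<open>R\<^sub>0\<close>; all other registers are initially \<open>0\<close>. A program coded by
  \<open>e\<close> is followed by instructions with code \<open>0\<close>, so that running off its end is halting.
\<close>

abbreviation field :: "tm \<Rightarrow> tm \<Rightarrow> nat \<Rightarrow> tm" where
  "field e st i \<equiv> get (get e (pfst st)) (num i)"

abbreviation step_body :: "tm \<Rightarrow> tm \<Rightarrow> tm \<Rightarrow> tm" where
  "step_body A e st \<equiv>
    (let r = psnd st; next_pc = suc (pfst st);
         op = field e st 0; a = field e st 1; b = field e st 2; q = field e st 3
     in ifeq op (num 1) (pair next_pc (upd r a zero))
       (ifeq op (num 2) (pair next_pc (upd r a (suc (get r a))))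
       (ifeq op (num 3) (pair next_pc (upd r b (get r a)))
       (ifeq op (num 4) (ifeq (get r a) (get r b) (pair q r) (pair next_pc r))
       (ifeq op (num 5) (pair next_pc (upd r a (A \<cdot> get r a)))
        st)))))"

definition "stepT = lams [fv 0, nv 0, nv 1] (step_body (ft 0) (nt 0) (nt 1))"

text \<open>\<open>run A e x k\<close> is the state after \<open>k\<close> steps on input \<open>x\<close>.\<close>

definition "runT = lams [fv 0, nv 0, nv 1, nv 2]
  (rec (nt 2) (pair zero (pair (nt 1) zero)) (lams [nv 3, nv 4] (stepT \<cdot> ft 0 \<cdot> nt 0 \<cdot> nt 3)))"
abbreviation run :: "tm \<Rightarrow> tm \<Rightarrow> tm \<Rightarrow> tm \<Rightarrow> tm" where "run A e x k \<equiv> runT \<cdot> A \<cdot> e \<cdot> x \<cdot> k"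

text \<open>
  \<open>result A e x k\<close> is \<open>0\<close> if the machine has not halted after \<open>k\<close> steps, and \<open>y + 1\<close> if it has halted
  with output \<open>y\<close>.
\<close>

definition "resultT = lams [fv 0, nv 0, nv 1, nv 2]
  (let st = run (ft 0) (nt 0) (nt 1) (nt 2) in cond (field (nt 0) st 0) (suc (get (psnd st) zero)) zero)"
abbreviation result :: "tm \<Rightarrow> tm \<Rightarrow> tm \<Rightarrow> tm \<Rightarrow> tm" where "result A e x k \<equiv> resultT \<cdot> A \<cdot> e \<cdot> x \<cdot> k"

text \<open>
  In the formulas below that take terms as arguments, these terms must not contain the variables
  that are bound in the formula. This is the case wherever the formulas are used.
\<close>

text \<open>\<open>\<Phi>\<^sub>e\<^sup>A(x)\<close> halts with output \<open>y\<close>.\<close>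

definition computes :: "tm \<Rightarrow> tm \<Rightarrow> tm \<Rightarrow> tm \<Rightarrow> fm" where
  "computes A e x y = Ex (nv 2) (Eq (result A e x (nt 2)) (suc y))"

text \<open>\<open>z \<noteq> \<Phi>\<^sub>e\<^sup>A(x)\<close>.\<close>

definition differs :: "tm \<Rightarrow> tm \<Rightarrow> tm \<Rightarrow> tm \<Rightarrow> fm" where
  "differs z A e x = All (nv 1) (computes A e x (nt 1) \<^bold>\<longrightarrow> Neg (Eq z (nt 1)))"


section \<open>Equality and finite sequences\<close>

fun max_name :: "tm \<Rightarrow> nat" where
  "max_name (Var v) = fst v"
| "max_name (Cst c) = 0"
| "max_name (s \<cdot> t) = max (max_name s) (max_name t)"

definition fresh :: "tm \<Rightarrow> tm \<Rightarrow> nat" where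
  "fresh s t = Suc (max (max_name s) (max_name t))"

definition less :: "tm \<Rightarrow> tm \<Rightarrow> fm" where
  "less s t = Eq (monus (suc s) t) zero"

abbreviation len :: "ty \<Rightarrow> tm \<Rightarrow> tm" where "len \<sigma> s \<equiv> Cst (Len \<sigma>) \<cdot> s"
abbreviation entry :: "ty \<Rightarrow> tm \<Rightarrow> tm \<Rightarrow> tm" where "entry \<sigma> s i \<equiv> Cst (Get \<sigma>) \<cdot> s \<cdot> i"
abbreviation tab :: "ty \<Rightarrow> tm \<Rightarrow> tm \<Rightarrow> tm" where "tab \<sigma> g k \<equiv> Cst (Tab \<sigma>) \<cdot> g \<cdot> k"

text \<open>Equality at higher types is extensional; sequences are equal if they have equal lengths and entries.\<close>

primrec eq :: "ty \<Rightarrow> tm \<Rightarrow> tm \<Rightarrow> fm" where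
  "eq N s t = Eq s t"
| "eq (\<rho> \<rightarrow> \<tau>) s t = (let v = (fresh s t, \<rho>) in All v (eq \<tau> (s \<cdot> Var v) (t \<cdot> Var v)))"
| "eq (Seq \<sigma>) s t =
    (Eq (len \<sigma> s) (len \<sigma> t) \<^bold>\<and>
     (let v = nv (fresh s t) in
        All v (less (Var v) (len \<sigma> s) \<^bold>\<longrightarrow> eq \<sigma> (entry \<sigma> s (Var v)) (entry \<sigma> t (Var v)))))"

definition mem :: "ty \<Rightarrow> tm \<Rightarrow> tm \<Rightarrow> fm" where
  "mem \<tau> t s = (let v = nv (fresh s t) in Ex v (less (Var v) (len \<tau> s) \<^bold>\<and> eq \<tau> t (entry \<tau> s (Var v))))"

primrec zero_of :: "ty \<Rightarrow> tm" where
  "zero_of N = zero"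
| "zero_of (\<rho> \<rightarrow> \<tau>) = Cst (K \<tau> \<rho>) \<cdot> zero_of \<tau>"
| "zero_of (Seq \<sigma>) = tab \<sigma> (Cst (K \<sigma> N) \<cdot> zero_of \<sigma>) zero"


section \<open>Derivability\<close>

text \<open>
  A Hilbert calculus for classical many-sorted predicate logic in which all axioms and generalisations in a
  derivation, and hence all its formulas, are taken from \<open>\<L>\<close>. In particular instances of axioms outside \<open>\<L>\<close>, such as ill-typed ones, are discarded.
  Axioms may have free variables, which are read universally.
\<close>

inductive derivable :: "fm set \<Rightarrow> fm set \<Rightarrow> fm \<Rightarrow> bool" for \<L> Ax where
  axiom: "\<phi> \<in> Ax \<Longrightarrow> \<phi> \<in> \<L> \<Longrightarrow> derivable \<L> Ax \<phi>"
| imp_K: "(\<phi> \<^bold>\<longrightarrow> \<psi> \<^bold>\<longrightarrow> \<phi>) \<in> \<L> \<Longrightarrow> derivable \<L> Ax (\<phi> \<^bold>\<longrightarrow> \<psi> \<^bold>\<longrightarrow> \<phi>)"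
| imp_S: "((\<phi> \<^bold>\<longrightarrow> \<psi> \<^bold>\<longrightarrow> \<chi>) \<^bold>\<longrightarrow> (\<phi> \<^bold>\<longrightarrow> \<psi>) \<^bold>\<longrightarrow> \<phi> \<^bold>\<longrightarrow> \<chi>) \<in> \<L> \<Longrightarrow>
    derivable \<L> Ax ((\<phi> \<^bold>\<longrightarrow> \<psi> \<^bold>\<longrightarrow> \<chi>) \<^bold>\<longrightarrow> (\<phi> \<^bold>\<longrightarrow> \<psi>) \<^bold>\<longrightarrow> \<phi> \<^bold>\<longrightarrow> \<chi>)"
| double_neg: "(Neg (Neg \<phi>) \<^bold>\<longrightarrow> \<phi>) \<in> \<L> \<Longrightarrow> derivable \<L> Ax (Neg (Neg \<phi>) \<^bold>\<longrightarrow> \<phi>)"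
| all_inst: "wt t \<Longrightarrow> ttype t = snd v \<Longrightarrow> free_for t v \<phi> \<Longrightarrow> (All v \<phi> \<^bold>\<longrightarrow> fsubst v t \<phi>) \<in> \<L> \<Longrightarrow>
    derivable \<L> Ax (All v \<phi> \<^bold>\<longrightarrow> fsubst v t \<phi>)"
| all_imp: "v \<notin> fvars \<phi> \<Longrightarrow> (All v (\<phi> \<^bold>\<longrightarrow> \<psi>) \<^bold>\<longrightarrow> \<phi> \<^bold>\<longrightarrow> All v \<psi>) \<in> \<L> \<Longrightarrow>
    derivable \<L> Ax (All v (\<phi> \<^bold>\<longrightarrow> \<psi>) \<^bold>\<longrightarrow> \<phi> \<^bold>\<longrightarrow> All v \<psi>)"
| mp: "derivable \<L> Ax (\<phi> \<^bold>\<longrightarrow> \<psi>) \<Longrightarrow> derivable \<L> Ax \<phi> \<Longrightarrow> derivable \<L> Ax \<psi>"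
| gen: "derivable \<L> Ax \<phi> \<Longrightarrow> All v \<phi> \<in> \<L> \<Longrightarrow> derivable \<L> Ax (All v \<phi>)"


section \<open>The theories\<close>

text \<open>
  The rule \<open>extensionality\<close> is the axiom of extensionality; together with \<open>Eq_refl\<close>, \<open>Eq_sym\<close>
  and \<open>Eq_trans\<close> it gives all the usual equality axioms.
\<close>

inductive_set E_PRA :: "fm set" where
  Eq_refl: "Eq s s \<in> E_PRA"
| Eq_sym: "(Eq s t \<^bold>\<longrightarrow> Eq t s) \<in> E_PRA"
| Eq_trans: "(Eq r s \<^bold>\<longrightarrow> Eq s t \<^bold>\<longrightarrow> Eq r t) \<in> E_PRA"
| extensionality: "(eq \<rho> s t \<^bold>\<longrightarrow> eq \<tau> (g \<cdot> s) (g \<cdot> t)) \<in> E_PRA"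
| K_eq: "eq \<rho> (Cst (K \<rho> \<tau>) \<cdot> s \<cdot> t) s \<in> E_PRA"
| S_eq: "eq \<tau> (Cst (S \<delta> \<rho> \<tau>) \<cdot> r \<cdot> s \<cdot> t) (r \<cdot> t \<cdot> (s \<cdot> t)) \<in> E_PRA"
| Rec_zero: "Eq (rec zero s t) s \<in> E_PRA"
| Rec_Succ: "Eq (rec (suc r) s t) (t \<cdot> rec r s t \<cdot> r) \<in> E_PRA"
| Succ_not_zero: "Neg (Eq (suc s) zero) \<in> E_PRA"
| Succ_inj: "(Eq (suc s) (suc t) \<^bold>\<longrightarrow> Eq s t) \<in> E_PRA"
| induction: "quantifier_free \<phi> \<Longrightarrow> snd x = N \<Longrightarrow>
    (fsubst x zero \<phi> \<^bold>\<and> All x (\<phi> \<^bold>\<longrightarrow> fsubst x (suc (Var x)) \<phi>) \<^bold>\<longrightarrow> All x \<phi>) \<in> E_PRA"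

inductive_set QF_AC :: "fm set" where
  "quantifier_free \<phi> \<Longrightarrow> snd x = one \<Longrightarrow> snd y = N \<Longrightarrow> snd F = two \<Longrightarrow> F \<notin> fvars \<phi> \<Longrightarrow>
    (All x (Ex y \<phi>) \<^bold>\<longrightarrow> Ex F (All x (fsubst y (Var F \<cdot> Var x) \<phi>))) \<in> QF_AC"

inductive_set Sequences :: "fm set" where
  len_tab: "Eq (len \<sigma> (tab \<sigma> g t)) t \<in> Sequences"
| entry_tab: "(less r t \<^bold>\<longrightarrow> eq \<sigma> (entry \<sigma> (tab \<sigma> g t) r) (g \<cdot> r)) \<in> Sequences"
| entry_out_of_range: "(Neg (less r (len \<sigma> s)) \<^bold>\<longrightarrow> eq \<sigma> (entry \<sigma> s r) (zero_of \<sigma>)) \<in> Sequences"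

inductive_set Standardness :: "fm set" where
  St_eq: "(St s \<^bold>\<and> eq \<rho> s t \<^bold>\<longrightarrow> St t) \<in> Standardness"
| St_closed: "tvars t = {} \<Longrightarrow> St t \<in> Standardness"
| St_app: "(St s \<^bold>\<and> St t \<^bold>\<longrightarrow> St (s \<cdot> t)) \<in> Standardness"

inductive_set HAC_int :: "fm set" where
  "internal \<phi> \<Longrightarrow> x \<noteq> y \<Longrightarrow> snd F = (snd x \<rightarrow> Seq (snd y)) \<Longrightarrow> F \<notin> fvars \<phi> \<Longrightarrow>
    (All_st x (Ex_st y \<phi>) \<^bold>\<longrightarrow>
     Ex_st F (All_st x (Ex y (mem (snd y) (Var y) (Var F \<cdot> Var x) \<^bold>\<and> \<phi>)))) \<in> HAC_int"

inductive_set Idealisation :: "fm set" where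
  "internal \<phi> \<Longrightarrow> z \<noteq> y \<Longrightarrow> x \<noteq> y \<Longrightarrow> snd x = Seq (snd z) \<Longrightarrow> x \<notin> fvars \<phi> \<Longrightarrow>
    (All_st x (Ex y (All z (mem (snd z) (Var z) (Var x) \<^bold>\<longrightarrow> \<phi>))) \<^bold>\<longrightarrow>
     Ex y (All_st z \<phi>)) \<in> Idealisation"

definition RCA0_omega :: "fm \<Rightarrow> bool" where
  "RCA0_omega = derivable {\<phi>. wff \<phi> \<and> internal \<phi> \<and> star_free_fm \<phi>} (E_PRA \<union> QF_AC)"

definition RCA0_Lambda :: "fm \<Rightarrow> bool" where
  "RCA0_Lambda = derivable {\<phi>. wff \<phi>}
     (E_PRA \<union> QF_AC \<union> Sequences \<union> Standardness \<union> HAC_int \<union> Idealisation)"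

definition closed_term :: "ty \<Rightarrow> tm \<Rightarrow> bool" where
  "closed_term \<rho> t \<longleftrightarrow> wt t \<and> ttype t = \<rho> \<and> tvars t = {} \<and> star_free_tm t"


section \<open>The principles\<close>

abbreviation \<mu>_var :: var where "\<mu>_var \<equiv> (0, two)"
abbreviation \<Psi>_var :: var where "\<Psi>_var \<equiv> (0, one \<rightarrow> one)"
abbreviation \<Phi>_var :: var where "\<Phi>_var \<equiv> (0, one \<rightarrow> one \<rightarrow> N \<rightarrow> N)"

definition approx :: "tm \<Rightarrow> tm \<Rightarrow> fm" where
  "approx C D = All_st (nv 0) (Eq (C \<cdot> nt 0) (D \<cdot> nt 0))"

definition UDNR_plus :: fm where
  "UDNR_plus =
     Ex_st \<Psi>_var
       (All_st (fv 0) (All (nv 0) (differs (Var \<Psi>_var \<cdot> ft 0 \<cdot> nt 0) (ft 0) (nt 0) (nt 0))) \<^bold>\<and>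
        All_st (fv 0) (All_st (fv 1)
          (approx (ft 0) (ft 1) \<^bold>\<longrightarrow> approx (Var \<Psi>_var \<cdot> ft 0) (Var \<Psi>_var \<cdot> ft 1))))"

definition Pi01_TRANS :: fm where
  "Pi01_TRANS = All_st (fv 0)
     (All_st (nv 0) (Eq (ft 0 \<cdot> nt 0) zero) \<^bold>\<longrightarrow> All (nv 1) (Eq (ft 0 \<cdot> nt 1) zero))"

definition MU :: "tm \<Rightarrow> fm" where
  "MU \<mu> = All (fv 0) (Ex (nv 0) (Eq (ft 0 \<cdot> nt 0) zero) \<^bold>\<longrightarrow> Eq (ft 0 \<cdot> (\<mu> \<cdot> ft 0)) zero)"

definition UDNR :: "tm \<Rightarrow> fm" where
  "UDNR \<Psi> = All (fv 0) (All (nv 0) (differs (\<Psi> \<cdot> ft 0 \<cdot> nt 0) (ft 0) (nt 0) (nt 0)))"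

text \<open>
  The initial segment \<open>\<langle>g 0, \<dots>, g (k - 1)\<rangle>\<close> is coded by a number: \<open>0\<close> codes the empty sequence, and
  \<open>pair c a + 1\<close> codes the extension by \<open>a\<close> of the sequence with code \<open>c\<close>.
\<close>

definition "segT = lams [fv 0, nv 0]
  (rec (nt 0) zero (lams [nv 1, nv 2] (suc (pair (nt 1) (ft 0 \<cdot> nt 2)))))"
abbreviation seg :: "tm \<Rightarrow> tm \<Rightarrow> tm" where "seg g k \<equiv> segT \<cdot> g \<cdot> k"

text \<open>\<open>\<Xi>\<close> is an extensionality functional for \<open>\<phi>\<close>.\<close>

definition extensionality_functional :: "tm \<Rightarrow> tm \<Rightarrow> fm" where
  "extensionality_functional \<Xi> \<phi> =
     All (nv 0) (All (fv 0) (All (fv 1)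
       (Eq (seg (ft 0) (\<Xi> \<cdot> ft 0 \<cdot> ft 1 \<cdot> nt 0)) (seg (ft 1) (\<Xi> \<cdot> ft 0 \<cdot> ft 1 \<cdot> nt 0)) \<^bold>\<longrightarrow>
        Eq (seg (\<phi> \<cdot> ft 0) (nt 0)) (seg (\<phi> \<cdot> ft 1) (nt 0)))))"

end

theory Submission
  imports Defs "HOL-Library.Countable_Set"
begin

text \<open>
  Both claims are derived from a completeness theorem for the calculus: a formula is provable if it
  belongs to every maximal consistent set with witnesses. In such a set the numeric terms, modulo
  provable equality, behave like a model of primitive recursive arithmetic with quantifier-free
  induction, in which one can argue semantically.

  From \<open>\<mu>\<close> one obtains a diagonally nonrecursive function by returning \<open>\<Phi>\<^sub>e\<^sup>A(e) + 1\<close> whenever \<open>\<mu>\<close> finds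
  a step at which the computation has halted. Conversely, let \<open>e\<close> be a program which searches for
  the first \<open>n\<close> with \<open>A(n) \<noteq> 0\<close> and returns \<open>A(n + 1)\<close>. Given \<open>f\<close>, put \<open>c = \<Psi>(0)(e)\<close> and let \<open>A(n)\<close> be \<open>c\<close> if
  \<open>f(n) = 0\<close>, otherwise \<open>1\<close> if \<open>f(n + 1) = 0\<close>, and otherwise \<open>0\<close>. If \<open>f(0) \<noteq> 0\<close> and \<open>f\<close> has a zero, then
  \<open>\<Phi>\<^sub>e\<^sup>A(e) = c\<close>, so that \<open>\<Psi>(A)(e) \<noteq> c = \<Psi>(0)(e)\<close>. Hence \<open>A\<close> differs from \<open>0\<close> below the bound given by the
  extensionality functional, or, in the nonstandard setting, at a standard argument.
\<close>

section \<open>Terms, formulas and substitution\<close>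

text \<open>A direct derivation about register machines in the Hilbert calculus would be out of
  reach. A model of all finite types is avoided as well: only numeric terms receive values,
  functions stay terms, and equality at a higher type is replaced by equality of numeric terms for
  all arguments. This suffices because the arguments concern numbers, with functions entering as
  parameters.

  The obstacle is that induction holds only for quantifier-free statements, whereas halting is an
  existential one. Therefore order is expressed by truncated subtraction, halting is tied to an
  explicit count of steps, and predecessors and differences appear as terms.

  On the nonstandard side, the choice principle yields only finitely many candidates for a zero,
  from which one has to be selected, and the functional so obtained is known to be correct only at
  standard functions. But \<open>UDNR_plus\<close> speaks about nonstandard programs too, so
  transfer has to be used once more to reach them.\<close>

instance ty :: countable by countable_datatype
instance const :: countable by countable_datatype
instance tm :: countable by countable_datatype
instance fm :: countable by countable_datatype

lemma finite_tvars [simp]: "finite (tvars t)"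
  by (induction t) auto

lemma tsubst_fresh [simp]: "v \<notin> tvars t \<Longrightarrow> tsubst v r t = t"
  by (induction t) auto

lemma tsubst_self [simp]: "tsubst v (Var v) t = t"
  by (induction t) auto

lemma tvars_tsubst: "tvars (tsubst v r t) \<subseteq> (tvars t - {v}) \<union> tvars r"
  by (induction t) auto

lemma ttype_tsubst [simp]: "ttype r = snd v \<Longrightarrow> ttype (tsubst v r t) = ttype t"
  by (induction t) auto

lemma wt_tsubst [simp]: "wt t \<Longrightarrow> wt r \<Longrightarrow> ttype r = snd v \<Longrightarrow> wt (tsubst v r t)"
  by (induction t) (auto split: ty.splits)

lemma star_free_tsubst [simp]: "star_free_tm t \<Longrightarrow> star_free_tm r \<Longrightarrow> star_free_tm (tsubst v r t)"
  by (induction t) auto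

lemma tsubst_tsubst_fresh: "w \<notin> tvars t \<Longrightarrow> tsubst w r (tsubst v (Var w) t) = tsubst v r t"
  by (induction t) auto

text \<open>Bound variables count too: a variable outside \<open>avars \<phi>\<close> can replace a
  free one without being captured, and the replacement can be undone.\<close>

fun avars :: "fm \<Rightarrow> var set" where
  "avars (Eq s t) = tvars s \<union> tvars t"
| "avars (St t) = tvars t"
| "avars Bot = {}"
| "avars (\<phi> \<^bold>\<longrightarrow> \<psi>) = avars \<phi> \<union> avars \<psi>"
| "avars (All v \<phi>) = insert v (avars \<phi>)"

lemma finite_avars [simp]: "finite (avars \<phi>)"
  by (induction \<phi>) auto

lemma fvars_avars: "fvars \<phi> \<subseteq> avars \<phi>"
  by (induction \<phi>) auto

lemma fsubst_fresh [simp]: "v \<notin> fvars \<phi> \<Longrightarrow> fsubst v r \<phi> = \<phi>"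
  by (induction \<phi>) auto

lemma fsubst_self [simp]: "fsubst v (Var v) \<phi> = \<phi>"
  by (induction \<phi>) auto

lemma free_for_self [simp]: "free_for (Var v) v \<phi>"
  by (induction \<phi>) auto

lemma free_for_quantifier_free [simp]: "quantifier_free \<phi> \<Longrightarrow> free_for r v \<phi>"
  by (induction \<phi>) auto

lemma fsubst_fsubst_fresh: "w \<notin> avars \<phi> \<Longrightarrow> fsubst w (Var v) (fsubst v (Var w) \<phi>) = \<phi>"
proof (induction \<phi>)
  case (All u \<phi>)
  then show ?case using fsubst_fresh[of w \<phi>] fvars_avars[of \<phi>] by (cases "u = v") (auto simp del: fsubst_fresh)
qed (auto simp: tsubst_tsubst_fresh)

lemma fvars_fsubst: "fvars (fsubst v r \<phi>) \<subseteq> (fvars \<phi> - {v}) \<union> tvars r"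
proof (induction \<phi>)
  case (Eq s t)
  then show ?case using tvars_tsubst[of v r s] tvars_tsubst[of v r t] by auto
next
  case (St t)
  then show ?case using tvars_tsubst[of v r t] by auto
qed auto

lemma free_for_fsubst_fresh: "w \<notin> avars \<phi> \<Longrightarrow> free_for (Var v) w (fsubst v (Var w) \<phi>)"
proof (induction \<phi>)
  case (All u \<phi>)
  then show ?case using fvars_avars[of \<phi>] by (cases "u = v") auto
qed auto

lemma wff_fsubst [simp]: "wff \<phi> \<Longrightarrow> wt r \<Longrightarrow> ttype r = snd v \<Longrightarrow> wff (fsubst v r \<phi>)"
  by (induction \<phi>) auto

lemma internal_fsubst [simp]: "internal (fsubst v r \<phi>) = internal \<phi>"
  by (induction \<phi>) auto

lemma star_free_fm_fsubst [simp]: "star_free_fm \<phi> \<Longrightarrow> star_free_tm r \<Longrightarrow> star_free_fm (fsubst v r \<phi>)"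
  by (induction \<phi>) auto

lemma star_free_ttype: "wt t \<Longrightarrow> star_free_tm t \<Longrightarrow> star_free (ttype t)"
  by (induction t) (auto split: ty.splits)


section \<open>Natural deduction and completeness\<close>

text \<open>The parameter \<open>sf\<close> restricts the language to the internal star-free formulas, so that the
  results of this locale apply to both theories.\<close>

locale calculus =
  fixes sf :: bool and Ax :: "fm set"
  assumes E_PRA_Ax: "E_PRA \<subseteq> Ax"
begin

definition L :: "fm set" where
  "L = {\<phi>. wff \<phi> \<and> (sf \<longrightarrow> internal \<phi> \<and> star_free_fm \<phi>)}"

definition ok :: "ty \<Rightarrow> tm \<Rightarrow> bool" where
  "ok \<rho> t \<longleftrightarrow> wt t \<and> ttype t = \<rho> \<and> (sf \<longrightarrow> star_free_tm t)"

definition okv :: "var \<Rightarrow> bool" where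
  "okv v \<longleftrightarrow> (sf \<longrightarrow> star_free (snd v))"

abbreviation prv :: "fm \<Rightarrow> bool" where "prv \<equiv> derivable L Ax"

lemma L_Imp [simp]: "(\<phi> \<^bold>\<longrightarrow> \<psi>) \<in> L \<longleftrightarrow> \<phi> \<in> L \<and> \<psi> \<in> L"
  by (auto simp: L_def)

lemma L_Bot [simp]: "Bot \<in> L"
  by (auto simp: L_def)

lemma L_All: "All v \<phi> \<in> L \<longleftrightarrow> \<phi> \<in> L \<and> okv v"
  by (auto simp: L_def okv_def)

lemma L_Eq: "Eq s t \<in> L \<longleftrightarrow> ok N s \<and> ok N t"
  by (auto simp: L_def ok_def)

lemma L_fsubst: "\<phi> \<in> L \<Longrightarrow> ok (snd v) r \<Longrightarrow> fsubst v r \<phi> \<in> L"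
  by (auto simp: L_def ok_def)

lemma ok_Var: "ok \<rho> (Var v) \<longleftrightarrow> \<rho> = snd v \<and> okv v"
  by (auto simp: ok_def okv_def)

lemma ok_app: "ok (\<rho> \<rightarrow> \<tau>) g \<Longrightarrow> ok \<rho> s \<Longrightarrow> ok \<tau> (g \<cdot> s)"
  by (auto simp: ok_def)

lemma L_fsubst_Var: "All v \<phi> \<in> L \<Longrightarrow> snd w = snd v \<Longrightarrow> fsubst v (Var w) \<phi> \<in> L"
  using L_fsubst[of \<phi> v "Var w"] by (simp add: L_All ok_Var okv_def)

lemma prv_L: "prv \<phi> \<Longrightarrow> \<phi> \<in> L"
  by (induction rule: derivable.induct) auto

section \<open>Derivability from hypotheses\<close>

lemma prv_id: "\<phi> \<in> L \<Longrightarrow> prv (\<phi> \<^bold>\<longrightarrow> \<phi>)"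
  by (rule derivable.mp[OF derivable.mp[OF derivable.imp_S[of \<phi> "\<phi> \<^bold>\<longrightarrow> \<phi>" \<phi>] derivable.imp_K]
        derivable.imp_K[of \<phi> \<phi>]]) auto

text \<open>Generalisation is confined to \<open>prv\<close>, that is, to derivations without
  hypotheses; so the deduction theorem needs no condition on variables.\<close>

inductive hyp :: "fm set \<Rightarrow> fm \<Rightarrow> bool" for H where
  assm: "\<phi> \<in> H \<Longrightarrow> \<phi> \<in> L \<Longrightarrow> hyp H \<phi>"
| base: "prv \<phi> \<Longrightarrow> hyp H \<phi>"
| mp: "hyp H (\<phi> \<^bold>\<longrightarrow> \<psi>) \<Longrightarrow> hyp H \<phi> \<Longrightarrow> hyp H \<psi>"

lemma hyp_L: "hyp H \<phi> \<Longrightarrow> \<phi> \<in> L"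
  by (induction rule: hyp.induct) (auto dest: prv_L)

lemma hyp_mp_base: "prv (\<phi> \<^bold>\<longrightarrow> \<psi>) \<Longrightarrow> hyp H \<phi> \<Longrightarrow> hyp H \<psi>"
  by (rule hyp.mp[OF hyp.base])

lemma hyp_empty: "hyp {} \<phi> \<Longrightarrow> prv \<phi>"
  by (induction rule: hyp.induct) (auto intro: derivable.mp)

lemma hyp_mono: "hyp H \<phi> \<Longrightarrow> H \<subseteq> H' \<Longrightarrow> hyp H' \<phi>"
  by (induction rule: hyp.induct) (auto intro: hyp.intros)

lemma hyp_weaken: "hyp H \<psi> \<Longrightarrow> \<phi> \<in> L \<Longrightarrow> hyp H (\<phi> \<^bold>\<longrightarrow> \<psi>)"
  by (rule hyp.mp[OF hyp.base[OF derivable.imp_K]]) (auto dest: hyp_L)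

lemma deduction: "hyp (insert \<phi> H) \<psi> \<Longrightarrow> \<phi> \<in> L \<Longrightarrow> hyp H (\<phi> \<^bold>\<longrightarrow> \<psi>)"
proof (induction rule: hyp.induct)
  case (assm \<psi>)
  then show ?case by (cases "\<psi> = \<phi>") (auto intro: hyp.base prv_id hyp_weaken hyp.assm)
next
  case (base \<psi>)
  then show ?case by (auto intro: hyp.base hyp_weaken)
next
  case (mp \<psi> \<chi>)
  then have "\<psi> \<in> L" "\<chi> \<in> L" using hyp_L by force+
  then have "prv ((\<phi> \<^bold>\<longrightarrow> \<psi> \<^bold>\<longrightarrow> \<chi>) \<^bold>\<longrightarrow> (\<phi> \<^bold>\<longrightarrow> \<psi>) \<^bold>\<longrightarrow> \<phi> \<^bold>\<longrightarrow> \<chi>)"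
    using mp by (intro derivable.imp_S) simp
  from hyp.mp[OF hyp_mp_base[OF this] ] show ?case using mp by simp
qed

lemma hyp_double_neg: "hyp H (Neg (Neg \<phi>)) \<Longrightarrow> hyp H \<phi>"
  by (rule hyp.mp[OF hyp.base[OF derivable.double_neg]]) (auto dest: hyp_L)

lemma hyp_contradiction: "hyp (insert (Neg \<phi>) H) Bot \<Longrightarrow> \<phi> \<in> L \<Longrightarrow> hyp H \<phi>"
  by (rule hyp_double_neg, rule deduction) auto

lemma hyp_inst: "hyp H (All v \<phi>) \<Longrightarrow> ok (snd v) t \<Longrightarrow> free_for t v \<phi> \<Longrightarrow> hyp H (fsubst v t \<phi>)"
  using hyp_L[of H "All v \<phi>"] L_fsubst[of \<phi> v t]
  by (intro hyp.mp[OF hyp.base[OF derivable.all_inst]]) (simp_all add: ok_def L_All)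

text \<open>Both hypotheses are instantiated at \<open>v\<close> itself. As \<open>v\<close> is not
  free in them, the resulting \<open>\<psi>\<close> can be generalised again, and two uses of
  \<open>all_imp\<close> move the quantifier inwards.\<close>

lemma prv_all_mp:
  assumes "All v (\<phi> \<^bold>\<longrightarrow> \<psi>) \<in> L"
  shows "prv (All v (\<phi> \<^bold>\<longrightarrow> \<psi>) \<^bold>\<longrightarrow> All v \<phi> \<^bold>\<longrightarrow> All v \<psi>)"
proof -
  let ?A = "All v (\<phi> \<^bold>\<longrightarrow> \<psi>)" and ?B = "All v \<phi>"
  have L: "?A \<in> L" "?B \<in> L" "\<phi> \<in> L" "\<psi> \<in> L" using assms by (auto simp: L_All)
  have v: "ok (snd v) (Var v)" using assms by (auto simp: ok_Var L_All)
  have "hyp {?A, ?B} (\<phi> \<^bold>\<longrightarrow> \<psi>)" "hyp {?A, ?B} \<phi>"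
    using hyp_inst[of "{?A, ?B}" v "\<phi> \<^bold>\<longrightarrow> \<psi>" "Var v"] hyp_inst[of "{?A, ?B}" v \<phi> "Var v"] L v
    by (simp_all add: hyp.assm)
  then have "hyp {?A, ?B} \<psi>" by (rule hyp.mp)
  then have "hyp {} (?A \<^bold>\<longrightarrow> ?B \<^bold>\<longrightarrow> \<psi>)" using L by (intro deduction) (auto simp: insert_commute)
  then have "prv (All v (?A \<^bold>\<longrightarrow> ?B \<^bold>\<longrightarrow> \<psi>))"
    using L assms by (intro derivable.gen hyp_empty) (auto simp: L_All)
  then have "prv (?A \<^bold>\<longrightarrow> All v (?B \<^bold>\<longrightarrow> \<psi>))"
    using L assms by (intro derivable.mp[OF derivable.all_imp]) (auto simp: L_All)
  moreover have "prv (All v (?B \<^bold>\<longrightarrow> \<psi>) \<^bold>\<longrightarrow> ?B \<^bold>\<longrightarrow> All v \<psi>)"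
    using L assms by (intro derivable.all_imp) (auto simp: L_All)
  ultimately have "hyp {?A} (?B \<^bold>\<longrightarrow> All v \<psi>)"
    using L by (elim hyp_mp_base) (auto intro: hyp.assm)
  from hyp_empty[OF deduction[OF this]] show ?thesis using L by auto
qed

text \<open>Generalisation is not a rule of \<open>hyp\<close> and is recovered by induction on the
  derivation: hypotheses do not contain \<open>v\<close> freely, theorems are generalised in
  \<open>prv\<close>, and \<open>prv_all_mp\<close> carries the quantifier through modus
  ponens.\<close>

lemma hyp_gen:
  assumes "hyp H \<phi>" "\<forall>\<psi>\<in>H. v \<notin> fvars \<psi>" "okv v"
  shows "hyp H (All v \<phi>)"
  using assms
proof (induction rule: hyp.induct)
  case (assm \<phi>)
  then have "prv (All v (\<phi> \<^bold>\<longrightarrow> \<phi>))" by (intro derivable.gen prv_id) (auto simp: L_All)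
  then have "prv (\<phi> \<^bold>\<longrightarrow> All v \<phi>)"
    using assm by (intro derivable.mp[OF derivable.all_imp]) (auto simp: L_All)
  then show ?case using assm by (elim hyp_mp_base) (auto intro: hyp.assm)
next
  case (base \<phi>)
  then show ?case by (auto intro!: hyp.base derivable.gen simp: L_All dest: prv_L)
next
  case (mp \<phi> \<psi>)
  then have "All v (\<phi> \<^bold>\<longrightarrow> \<psi>) \<in> L" using hyp_L by blast
  from hyp.mp[OF hyp_mp_base[OF prv_all_mp[OF this] mp.IH(1)] mp.IH(2)] show ?case using mp by simp
qed

text \<open>The eigenvariable \<open>w\<close> is generalised, being fresh for the hypotheses, and
  the universal formula over \<open>w\<close> alone implies the one over \<open>v\<close>. The
  detour is made because \<open>v\<close> itself may be free in \<open>H\<close>.\<close>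

lemma hyp_rename:
  assumes "hyp H (fsubst v (Var w) \<phi>)" "All v \<phi> \<in> L" "snd w = snd v"
    "w \<notin> avars \<phi>" "w \<noteq> v" "\<forall>\<psi>\<in>H. w \<notin> fvars \<psi>"
  shows "hyp H (All v \<phi>)"
proof -
  let ?A = "All w (fsubst v (Var w) \<phi>)"
  have st: "okv v" "okv w" using assms by (auto simp: L_All okv_def)
  have A: "hyp H ?A" using assms st by (intro hyp_gen) auto
  have "hyp {?A} (fsubst w (Var v) (fsubst v (Var w) \<phi>))"
    using assms A st by (intro hyp_inst hyp.assm free_for_fsubst_fresh) (auto simp: ok_Var dest: hyp_L)
  then have "hyp {?A} \<phi>" using fsubst_fsubst_fresh assms by simp
  moreover have "v \<notin> fvars ?A" using fvars_fsubst[of v "Var w" \<phi>] assms by auto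
  ultimately have "hyp {?A} (All v \<phi>)" using st by (intro hyp_gen) auto
  then have "prv (?A \<^bold>\<longrightarrow> All v \<phi>)" using A hyp_L by (intro hyp_empty deduction) auto
  then show ?thesis using A by (rule hyp_mp_base)
qed

section \<open>The Henkin extension of a consistent set\<close>

definition consistent :: "fm set \<Rightarrow> bool" where
  "consistent H \<longleftrightarrow> \<not> hyp H Bot"

definition witness :: "fm set \<Rightarrow> var \<Rightarrow> fm \<Rightarrow> var" where
  "witness H v \<phi> = (SOME n. n \<ge> 100 \<and> (n, snd v) \<notin> insert v (avars \<phi>) \<union> (\<Union>\<psi>\<in>H. fvars \<psi>), snd v)"

lemma finite_fvars [simp]: "finite (fvars \<phi>)"
  by (rule finite_subset[OF fvars_avars]) simp

lemma witness:
  assumes "finite H"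
  shows "fst (witness H v \<phi>) \<ge> 100 \<and> witness H v \<phi> \<notin> insert v (avars \<phi>) \<union> (\<Union>\<psi>\<in>H. fvars \<psi>)"
proof -
  let ?X = "insert v (avars \<phi>) \<union> (\<Union>\<psi>\<in>H. fvars \<psi>)"
  have "finite (fst ` ?X)" using assms by auto
  then have "infinite ({100..} - fst ` ?X)" by (intro Diff_infinite_finite) (auto simp: infinite_Ici)
  then obtain n where n: "n \<in> {100..} - fst ` ?X" using infinite_imp_nonempty by blast
  then have "(n, snd v) \<notin> ?X" using image_eqI[of n fst "(n, snd v)" ?X] by auto
  then have "\<exists>n. n \<ge> 100 \<and> (n, snd v) \<notin> ?X" using n by auto
  from someI_ex[OF this] show ?thesis unfolding witness_def by simp
qed

text \<open>Lindenbaum's and Henkin's constructions in one step: when a universal formula is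
  rejected, the negation of an instance joins its negation. Variables of the language act as Henkin
  constants; a fresh one exists because every stage is finite.\<close>

fun extend :: "fm \<Rightarrow> fm set \<Rightarrow> fm set" where
  "extend \<psi> H = (if \<psi> \<notin> L then H else if consistent (insert \<psi> H) then insert \<psi> H
     else insert (Neg \<psi>) H \<union>
       (case \<psi> of All v \<phi> \<Rightarrow> {Neg (fsubst v (Var (witness (insert (Neg \<psi>) H) v \<phi>)) \<phi>)} | _ \<Rightarrow> {}))"

lemma finite_extend: "finite H \<Longrightarrow> finite (extend \<psi> H)"
  by (auto split: fm.splits)

lemma extend_L:
  assumes "H \<subseteq> L"
  shows "extend \<psi> H \<subseteq> L"
  using assms by (auto split: fm.splits simp: witness_def intro!: L_fsubst_Var)

lemma consistent_Neg:
  assumes "consistent H" "\<not> consistent (insert \<psi> H)" "\<psi> \<in> L"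
  shows "consistent (insert (Neg \<psi>) H)"
  unfolding consistent_def
proof
  assume "hyp (insert (Neg \<psi>) H) Bot"
  then have "hyp H \<psi>" using assms(3) by (rule hyp_contradiction)
  moreover have "hyp H (Neg \<psi>)" using assms by (intro deduction) (auto simp: consistent_def)
  ultimately show False using assms(1) hyp.mp[of H \<psi> Bot] unfolding consistent_def by blast
qed

lemma consistent_extend:
  assumes "consistent H" "finite H"
  shows "consistent (extend \<psi> H)"
proof (cases "\<psi> \<in> L \<and> \<not> consistent (insert \<psi> H)")
  case False
  then show ?thesis using assms by auto
next
  case True
  then have cons: "consistent (insert (Neg \<psi>) H)" using consistent_Neg assms by blast
  show ?thesis
  proof (cases "\<exists>v \<phi>. \<psi> = All v \<phi>")
    case False
    then show ?thesis using True cons by (auto split: fm.splits)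
  next
    case ex: True
    then obtain v \<phi> where \<psi>: "\<psi> = All v \<phi>" by blast
    let ?H = "insert (Neg \<psi>) H"
    define w where "w = witness ?H v \<phi>"
    have w: "w \<notin> insert v (avars \<phi>) \<union> (\<Union>\<psi>\<in>?H. fvars \<psi>)"
      using witness[of ?H v \<phi>] assms w_def by auto
    have sw: "snd w = snd v" by (simp add: w_def witness_def)
    have L: "Neg (fsubst v (Var w) \<phi>) \<in> L"
      using True sw L_fsubst_Var[of v \<phi> w] by (simp add: \<psi>)
    have "consistent (insert (Neg (fsubst v (Var w) \<phi>)) ?H)"
      unfolding consistent_def
    proof
      assume "hyp (insert (Neg (fsubst v (Var w) \<phi>)) ?H) Bot"
      then have "hyp ?H (fsubst v (Var w) \<phi>)" by (rule hyp_contradiction) (use L in auto)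
      \<comment> \<open>A derivable instance at the fresh \<open>w\<close> would give the universal
        formula, whose negation lies in \<open>?H\<close>.\<close>
      then have "hyp ?H \<psi>" using hyp_rename[of ?H v w \<phi>] w sw True by (auto simp: \<psi>)
      then have "hyp ?H Bot" using hyp.mp[OF hyp.assm[of "Neg \<psi>"]] True by auto
      then show False using cons consistent_def by auto
    qed
    then show ?thesis using True by (simp add: \<psi> w_def)
  qed
qed

lemma extend_superset: "H \<subseteq> extend \<psi> H"
  by auto

declare extend.simps [simp del]

primrec stage :: "fm set \<Rightarrow> nat \<Rightarrow> fm set" where
  "stage H 0 = H"
| "stage H (Suc n) = extend (from_nat n) (stage H n)"

lemma stage_mono: "m \<le> n \<Longrightarrow> stage H m \<subseteq> stage H n"
  by (rule lift_Suc_mono_le[where f = "stage H"]) (simp_all add: extend_superset)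

lemma stage: "finite H \<Longrightarrow> H \<subseteq> L \<Longrightarrow> consistent H \<Longrightarrow>
    finite (stage H n) \<and> stage H n \<subseteq> L \<and> consistent (stage H n)"
  by (induction n) (simp_all add: finite_extend extend_L consistent_extend)

end

context calculus
begin
text \<open>Compactness. In the case of modus ponens the later of the two stages derives both
  premises.\<close>

lemma hyp_stage: "hyp (\<Union>n. stage H n) \<phi> \<Longrightarrow> \<exists>n. hyp (stage H n) \<phi>"
proof (induction rule: hyp.induct)
  case (mp \<phi> \<psi>)
  from mp.IH obtain m n where "hyp (stage H m) (\<phi> \<^bold>\<longrightarrow> \<psi>)" "hyp (stage H n) \<phi>" by auto
  then have "hyp (stage H (max m n)) (\<phi> \<^bold>\<longrightarrow> \<psi>)" "hyp (stage H (max m n)) \<phi>"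
    using hyp_mono[OF _ stage_mono] by simp_all
  from hyp.mp[OF this] show ?case by (rule exI)
qed (auto intro: hyp.assm hyp.base)

end

text \<open>The witnesses are variables with large names, so that they are not captured by the binders in the
  formulas of interest.\<close>

locale world = calculus +
  fixes W :: "fm set"
  assumes W_L: "W \<subseteq> L"
    and W_prv: "prv \<phi> \<Longrightarrow> \<phi> \<in> W"
    and W_Bot [simp]: "Bot \<notin> W"
    and W_Imp': "(\<phi> \<^bold>\<longrightarrow> \<psi>) \<in> L \<Longrightarrow> (\<phi> \<^bold>\<longrightarrow> \<psi>) \<in> W \<longleftrightarrow> (\<phi> \<in> W \<longrightarrow> \<psi> \<in> W)"
    and W_witness: "All v \<phi> \<in> L \<Longrightarrow> All v \<phi> \<notin> W \<Longrightarrow>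
      \<exists>n\<ge>100. (n, snd v) \<notin> avars \<phi> \<and> fsubst v (Var (n, snd v)) \<phi> \<notin> W"

context calculus
begin

text \<open>The union of the stages started at \<open>Neg \<phi>\<close> is consistent by
  compactness; as it decides every formula of the language, it is closed under derivability.\<close>

lemma world_exists:
  assumes "\<phi> \<in> L" "\<not> prv \<phi>"
  shows "\<exists>W. world sf Ax W \<and> \<phi> \<notin> W"
proof -
  let ?H = "{Neg \<phi>}"
  have "consistent ?H"
    using hyp_contradiction[of \<phi> "{}"] hyp_empty[of \<phi>] assms unfolding consistent_def by auto
  then have st: "finite (stage ?H n) \<and> stage ?H n \<subseteq> L \<and> consistent (stage ?H n)" for n
    using stage[of ?H n] assms by auto
  define W where "W = (\<Union>n. stage ?H n)"
  have cons: "\<not> hyp W Bot" using hyp_stage[of ?H Bot] st by (auto simp: W_def consistent_def)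
  have WL: "W \<subseteq> L" using st by (auto simp: W_def)
  \<comment> \<open>The formula \<open>\<psi>\<close> is treated in the step that follows stage
    \<open>to_nat \<psi>\<close>, so its decision and its witness end up in the union.\<close>
  have ext: "extend \<psi> (stage ?H (to_nat \<psi>)) \<subseteq> W" for \<psi>
    using UN_upper[of "Suc (to_nat \<psi>)" UNIV "stage ?H"] by (simp add: W_def)
  have total: "\<psi> \<in> W \<or> Neg \<psi> \<in> W" if "\<psi> \<in> L" for \<psi>
    using ext[of \<psi>] that by (auto simp: extend.simps split: if_splits)
  have closed: "\<psi> \<in> W" if "hyp W \<psi>" for \<psi>
    using total[of \<psi>] hyp_L[OF that] that cons hyp.mp[OF hyp.assm[of "Neg \<psi>" W]] by auto
  have "world sf Ax W"
  proof
    show "W \<subseteq> L" by fact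
    show "\<psi> \<in> W" if "prv \<psi>" for \<psi> using that closed hyp.base by blast
    show "Bot \<notin> W" using cons by (auto intro: hyp.assm)
    show "(\<psi> \<^bold>\<longrightarrow> \<chi>) \<in> W \<longleftrightarrow> (\<psi> \<in> W \<longrightarrow> \<chi> \<in> W)" if L: "(\<psi> \<^bold>\<longrightarrow> \<chi>) \<in> L" for \<psi> \<chi>
    proof
      show "\<psi> \<in> W \<longrightarrow> \<chi> \<in> W" if "(\<psi> \<^bold>\<longrightarrow> \<chi>) \<in> W"
        using that closed hyp.mp[OF hyp.assm hyp.assm] WL by blast
      assume imp: "\<psi> \<in> W \<longrightarrow> \<chi> \<in> W"
      show "(\<psi> \<^bold>\<longrightarrow> \<chi>) \<in> W"
      proof (cases "\<psi> \<in> W")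
        case True
        then show ?thesis using imp L by (auto intro!: closed hyp_weaken intro: hyp.assm)
      next
        case False
        then have "Neg \<psi> \<in> W" using total L by auto
        then have "hyp (insert (Neg \<chi>) (insert \<psi> W)) Bot"
          using hyp.mp[OF hyp.assm[of "Neg \<psi>"] hyp.assm[of \<psi>]] L by auto
        then have "hyp (insert \<psi> W) \<chi>" by (rule hyp_contradiction) (use L in auto)
        then show ?thesis using L by (auto intro!: closed deduction)
      qed
    qed
    show "\<exists>n\<ge>100. (n, snd v) \<notin> avars \<psi> \<and> fsubst v (Var (n, snd v)) \<psi> \<notin> W"
      if L: "All v \<psi> \<in> L" and notin: "All v \<psi> \<notin> W" for v \<psi>
    proof -
      let ?S = "stage ?H (to_nat (All v \<psi>))"
      let ?w = "witness (insert (Neg (All v \<psi>)) ?S) v \<psi>"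
      have "Neg (fsubst v (Var ?w) \<psi>) \<in> W"
        using ext[of "All v \<psi>"] L notin by (auto simp: extend.simps split: if_splits)
      then have "fsubst v (Var ?w) \<psi> \<notin> W"
        using cons hyp.mp[OF hyp.assm hyp.assm] WL by blast
      moreover have "?w = (fst ?w, snd v)" by (simp add: witness_def)
      moreover have "fst ?w \<ge> 100 \<and> ?w \<notin> avars \<psi>"
        using witness[of "insert (Neg (All v \<psi>)) ?S" v \<psi>] st by auto
      ultimately show ?thesis by metis
    qed
  qed
  moreover have "Neg \<phi> \<in> W" using UN_upper[of 0 UNIV "stage ?H"] by (auto simp: W_def)
  then have "\<phi> \<notin> W" using cons hyp.mp[OF hyp.assm hyp.assm] WL by blast
  ultimately show ?thesis by blast
qed

theorem completeness: "\<phi> \<in> L \<Longrightarrow> (\<And>W. world sf Ax W \<Longrightarrow> \<phi> \<in> W) \<Longrightarrow> prv \<phi>"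
  using world_exists by blast

end

section \<open>Extensional equality and beta conversion\<close>

text \<open>Iterated beta conversion produces a simultaneous substitution, since the arguments of an
  abstraction may share variables with its body.\<close>

primrec sub :: "(var \<Rightarrow> tm) \<Rightarrow> tm \<Rightarrow> tm" where
  "sub \<sigma> (Var v) = \<sigma> v"
| "sub \<sigma> (Cst c) = Cst c"
| "sub \<sigma> (s \<cdot> t) = sub \<sigma> s \<cdot> sub \<sigma> t"

lemma sub_cong: "(\<And>v. v \<in> tvars t \<Longrightarrow> \<sigma> v = \<tau> v) \<Longrightarrow> sub \<sigma> t = sub \<tau> t"
  by (induction t) auto

lemma sub_Var [simp]: "sub Var t = t"
  by (induction t) auto

lemma sub_closed: "tvars t = {} \<Longrightarrow> sub \<sigma> t = t"
  using sub_cong[of t \<sigma> Var] by simp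

lemma sub_sub: "sub \<sigma> (sub \<tau> t) = sub (\<lambda>v. sub \<sigma> (\<tau> v)) t"
  by (induction t) auto

lemma tsubst_eq_sub: "tsubst v r t = sub (Var(v := r)) t"
  by (induction t) auto

lemma sub_upd_fresh: "v \<notin> tvars t \<Longrightarrow> sub (\<sigma>(v := u)) t = sub \<sigma> t"
  by (rule sub_cong) auto

lemma tvars_lam [simp]: "tvars (lam v t) = tvars t - {v}"
  by (induction t) auto

lemma tvars_lams [simp]: "tvars (lams vs t) = tvars t - set vs"
  by (induction vs) (auto simp: lams_def)

text \<open>At these types, extensional equality amounts to equations between numeric terms.\<close>

primrec nres :: "ty \<Rightarrow> bool" where
  "nres N = True"
| "nres (\<rho> \<rightarrow> \<tau>) = nres \<tau>"
| "nres (Seq \<sigma>) = False"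

lemma star_free_nres: "star_free \<rho> \<Longrightarrow> nres \<rho>"
  by (induction \<rho>) auto

lemma star_free_lam: "star_free_tm t \<Longrightarrow> wt t \<Longrightarrow> star_free (snd v) \<Longrightarrow> star_free_tm (lam v t)"
proof (induction t)
  case (App s t)
  then have "star_free (ttype (s \<cdot> t))" "star_free (ttype t)"
    using star_free_ttype[of "s \<cdot> t"] star_free_ttype[of t] by simp_all
  then show ?case using App by simp
qed auto

lemma wt_lam: "wt t \<Longrightarrow> wt (lam v t) \<and> ttype (lam v t) = (snd v \<rightarrow> ttype t)"
  by (induction t) (auto split: ty.splits)

lemma wt_lams: "wt t \<Longrightarrow> wt (lams vs t) \<and> ttype (lams vs t) = foldr (\<lambda>v. Fun (snd v)) vs (ttype t)"
  by (induction vs) (auto simp: lams_def wt_lam)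

lemma star_free_lams: "star_free_tm t \<Longrightarrow> wt t \<Longrightarrow> \<forall>v\<in>set vs. star_free (snd v) \<Longrightarrow> star_free_tm (lams vs t)"
  using wt_lams[of t] by (induction vs) (auto simp: lams_def intro!: star_free_lam)

lemma max_name: "v \<in> tvars t \<Longrightarrow> fst v \<le> max_name t"
  by (induction t) auto

lemma fresh: "(fresh s t, \<rho>) \<notin> tvars s" "(fresh s t, \<rho>) \<notin> tvars t"
  using max_name[of "(fresh s t, \<rho>)"] by (fastforce simp: fresh_def)+

context calculus
begin

lemma ok_App_iff: "ok \<tau> (s \<cdot> t) \<longleftrightarrow> (\<exists>\<rho>. ok (\<rho> \<rightarrow> \<tau>) s \<and> ok \<rho> t)"
  by (auto simp: ok_def split: ty.splits)

lemma ok_star_free: "wt t \<Longrightarrow> star_free_tm t \<Longrightarrow> ttype t = \<rho> \<Longrightarrow> ok \<rho> t"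
  by (simp add: ok_def)

lemma okv_tvars: "ok \<rho> t \<Longrightarrow> v \<in> tvars t \<Longrightarrow> okv v"
  by (induction t arbitrary: \<rho>) (auto simp: ok_Var ok_App_iff)

lemma ok_okv: "ok (snd v) r \<Longrightarrow> okv v"
  using star_free_ttype[of r] by (auto simp: ok_def okv_def)

lemma ok_okv': "ok (\<rho> \<rightarrow> \<tau>) r \<Longrightarrow> okv (n, \<rho>)"
  using star_free_ttype[of r] by (auto simp: ok_def okv_def)

definition oks :: "(var \<Rightarrow> tm) \<Rightarrow> bool" where
  "oks \<sigma> \<longleftrightarrow> (\<forall>v. okv v \<longrightarrow> ok (snd v) (\<sigma> v))"

lemma oks_Var [simp]: "oks Var"
  by (simp add: oks_def ok_Var)

lemma oks_upd: "oks \<sigma> \<Longrightarrow> ok (snd v) u \<Longrightarrow> oks (\<sigma>(v := u))"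
  unfolding oks_def by (metis fun_upd_apply)

lemma ok_sub: "ok \<rho> t \<Longrightarrow> oks \<sigma> \<Longrightarrow> ok \<rho> (sub \<sigma> t)"
  by (induction t arbitrary: \<rho>) (auto simp: ok_App_iff ok_Var oks_def ok_def[of _ "Cst _"])

lemma prv_tsubst: "prv (Eq a b) \<Longrightarrow> ok (snd v) r \<Longrightarrow> prv (Eq (tsubst v r a) (tsubst v r b))"
  using hyp_inst[OF hyp_gen[OF hyp.base, of "Eq a b" "{}" v], of r] ok_okv[of v r] hyp_empty by simp

text \<open>As no inserted term contains a variable of \<open>X\<close>, the simultaneous
  substitution can be carried out one variable at a time.\<close>

lemma prv_sub_disjoint:
  assumes "finite X" "\<And>v. v \<in> X \<Longrightarrow> ok (snd v) (\<sigma> v)" "\<And>v. v \<in> X \<Longrightarrow> tvars (\<sigma> v) \<inter> X = {}" "prv (Eq a b)"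
  shows "prv (Eq (sub (\<lambda>v. if v \<in> X then \<sigma> v else Var v) a) (sub (\<lambda>v. if v \<in> X then \<sigma> v else Var v) b))"
  using assms
proof (induction X arbitrary: a b)
  case empty
  then show ?case by simp
next
  case (insert x X)
  have [simp]: "sub (\<lambda>v. if v \<in> X then \<sigma> v else Var v) (\<sigma> x) = \<sigma> x"
    using insert.prems(2)[of x] by (subst sub_cong[of _ _ Var]) auto
  have *: "sub (\<lambda>v. if v \<in> X then \<sigma> v else Var v) (tsubst x (\<sigma> x) t) =
      sub (\<lambda>v. if v \<in> insert x X then \<sigma> v else Var v) t" for t
    unfolding tsubst_eq_sub sub_sub using insert.hyps by (intro sub_cong) auto
  have "prv (Eq (tsubst x (\<sigma> x) a) (tsubst x (\<sigma> x) b))" using insert.prems by (intro prv_tsubst) auto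
  from insert.IH[OF _ _ this, unfolded *] show ?case using insert.prems by blast
qed

text \<open>In general an inserted term may contain a variable that is still to be replaced. Hence
  the variables of the equation are first renamed beyond every name in play; both the renaming and
  the substitution after it are of the disjoint kind.\<close>

lemma prv_sub:
  assumes "prv (Eq a b)" "oks \<sigma>"
  shows "prv (Eq (sub \<sigma> a) (sub \<sigma> b))"
proof -
  let ?X = "tvars a \<union> tvars b"
  \<comment> \<open>The pair \<open>(0, N)\<close> keeps the set nonempty when the equation is
    closed.\<close>
  define n where "n = Suc (Max (fst ` (?X \<union> (\<Union>v\<in>?X. tvars (\<sigma> v)) \<union> {(0, N)})))"
  have n: "fst w < n" if "w \<in> ?X \<union> (\<Union>v\<in>?X. tvars (\<sigma> v))" for w
    unfolding n_def less_Suc_eq_le using that by (intro Max_ge) auto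
  let ?s = "\<lambda>v. (fst v + n, snd v)" and ?r = "\<lambda>v. (fst v - n, snd v)"
  have okX: "okv v" if "v \<in> ?X" for v using that prv_L[OF assms(1)] okv_tvars[of N a v] okv_tvars[of N b v] by (auto simp: L_Eq)
  have 1: "prv (Eq (sub (\<lambda>v. if v \<in> ?X then Var (?s v) else Var v) a)
      (sub (\<lambda>v. if v \<in> ?X then Var (?s v) else Var v) b))" (is "prv (Eq ?a ?b)")
  proof (rule prv_sub_disjoint)
    fix v assume v: "v \<in> ?X"
    then show "ok (snd v) (Var (?s v))" using okX[OF v] by (simp add: ok_Var okv_def)
    show "tvars (Var (?s v)) \<inter> ?X = {}" using n[of "?s v"] by fastforce
  qed (use assms in auto)
  have 2: "prv (Eq (sub (\<lambda>v. if v \<in> ?s ` ?X then \<sigma> (?r v) else Var v) ?a)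
      (sub (\<lambda>v. if v \<in> ?s ` ?X then \<sigma> (?r v) else Var v) ?b))"
  proof (rule prv_sub_disjoint[OF _ _ _ 1])
    fix v assume "v \<in> ?s ` ?X"
    then obtain w where w: "w \<in> ?X" "v = ?s w" by blast
    then have "ok (snd w) (\<sigma> w)" using okX[of w] assms(2) unfolding oks_def by blast
    then show "ok (snd v) (\<sigma> (?r v))" using w by simp
    show "tvars (\<sigma> (?r v)) \<inter> ?s ` ?X = {}" using n w by fastforce
  qed auto
  have "sub (\<lambda>v. if v \<in> ?s ` ?X then \<sigma> (?r v) else Var v) (sub (\<lambda>v. if v \<in> ?X then Var (?s v) else Var v) t) = sub \<sigma> t"
    if "tvars t \<subseteq> ?X" for t
    unfolding sub_sub using that by (intro sub_cong) auto
  then show ?thesis using 2 by simp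
qed

text \<open>Extensional equality stated outside the calculus: the arguments are arbitrary terms,
  which avoids the fresh bound variables of \<open>eq\<close>. It is meant for types with numeric
  result, whence the value at \<open>Seq\<close>.\<close>

primrec eqv :: "ty \<Rightarrow> tm \<Rightarrow> tm \<Rightarrow> bool" where
  "eqv N s t = prv (Eq s t)"
| "eqv (\<rho> \<rightarrow> \<tau>) s t = (\<forall>u. ok \<rho> u \<longrightarrow> eqv \<tau> (s \<cdot> u) (t \<cdot> u))"
| "eqv (Seq \<sigma>) s t = False"

lemma prv_ax: "\<phi> \<in> E_PRA \<Longrightarrow> \<phi> \<in> L \<Longrightarrow> prv \<phi>"
  using E_PRA_Ax by (auto intro: derivable.axiom)

lemma eq_L: "nres \<rho> \<Longrightarrow> ok \<rho> s \<Longrightarrow> ok \<rho> t \<Longrightarrow> eq \<rho> s t \<in> L"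
proof (induction \<rho> arbitrary: s t)
  case (Fun \<rho> \<tau>)
  let ?v = "(fresh s t, \<rho>)"
  have "okv ?v" using Fun.prems ok_okv' by blast
  then have "eq \<tau> (s \<cdot> Var ?v) (t \<cdot> Var ?v) \<in> L"
    using Fun by (intro Fun.IH) (auto simp: ok_Var intro!: ok_app)
  then show ?case using \<open>okv ?v\<close> by (simp add: L_All Let_def)
qed (auto simp: L_Eq)

lemma eqv_refl: "nres \<rho> \<Longrightarrow> ok \<rho> s \<Longrightarrow> eqv \<rho> s s"
  by (induction \<rho> arbitrary: s) (auto intro!: prv_ax E_PRA.intros ok_app simp: L_Eq)

lemma eqv_trans: "eqv \<rho> r s \<Longrightarrow> eqv \<rho> s t \<Longrightarrow> eqv \<rho> r t"
proof (induction \<rho> arbitrary: r s t)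
  case N
  then show ?case using prv_L[of "Eq r s"] prv_L[of "Eq s t"]
    derivable.mp[OF derivable.mp[OF prv_ax[OF E_PRA.Eq_trans[of r s t]]]] by (simp add: L_Eq)
next
  case (Fun \<rho> \<tau>)
  have "eqv \<tau> (r \<cdot> u) (t \<cdot> u)" if "ok \<rho> u" for u
    using Fun.IH(2)[of "r \<cdot> u" "s \<cdot> u" "t \<cdot> u"] Fun.prems that by simp
  then show ?case by simp
qed simp

text \<open>The substitution is there for the induction: the bound variable of \<open>eq\<close> is
  opened as a free one, and \<open>\<sigma>\<close> sends it to the argument \<open>u\<close>. Thus
  \<open>u\<close> may contain variables that are bound further inside.\<close>

lemma prv_eq_eqv: "prv (eq \<tau> s t) \<Longrightarrow> nres \<tau> \<Longrightarrow> oks \<sigma> \<Longrightarrow> eqv \<tau> (sub \<sigma> s) (sub \<sigma> t)"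
proof (induction \<tau> arbitrary: s t \<sigma>)
  case (Fun \<rho> \<tau>)
  let ?v = "(fresh s t, \<rho>)"
  have "prv (All ?v (eq \<tau> (s \<cdot> Var ?v) (t \<cdot> Var ?v)))" using Fun.prems by (simp add: Let_def)
  moreover from prv_L[OF this] have "ok \<rho> (Var ?v)" by (simp add: ok_Var L_All)
  ultimately have prv: "prv (eq \<tau> (s \<cdot> Var ?v) (t \<cdot> Var ?v))"
    using hyp_inst[OF hyp.base, of ?v _ "Var ?v" "{}"] hyp_empty by simp
  have "eqv \<tau> (sub (\<sigma>(?v := u)) (s \<cdot> Var ?v)) (sub (\<sigma>(?v := u)) (t \<cdot> Var ?v))" if "ok \<rho> u" for u
    using Fun.prems that by (intro Fun.IH(2)[OF prv] oks_upd) auto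
  then show ?case by (auto simp: sub_upd_fresh fresh)
qed (auto intro: prv_sub)

lemma eqv_prv_eq: "eqv \<tau> s t \<Longrightarrow> ok \<tau> s \<Longrightarrow> ok \<tau> t \<Longrightarrow> nres \<tau> \<Longrightarrow> prv (eq \<tau> s t)"
proof (induction \<tau> arbitrary: s t)
  case (Fun \<rho> \<tau>)
  let ?v = "(fresh s t, \<rho>)"
  have v: "okv ?v" using Fun.prems ok_okv' by blast
  then have "prv (eq \<tau> (s \<cdot> Var ?v) (t \<cdot> Var ?v))"
    using Fun by (intro Fun.IH(2)) (auto simp: ok_Var intro!: ok_app)
  then show ?case using v prv_L by (auto simp: Let_def L_All intro!: derivable.gen)
qed auto

lemma prv_eq_eqv': "prv (eq \<tau> s t) \<Longrightarrow> nres \<tau> \<Longrightarrow> eqv \<tau> s t"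
  using prv_eq_eqv[of \<tau> s t Var] by simp

lemma eqv_arg:
  assumes "ok (\<rho> \<rightarrow> \<tau>) g" "eqv \<rho> s t" "ok \<rho> s" "ok \<rho> t" "nres \<rho>" "nres \<tau>"
  shows "eqv \<tau> (g \<cdot> s) (g \<cdot> t)"
proof -
  have "(eq \<rho> s t \<^bold>\<longrightarrow> eq \<tau> (g \<cdot> s) (g \<cdot> t)) \<in> L"
    using assms by (auto intro!: eq_L ok_app)
  then have "prv (eq \<rho> s t \<^bold>\<longrightarrow> eq \<tau> (g \<cdot> s) (g \<cdot> t))" by (intro prv_ax E_PRA.extensionality)
  from derivable.mp[OF this eqv_prv_eq] show ?thesis using assms by (intro prv_eq_eqv') auto
qed

lemma eqv_app:
  assumes "eqv (\<rho> \<rightarrow> \<tau>) g h" "eqv \<rho> s t" "ok (\<rho> \<rightarrow> \<tau>) h" "ok \<rho> s" "ok \<rho> t" "nres \<rho>" "nres \<tau>"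
  shows "eqv \<tau> (g \<cdot> s) (h \<cdot> t)"
  using assms eqv_arg[of \<rho> \<tau> h s t] eqv_trans[of \<tau> "g \<cdot> s" "h \<cdot> s" "h \<cdot> t"] by auto

section \<open>The combinator equations and beta conversion\<close>

lemma eqv_K:
  assumes "ok \<rho> s" "ok \<tau> t" "nres \<rho>"
  shows "eqv \<rho> (Cst (K \<rho> \<tau>) \<cdot> s \<cdot> t) s"
proof -
  have "ok \<rho> (Cst (K \<rho> \<tau>) \<cdot> s \<cdot> t)" using assms star_free_ttype by (auto simp: ok_def)
  then show ?thesis using assms by (intro prv_eq_eqv' prv_ax E_PRA.K_eq eq_L)
qed

lemma eqv_S:
  assumes "ok (\<delta> \<rightarrow> \<rho> \<rightarrow> \<tau>) r" "ok (\<delta> \<rightarrow> \<rho>) s" "ok \<delta> t" "nres \<tau>"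
  shows "eqv \<tau> (Cst (S \<delta> \<rho> \<tau>) \<cdot> r \<cdot> s \<cdot> t) (r \<cdot> t \<cdot> (s \<cdot> t))"
proof -
  have "star_free (\<delta> \<rightarrow> \<rho> \<rightarrow> \<tau>)" if sf
    using assms(1) that unfolding ok_def by (metis star_free_ttype)
  then have "ok \<tau> (Cst (S \<delta> \<rho> \<tau>) \<cdot> r \<cdot> s \<cdot> t)" using assms by (auto simp: ok_def)
  moreover have "ok \<tau> (r \<cdot> t \<cdot> (s \<cdot> t))" using assms by (intro ok_app)
  ultimately show ?thesis using assms by (intro prv_eq_eqv' prv_ax E_PRA.S_eq eq_L)
qed

lemma ok_lam: "wt t \<Longrightarrow> star_free_tm t \<Longrightarrow> star_free (snd v) \<Longrightarrow> ok (snd v \<rightarrow> ttype t) (lam v t)"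
  by (simp add: ok_def wt_lam star_free_lam)

text \<open>Induction along the definition of \<open>lam\<close>. Abstractions contain no binders,
  so \<open>\<sigma>\<close> can supply the remaining variables without capture, which is what
  nested abstractions require. Star-freeness ensures that the combinator equations are used only at
  types with numeric result.\<close>

lemma beta:
  assumes "wt t" "star_free_tm t" "star_free (snd v)" "oks \<sigma>" "ok (snd v) u"
  shows "eqv (ttype t) (sub \<sigma> (lam v t) \<cdot> u) (sub (\<sigma>(v := u)) t)"
  using assms(1,2)
proof (induction t)
  case (Var w)
  have nres: "nres (snd v)" "nres (snd w)" using Var assms star_free_nres by auto
  show ?case
  proof (cases "w = v")
    case True
    let ?\<rho> = "snd v"
    have ok: "ok (?\<rho> \<rightarrow> ?\<rho>) (Cst (K ?\<rho> ?\<rho>) \<cdot> u)" "ok (?\<rho> \<rightarrow> (?\<rho> \<rightarrow> ?\<rho>) \<rightarrow> ?\<rho>) (Cst (K ?\<rho> (?\<rho> \<rightarrow> ?\<rho>)))"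
      "ok (?\<rho> \<rightarrow> ?\<rho> \<rightarrow> ?\<rho>) (Cst (K ?\<rho> ?\<rho>))"
      using assms star_free_ttype by (auto simp: ok_def)
    have "eqv ?\<rho> (sub \<sigma> (lam v (Var w)) \<cdot> u) (Cst (K ?\<rho> (?\<rho> \<rightarrow> ?\<rho>)) \<cdot> u \<cdot> (Cst (K ?\<rho> ?\<rho>) \<cdot> u))"
      using eqv_S[OF ok(2,3) assms(5)] nres True by simp
    moreover have "eqv ?\<rho> (Cst (K ?\<rho> (?\<rho> \<rightarrow> ?\<rho>)) \<cdot> u \<cdot> (Cst (K ?\<rho> ?\<rho>) \<cdot> u)) u"
      using eqv_K assms(5) ok(1) nres by blast
    ultimately show ?thesis using True eqv_trans by simp
  next
    case False
    have "okv w" using Var by (simp add: okv_def)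
    then have "ok (snd w) (\<sigma> w)" using assms(4) unfolding oks_def by blast
    then show ?thesis using False eqv_K[of "snd w" "\<sigma> w" "snd v" u] assms nres by simp
  qed
next
  case (Cst c)
  then show ?case using eqv_K[of "ctype c" "Cst c" "snd v" u] assms star_free_nres
    by (auto simp: ok_def)
next
  case (App s t)
  obtain \<rho> \<tau> where ty: "ttype s = (\<rho> \<rightarrow> \<tau>)" "ttype t = \<rho>" using App.prems by (auto split: ty.splits)
  have st: "wt s" "star_free_tm s" "wt t" "star_free_tm t" using App.prems by auto
  have nres: "nres \<rho>" "nres \<tau>" using star_free_ttype[of s] st ty star_free_nres by auto
  have oks: "oks (\<sigma>(v := u))" using assms by (intro oks_upd)
  have ok: "ok (\<rho> \<rightarrow> \<tau>) (sub \<sigma> s)" "ok (\<rho> \<rightarrow> \<tau>) (sub (\<sigma>(v := u)) s)" "ok \<rho> (sub \<sigma> t)" "ok \<rho> (sub (\<sigma>(v := u)) t)"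
    using st ty oks assms(4) by (auto intro!: ok_sub ok_star_free)
  show ?case
  proof (cases "v \<in> tvars (s \<cdot> t)")
    case True
    have lam: "ok (snd v \<rightarrow> \<rho> \<rightarrow> \<tau>) (sub \<sigma> (lam v s))" "ok (snd v \<rightarrow> \<rho>) (sub \<sigma> (lam v t))"
      using st ty assms(4) ok_lam[of s v] ok_lam[of t v] assms(3) by (auto intro!: ok_sub)
    have "eqv \<tau> (sub \<sigma> (lam v (s \<cdot> t)) \<cdot> u) (sub \<sigma> (lam v s) \<cdot> u \<cdot> (sub \<sigma> (lam v t) \<cdot> u))"
      using eqv_S[OF lam assms(5)] nres True ty by simp
    moreover have "eqv (\<rho> \<rightarrow> \<tau>) (sub \<sigma> (lam v s) \<cdot> u) (sub (\<sigma>(v := u)) s)"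
      "eqv \<rho> (sub \<sigma> (lam v t) \<cdot> u) (sub (\<sigma>(v := u)) t)"
      using App.IH st ty by metis+
    then have "eqv \<tau> (sub \<sigma> (lam v s) \<cdot> u \<cdot> (sub \<sigma> (lam v t) \<cdot> u)) (sub (\<sigma>(v := u)) s \<cdot> sub (\<sigma>(v := u)) t)"
      by (rule eqv_app[OF _ _ ok(2) ok_app[OF lam(2) assms(5)] ok(4) nres])
    ultimately have "eqv \<tau> (sub \<sigma> (lam v (s \<cdot> t)) \<cdot> u) (sub (\<sigma>(v := u)) s \<cdot> sub (\<sigma>(v := u)) t)"
      by (blast intro: eqv_trans)
    then show ?thesis by (simp only: ttype.simps ty ty.case sub.simps)
  next
    case False
    have "ok \<tau> (sub \<sigma> s \<cdot> sub \<sigma> t)" using ok by (intro ok_app)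
    from eqv_K[OF this assms(5) nres(2)]
    have "eqv \<tau> (sub \<sigma> (lam v (s \<cdot> t)) \<cdot> u) (sub \<sigma> (s \<cdot> t))" using False ty by simp
    then show ?thesis using ty by (simp only: sub_upd_fresh[OF False] ttype.simps ty.case)
  qed
qed

fun upds :: "(var \<Rightarrow> tm) \<Rightarrow> var list \<Rightarrow> tm list \<Rightarrow> var \<Rightarrow> tm" where
  "upds \<sigma> (v # vs) (u # us) = upds (\<sigma>(v := u)) vs us"
| "upds \<sigma> _ _ = \<sigma>"

lemma eqv_foldl: "eqv (foldr Fun \<rho>s \<tau>) s t \<Longrightarrow> list_all2 ok \<rho>s us \<Longrightarrow> eqv \<tau> (foldl App s us) (foldl App t us)"
proof (induction us arbitrary: \<rho>s s t)
  case (Cons u us)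
  then obtain \<rho> \<rho>s' where "\<rho>s = \<rho> # \<rho>s'" by (auto simp: list_all2_Cons2)
  then show ?case using Cons.prems Cons.IH[of \<rho>s' "s \<cdot> u" "t \<cdot> u"] by simp
qed simp

lemma beta_lams:
  assumes "wt t" "star_free_tm t" "\<forall>v\<in>set vs. star_free (snd v)" "oks \<sigma>"
    "list_all2 ok (map snd vs) us"
  shows "eqv (ttype t) (foldl App (sub \<sigma> (lams vs t)) us) (sub (upds \<sigma> vs us) t)"
  using assms(3-5)
proof (induction vs arbitrary: \<sigma> us)
  case Nil
  then show ?case using assms(1,2) star_free_ttype star_free_nres
    by (auto simp: lams_def intro!: eqv_refl ok_sub ok_star_free)
next
  case (Cons v vs)
  then obtain u us' where us: "us = u # us'" "ok (snd v) u" "list_all2 ok (map snd vs) us'"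
    by (auto simp: list_all2_Cons1)
  have lams: "lams (v # vs) t = lam v (lams vs t)" by (simp add: lams_def)
  have ty: "ttype (lams vs t) = foldr Fun (map snd vs) (ttype t)"
    using wt_lams[OF assms(1)] by (simp add: foldr_map comp_def)
  have "eqv (foldr Fun (map snd vs) (ttype t)) (sub \<sigma> (lam v (lams vs t)) \<cdot> u) (sub (\<sigma>(v := u)) (lams vs t))"
    using beta[of "lams vs t" v \<sigma> u] Cons us(2) assms(1,2) wt_lams star_free_lams ty by auto
  from eqv_foldl[OF this us(3)]
  have "eqv (ttype t) (foldl App (sub \<sigma> (lams (v # vs) t)) us) (foldl App (sub (\<sigma>(v := u)) (lams vs t)) us')"
    by (simp add: us(1) lams)
  moreover have "eqv (ttype t) (foldl App (sub (\<sigma>(v := u)) (lams vs t)) us') (sub (upds \<sigma> (v # vs) us) t)"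
    using Cons us oks_upd by simp
  ultimately show ?case by (rule eqv_trans)
qed

end

section \<open>The values of numeric terms in a world\<close>

lemma wt_lams' [simp]: "wt t \<Longrightarrow> wt (lams vs t)"
  "wt t \<Longrightarrow> ttype (lams vs t) = foldr (\<lambda>v. Fun (snd v)) vs (ttype t)"
  using wt_lams by auto

lemma star_free_lams' [simp]:
  "wt t \<Longrightarrow> star_free_tm t \<Longrightarrow> \<forall>v\<in>set vs. star_free (snd v) \<Longrightarrow> star_free_tm (lams vs t)"
  by (rule star_free_lams)

context calculus
begin

lemma ok_zero [simp]: "ok N zero"
  by (rule ok_star_free) auto

lemma ok_Succ [simp]: "ok (N \<rightarrow> N) (Cst Succ)"
  by (rule ok_star_free) auto

lemma ok_suc [simp]: "ok N t \<Longrightarrow> ok N (suc t)"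
  by (rule ok_app[of N]) auto

lemma ok_num [simp]: "ok N (num n)"
  by (induction n) auto

end

context world
begin

lemma W_ax: "\<phi> \<in> E_PRA \<Longrightarrow> \<phi> \<in> L \<Longrightarrow> \<phi> \<in> W"
  by (intro W_prv prv_ax)

lemma W_Imp [simp]: "\<phi> \<in> L \<Longrightarrow> \<psi> \<in> L \<Longrightarrow> (\<phi> \<^bold>\<longrightarrow> \<psi>) \<in> W \<longleftrightarrow> (\<phi> \<in> W \<longrightarrow> \<psi> \<in> W)"
  by (rule W_Imp') simp

lemma W_mp: "(\<phi> \<^bold>\<longrightarrow> \<psi>) \<in> W \<Longrightarrow> \<phi> \<in> W \<Longrightarrow> \<psi> \<in> W"
  using W_L W_Imp' by blast

lemma W_inst:
  assumes "All v \<phi> \<in> W" "ok (snd v) t" "free_for t v \<phi>"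
  shows "fsubst v t \<phi> \<in> W"
proof (rule W_mp[OF W_prv assms(1)])
  have "All v \<phi> \<in> L" using assms(1) W_L by blast
  then have "(All v \<phi> \<^bold>\<longrightarrow> fsubst v t \<phi>) \<in> L" using assms(2) by (auto simp: L_All intro: L_fsubst)
  then show "prv (All v \<phi> \<^bold>\<longrightarrow> fsubst v t \<phi>)"
    using assms by (intro derivable.all_inst) (auto simp: ok_def)
qed

section \<open>The classes of numeric terms as numbers\<close>

definition cls :: "tm \<Rightarrow> tm set" where
  "cls s = {t. ok N t \<and> Eq s t \<in> W}"

text \<open>The classes are enumerated by natural numbers so that every element of the type \<open>nat\<close> is a value
  and the laws of arithmetic need no membership conditions. The order of the enumeration is irrelevant.\<close>

definition V :: "tm \<Rightarrow> nat" where
  "V s = to_nat_on (cls ` {t. ok N t}) (cls s)"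

lemma Eq_refl_W: "ok N s \<Longrightarrow> Eq s s \<in> W"
  by (intro W_ax E_PRA.Eq_refl) (simp add: L_Eq)

lemma Eq_sym_W: "ok N s \<Longrightarrow> ok N t \<Longrightarrow> Eq s t \<in> W \<Longrightarrow> Eq t s \<in> W"
  by (rule W_mp[OF W_ax[OF E_PRA.Eq_sym]]) (simp_all add: L_Eq)

lemma Eq_trans_W: "ok N r \<Longrightarrow> ok N s \<Longrightarrow> ok N t \<Longrightarrow> Eq r s \<in> W \<Longrightarrow> Eq s t \<in> W \<Longrightarrow> Eq r t \<in> W"
  by (rule W_mp[OF W_mp[OF W_ax[OF E_PRA.Eq_trans]]]) (simp_all add: L_Eq)

lemma cls_eq_iff: "ok N s \<Longrightarrow> ok N t \<Longrightarrow> cls s = cls t \<longleftrightarrow> Eq s t \<in> W"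
  unfolding cls_def using Eq_refl_W Eq_sym_W Eq_trans_W by blast

lemma V_eq_iff: "ok N s \<Longrightarrow> ok N t \<Longrightarrow> V s = V t \<longleftrightarrow> Eq s t \<in> W"
  unfolding V_def by (subst inj_on_eq_iff[OF inj_on_to_nat_on]) (auto simp: cls_eq_iff)

text \<open>Provides infinitely many classes, which makes their enumeration reach every natural
  number in \<open>V_surj\<close>.\<close>

lemma V_num_inj: "V (num m) = V (num n) \<Longrightarrow> m = n"
proof (induction m arbitrary: n)
  case 0
  then show ?case
  proof (cases n)
    case (Suc k)
    have "Neg (Eq (suc (num k)) zero) \<in> W" by (intro W_ax E_PRA.Succ_not_zero) (simp add: L_Eq)
    then show ?thesis using 0 Suc by (simp add: V_eq_iff[symmetric] L_Eq)
  qed simp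
next
  case (Suc m)
  have ne: "V (suc (num m)) \<noteq> V zero"
  proof -
    have "Neg (Eq (suc (num m)) zero) \<in> W" by (intro W_ax E_PRA.Succ_not_zero) (simp add: L_Eq)
    then show ?thesis by (simp add: V_eq_iff L_Eq)
  qed
  show ?case
  proof (cases n)
    case 0
    then show ?thesis using Suc ne by simp
  next
    case (Suc k)
    have "(Eq (suc (num m)) (suc (num k)) \<^bold>\<longrightarrow> Eq (num m) (num k)) \<in> W"
      by (intro W_ax E_PRA.Succ_inj) (simp add: L_Eq)
    then show ?thesis using Suc.prems Suc.IH[of k] Suc by (simp add: V_eq_iff L_Eq)
  qed
qed

lemma V_surj: "\<exists>t. ok N t \<and> V t = a"
proof -
  let ?U = "cls ` {t. ok N t}"
  have "inj (\<lambda>n. cls (num n))"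
    using V_num_inj by (auto simp: V_def inj_def)
  then have "infinite (range (\<lambda>n. cls (num n)))" by (rule range_inj_infinite)
  moreover have "range (\<lambda>n. cls (num n)) \<subseteq> ?U" by auto
  ultimately have "infinite ?U" using finite_subset by blast
  then have "bij_betw (to_nat_on ?U) ?U UNIV" by (intro to_nat_on_infinite) auto
  then obtain c where "c \<in> ?U" "to_nat_on ?U c = a" by (metis UNIV_I bij_betw_imp_surj_on imageE)
  then show ?thesis by (auto simp: V_def)
qed

definition R :: "nat \<Rightarrow> tm" where
  "R a = (SOME t. ok N t \<and> V t = a)"

lemma ok_R [simp]: "ok N (R a)" and V_R [simp]: "V (R a) = a"
  using someI_ex[OF V_surj[of a]] by (auto simp: R_def)

lemma V_eqv: "eqv N s t \<Longrightarrow> V s = V t"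
  using W_prv[of "Eq s t"] prv_L[of "Eq s t"] by (simp add: V_eq_iff L_Eq)

lemma V_arg: "ok (N \<rightarrow> N) g \<Longrightarrow> ok N s \<Longrightarrow> ok N t \<Longrightarrow> V s = V t \<Longrightarrow> V (g \<cdot> s) = V (g \<cdot> t)"
  using W_ax[OF E_PRA.extensionality[of N s t N g]] ok_app[of N N g]
  by (simp add: V_eq_iff L_Eq)

text \<open>Extensionality speaks about the argument of a function, so the position to be changed is
  abstracted first; beta conversion then reaches any numeric position in a term.\<close>

lemma V_context:
  assumes "wt b" "star_free_tm b" "ttype b = N" "oks \<sigma>" "ok N s" "ok N t" "V s = V t"
  shows "V (sub (\<sigma>((n, N) := s)) b) = V (sub (\<sigma>((n, N) := t)) b)"
proof -
  have "ok (N \<rightarrow> N) (sub \<sigma> (lam (n, N) b))" using ok_lam[of b "(n, N)"] assms by (auto intro!: ok_sub)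
  then have "V (sub \<sigma> (lam (n, N) b) \<cdot> s) = V (sub \<sigma> (lam (n, N) b) \<cdot> t)"
    using assms by (intro V_arg)
  moreover have "V (sub \<sigma> (lam (n, N) b) \<cdot> u) = V (sub (\<sigma>((n, N) := u)) b)" if "ok N u" for u
    by (rule V_eqv) (use beta[OF assms(1,2) _ assms(4), of "(n, N)" u] assms(3) that in simp)
  ultimately show ?thesis using assms(5,6) by simp
qed

lemma V_arg2:
  assumes "ok (N \<rightarrow> N \<rightarrow> N) g" "ok N s" "ok N s'" "ok N t" "ok N t'" "V s = V s'" "V t = V t'"
  shows "V (g \<cdot> s \<cdot> t) = V (g \<cdot> s' \<cdot> t')"
proof -
  let ?b = "Var (0, N \<rightarrow> N \<rightarrow> N) \<cdot> Var (0, N) \<cdot> Var (1, N)"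
  have "oks (Var((0, N \<rightarrow> N \<rightarrow> N) := g, (1, N) := t))" using assms by (intro oks_upd) auto
  then have "V (g \<cdot> s \<cdot> t) = V (g \<cdot> s' \<cdot> t)"
    using V_context[of ?b "Var((0, N \<rightarrow> N \<rightarrow> N) := g, (1, N) := t)" s s' 0] assms by simp
  also have "\<dots> = V (g \<cdot> s' \<cdot> t')" using assms by (intro V_arg ok_app[of N]) auto
  finally show ?thesis .
qed

lemma V_arg3:
  assumes "ok (N \<rightarrow> N \<rightarrow> N \<rightarrow> N) g" "ok N s" "ok N s'" "ok N t" "ok N t'" "ok N u" "ok N u'"
    "V s = V s'" "V t = V t'" "V u = V u'"
  shows "V (g \<cdot> s \<cdot> t \<cdot> u) = V (g \<cdot> s' \<cdot> t' \<cdot> u')"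
proof -
  let ?b = "Var (0, N \<rightarrow> N \<rightarrow> N \<rightarrow> N) \<cdot> Var (0, N) \<cdot> Var (1, N) \<cdot> Var (2, N)"
  let ?s = "Var((0, N \<rightarrow> N \<rightarrow> N \<rightarrow> N) := g, (1, N) := t, (2, N) := u)"
  have "oks ?s" using assms by (intro oks_upd) auto
  then have "V (g \<cdot> s \<cdot> t \<cdot> u) = V (g \<cdot> s' \<cdot> t \<cdot> u)"
    using V_context[of ?b ?s s s' 0] assms by simp
  also have "\<dots> = V (g \<cdot> s' \<cdot> t' \<cdot> u')" using assms by (intro V_arg2 ok_app[of N]) auto
  finally show ?thesis .
qed

text \<open>Functions on values induced by a term. The term \<open>g\<close> is kept as a parameter,
  since objects of higher type have no value.\<close>

definition ap1 :: "tm \<Rightarrow> nat \<Rightarrow> nat" where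
  "ap1 g a = V (g \<cdot> R a)"

definition ap2 :: "tm \<Rightarrow> nat \<Rightarrow> nat \<Rightarrow> nat" where
  "ap2 g a b = V (g \<cdot> R a \<cdot> R b)"

definition ap3 :: "tm \<Rightarrow> nat \<Rightarrow> nat \<Rightarrow> nat \<Rightarrow> nat" where
  "ap3 g a b c = V (g \<cdot> R a \<cdot> R b \<cdot> R c)"

definition rc :: "tm \<Rightarrow> nat \<Rightarrow> nat \<Rightarrow> nat" where
  "rc g a b = V (rec (R a) (R b) g)"

lemma V_ap1: "ok (N \<rightarrow> N) g \<Longrightarrow> ok N s \<Longrightarrow> V (g \<cdot> s) = ap1 g (V s)"
  unfolding ap1_def by (rule V_arg) auto

lemma V_ap2: "ok (N \<rightarrow> N \<rightarrow> N) g \<Longrightarrow> ok N s \<Longrightarrow> ok N t \<Longrightarrow> V (g \<cdot> s \<cdot> t) = ap2 g (V s) (V t)"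
  unfolding ap2_def by (rule V_arg2) auto

lemma V_ap3: "ok (N \<rightarrow> N \<rightarrow> N \<rightarrow> N) g \<Longrightarrow> ok N s \<Longrightarrow> ok N t \<Longrightarrow> ok N u \<Longrightarrow>
    V (g \<cdot> s \<cdot> t \<cdot> u) = ap3 g (V s) (V t) (V u)"
  unfolding ap3_def by (rule V_arg3) auto

lemma ok_rec: "ok N r \<Longrightarrow> ok N s \<Longrightarrow> ok (N \<rightarrow> N \<rightarrow> N) g \<Longrightarrow> ok N (rec r s g)"
  by (simp add: ok_def)

lemma V_rec:
  assumes "ok N r" "ok N s" "ok (N \<rightarrow> N \<rightarrow> N) g"
  shows "V (rec r s g) = rc g (V r) (V s)"
proof -
  let ?b = "Cst Rec \<cdot> Var (0, N) \<cdot> Var (1, N) \<cdot> Var (0, N \<rightarrow> N \<rightarrow> N)"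
  have ok: "oks (Var((0, N \<rightarrow> N \<rightarrow> N) := g, (1, N) := s))" "oks (Var((0, N \<rightarrow> N \<rightarrow> N) := g, (0, N) := R (V r)))"
    using assms by (intro oks_upd; simp)+
  have "V (rec r s g) = V (rec (R (V r)) s g)"
    using V_context[of ?b "Var((0, N \<rightarrow> N \<rightarrow> N) := g, (1, N) := s)" r "R (V r)" 0] assms ok by simp
  also have "\<dots> = V (rec (R (V r)) (R (V s)) g)"
    using V_context[of ?b "Var((0, N \<rightarrow> N \<rightarrow> N) := g, (0, N) := R (V r))" s "R (V s)" 1] assms ok by simp
  finally show ?thesis by (simp add: rc_def)
qed

abbreviation "Z \<equiv> V zero"
abbreviation "Sc \<equiv> ap1 (Cst Succ)"

lemma V_suc [simp]: "ok N t \<Longrightarrow> V (suc t) = Sc (V t)"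
  by (rule V_ap1) auto

lemma rc_Z: "ok (N \<rightarrow> N \<rightarrow> N) g \<Longrightarrow> rc g Z b = b"
  using W_ax[OF E_PRA.Rec_zero, of "R b" g] V_rec[of zero "R b" g] by (simp add: V_eq_iff[symmetric] L_Eq ok_rec)

lemma rc_Sc: "ok (N \<rightarrow> N \<rightarrow> N) g \<Longrightarrow> rc g (Sc a) b = ap2 g (rc g a b) a"
  using W_ax[OF E_PRA.Rec_Succ, of "R a" "R b" g] V_rec[of "suc (R a)" "R b" g] V_rec[of "R a" "R b" g]
    V_ap2[of g "rec (R a) (R b) g" "R a"] ok_app[of N "N \<rightarrow> N" g "rec (R a) (R b) g"]
    ok_app[of N N "g \<cdot> rec (R a) (R b) g" "R a"]
  by (simp add: V_eq_iff[symmetric] L_Eq ok_rec)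

lemma Sc_not_Z [simp]: "Sc a \<noteq> Z" "Z \<noteq> Sc a"
  using W_ax[OF E_PRA.Succ_not_zero, of "R a"] V_eq_iff[of "suc (R a)" zero] by (auto simp: L_Eq)

lemma Sc_inj [simp]: "Sc a = Sc b \<longleftrightarrow> a = b"
  using W_ax[OF E_PRA.Succ_inj, of "R a" "R b"] V_eq_iff[of "suc (R a)" "suc (R b)"] V_eq_iff[of "R a" "R b"]
  by (auto simp: L_Eq)

lemma V_lams:
  assumes "wt b" "star_free_tm b" "ttype b = N" "\<forall>v\<in>set vs. star_free (snd v)" "oks \<sigma>"
    "list_all2 ok (map snd vs) us"
  shows "V (foldl App (sub \<sigma> (lams vs b)) us) = V (sub (upds \<sigma> vs us) b)"
  using V_eqv beta_lams[OF assms(1,2,4-6)] assms(3) by simp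


text \<open>Induction holds for the predicates satisfying \<open>fdef\<close>, that is, those given by quantifier-free formulas
  with parameters. The closure rules below spare us writing down the induction formulas.\<close>

definition tdef :: "(nat \<Rightarrow> nat) \<Rightarrow> bool" where
  "tdef f \<longleftrightarrow> (\<exists>F X. finite X \<and> (\<forall>t. ok N t \<longrightarrow> ok N (F t) \<and> V (F t) = f (V t)) \<and>
     (\<forall>x r t. x \<notin> X \<longrightarrow> tsubst x t (F r) = F (tsubst x t r)))"

text \<open>Commuting with substitution for all variables outside a finite set, that of the
  parameters, means that the formula depends uniformly on its argument: \<open>F (Var x)\<close>
  with \<open>x\<close> fresh is an induction formula whose instances are the formulas
  \<open>F t\<close>.\<close>

definition fdef :: "(nat \<Rightarrow> bool) \<Rightarrow> bool" where
  "fdef P \<longleftrightarrow> (\<exists>F X. finite X \<and>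
     (\<forall>t. ok N t \<longrightarrow> F t \<in> L \<and> quantifier_free (F t) \<and> (F t \<in> W \<longleftrightarrow> P (V t))) \<and>
     (\<forall>x r t. x \<notin> X \<longrightarrow> fsubst x t (F r) = F (tsubst x t r)))"

lemma tdef_id: "tdef (\<lambda>a. a)"
  unfolding tdef_def by (intro exI[of _ "\<lambda>t. t"] exI[of _ "{}"]) auto

lemma tdef_const: "tdef (\<lambda>a. c)"
  unfolding tdef_def by (intro exI[of _ "\<lambda>t. R c"] exI[of _ "tvars (R c)"]) auto

lemma tdef_ap1:
  assumes "ok (N \<rightarrow> N) g" "tdef f"
  shows "tdef (\<lambda>a. ap1 g (f a))"
proof -
  obtain F X where "finite X" "\<And>t. ok N t \<Longrightarrow> ok N (F t) \<and> V (F t) = f (V t)"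
    "\<And>x r t. x \<notin> X \<Longrightarrow> tsubst x t (F r) = F (tsubst x t r)"
    using assms(2) unfolding tdef_def by blast
  then show ?thesis unfolding tdef_def using assms(1)
    by (intro exI[of _ "\<lambda>t. g \<cdot> F t"] exI[of _ "X \<union> tvars g"]) (auto simp: V_ap1 intro: ok_app)
qed

lemma tdef_ap2:
  assumes "ok (N \<rightarrow> N \<rightarrow> N) g" "tdef f" "tdef h"
  shows "tdef (\<lambda>a. ap2 g (f a) (h a))"
proof -
  obtain F X where "finite X" "\<And>t. ok N t \<Longrightarrow> ok N (F t) \<and> V (F t) = f (V t)"
    "\<And>x r t. x \<notin> X \<Longrightarrow> tsubst x t (F r) = F (tsubst x t r)"
    using assms(2) unfolding tdef_def by blast
  moreover obtain H Y where "finite Y" "\<And>t. ok N t \<Longrightarrow> ok N (H t) \<and> V (H t) = h (V t)"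
    "\<And>x r t. x \<notin> Y \<Longrightarrow> tsubst x t (H r) = H (tsubst x t r)"
    using assms(3) unfolding tdef_def by blast
  ultimately show ?thesis unfolding tdef_def using assms(1)
    by (intro exI[of _ "\<lambda>t. g \<cdot> F t \<cdot> H t"] exI[of _ "X \<union> Y \<union> tvars g"]) (auto simp: V_ap2 intro!: ok_app[of N])
qed

lemma tdef_ap3:
  assumes "ok (N \<rightarrow> N \<rightarrow> N \<rightarrow> N) g" "tdef f" "tdef h" "tdef k"
  shows "tdef (\<lambda>a. ap3 g (f a) (h a) (k a))"
proof -
  obtain F X where "finite X" "\<And>t. ok N t \<Longrightarrow> ok N (F t) \<and> V (F t) = f (V t)"
    "\<And>x r t. x \<notin> X \<Longrightarrow> tsubst x t (F r) = F (tsubst x t r)"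
    using assms(2) unfolding tdef_def by blast
  moreover obtain H Y where "finite Y" "\<And>t. ok N t \<Longrightarrow> ok N (H t) \<and> V (H t) = h (V t)"
    "\<And>x r t. x \<notin> Y \<Longrightarrow> tsubst x t (H r) = H (tsubst x t r)"
    using assms(3) unfolding tdef_def by blast
  moreover obtain I A where "finite A" "\<And>t. ok N t \<Longrightarrow> ok N (I t) \<and> V (I t) = k (V t)"
    "\<And>x r t. x \<notin> A \<Longrightarrow> tsubst x t (I r) = I (tsubst x t r)"
    using assms(4) unfolding tdef_def by blast
  ultimately show ?thesis unfolding tdef_def using assms(1)
    by (intro exI[of _ "\<lambda>t. g \<cdot> F t \<cdot> H t \<cdot> I t"] exI[of _ "X \<union> Y \<union> A \<union> tvars g"])
      (auto simp: V_ap3 intro!: ok_app[of N])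
qed

lemma fdef_eq:
  assumes "tdef f" "tdef h"
  shows "fdef (\<lambda>a. f a = h a)"
proof -
  obtain F X where "finite X" "\<And>t. ok N t \<Longrightarrow> ok N (F t) \<and> V (F t) = f (V t)"
    "\<And>x r t. x \<notin> X \<Longrightarrow> tsubst x t (F r) = F (tsubst x t r)"
    using assms(1) unfolding tdef_def by blast
  moreover obtain H Y where "finite Y" "\<And>t. ok N t \<Longrightarrow> ok N (H t) \<and> V (H t) = h (V t)"
    "\<And>x r t. x \<notin> Y \<Longrightarrow> tsubst x t (H r) = H (tsubst x t r)"
    using assms(2) unfolding tdef_def by blast
  ultimately show ?thesis unfolding fdef_def
    by (intro exI[of _ "\<lambda>t. Eq (F t) (H t)"] exI[of _ "X \<union> Y"]) (auto simp: V_eq_iff[symmetric] L_Eq)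
qed

lemma fdef_imp:
  assumes "fdef P" "fdef Q"
  shows "fdef (\<lambda>a. P a \<longrightarrow> Q a)"
proof -
  obtain F X where "finite X" "\<And>t. ok N t \<Longrightarrow> F t \<in> L \<and> quantifier_free (F t) \<and> (F t \<in> W \<longleftrightarrow> P (V t))"
    "\<And>x r t. x \<notin> X \<Longrightarrow> fsubst x t (F r) = F (tsubst x t r)"
    using assms(1) unfolding fdef_def by blast
  moreover obtain H Y where "finite Y" "\<And>t. ok N t \<Longrightarrow> H t \<in> L \<and> quantifier_free (H t) \<and> (H t \<in> W \<longleftrightarrow> Q (V t))"
    "\<And>x r t. x \<notin> Y \<Longrightarrow> fsubst x t (H r) = H (tsubst x t r)"
    using assms(2) unfolding fdef_def by blast
  ultimately show ?thesis unfolding fdef_def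
    by (intro exI[of _ "\<lambda>t. F t \<^bold>\<longrightarrow> H t"] exI[of _ "X \<union> Y"]) auto
qed

lemma fdef_False: "fdef (\<lambda>a. False)"
  unfolding fdef_def by (intro exI[of _ "\<lambda>t. Bot"] exI[of _ "{}"]) auto

lemma fdef_not: "fdef P \<Longrightarrow> fdef (\<lambda>a. \<not> P a)"
  using fdef_imp[OF _ fdef_False] by simp

lemma fdef_or: "fdef P \<Longrightarrow> fdef Q \<Longrightarrow> fdef (\<lambda>a. P a \<or> Q a)"
  using fdef_imp[OF fdef_not] by (simp add: disj_imp)

lemma fdef_and: "fdef P \<Longrightarrow> fdef Q \<Longrightarrow> fdef (\<lambda>a. P a \<and> Q a)"
  using fdef_not[OF fdef_imp[OF _ fdef_not, of P Q]] by simp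

lemma quantifier_free_induct:
  assumes "fdef P" "P Z" "\<And>a. P a \<Longrightarrow> P (Sc a)"
  shows "P a"
proof -
  obtain F X where X: "finite X" and F: "\<And>t. ok N t \<Longrightarrow> F t \<in> L \<and> quantifier_free (F t) \<and> (F t \<in> W \<longleftrightarrow> P (V t))"
    and sub: "\<And>x r t. x \<notin> X \<Longrightarrow> fsubst x t (F r) = F (tsubst x t r)"
    using assms(1) unfolding fdef_def by blast
  obtain n where "n \<notin> fst ` X" using X ex_new_if_finite[of "fst ` X"] by auto
  then have n: "(n, N) \<notin> X" by force
  let ?x = "(n, N)" and ?\<phi> = "F (Var (n, N))"
  have x: "ok N (Var ?x)" by (simp add: ok_Var okv_def)
  \<comment> \<open>If the step formula failed, it would fail at a witness variable, against the
    induction step for the value of that variable.\<close>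
  have step: "All ?x (?\<phi> \<^bold>\<longrightarrow> fsubst ?x (suc (Var ?x)) ?\<phi>) \<in> W"
  proof (rule ccontr)
    have "(?\<phi> \<^bold>\<longrightarrow> fsubst ?x (suc (Var ?x)) ?\<phi>) \<in> L" using F[OF x] L_fsubst[of ?\<phi> ?x] x by simp
    moreover assume "\<not> ?thesis"
    ultimately obtain w where w: "fsubst ?x (Var (w, N)) (?\<phi> \<^bold>\<longrightarrow> fsubst ?x (suc (Var ?x)) ?\<phi>) \<notin> W"
      using W_witness[of ?x "?\<phi> \<^bold>\<longrightarrow> fsubst ?x (suc (Var ?x)) ?\<phi>"] by (auto simp: L_All okv_def)
    have "ok N (Var (w, N))" by (simp add: ok_Var okv_def)
    with w show False using F[of "Var (w, N)"] F[of "suc (Var (w, N))"] assms(3) by (simp add: sub[OF n])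
  qed
  have "(fsubst ?x zero ?\<phi> \<^bold>\<and> All ?x (?\<phi> \<^bold>\<longrightarrow> fsubst ?x (suc (Var ?x)) ?\<phi>) \<^bold>\<longrightarrow> All ?x ?\<phi>) \<in> W"
    using F[OF x] L_fsubst[of ?\<phi> ?x] x
    by (intro W_ax E_PRA.induction) (auto simp: L_All okv_def)
  moreover have "fsubst ?x zero ?\<phi> \<in> W" using F[of zero] assms(2) by (simp add: sub[OF n])
  moreover have "fsubst ?x zero ?\<phi> \<in> L" "All ?x ?\<phi> \<in> L" "All ?x (?\<phi> \<^bold>\<longrightarrow> fsubst ?x (suc (Var ?x)) ?\<phi>) \<in> L"
    using F[OF x] L_fsubst[of ?\<phi> ?x] x by (auto simp: L_All okv_def)
  ultimately have "All ?x ?\<phi> \<in> W" using step by simp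
  from W_inst[OF this, of "R a"] have "F (R a) \<in> W" using F[OF x] by (simp add: sub[OF n])
  then show ?thesis using F[of "R a"] by simp
qed

end

section \<open>Arithmetic\<close>

declare sub_closed [simp] lam.simps [simp del]

lemma star_free_num [simp]: "star_free_tm (num n)" and wt_num [simp]: "wt (num n) \<and> ttype (num n) = N"
  and tvars_num [simp]: "tvars (num n) = {}"
  by (induction n) auto

lemma prdT [simp]: "wt prdT" "ttype prdT = one" "star_free_tm prdT" "tvars prdT = {}"
  by (auto simp: prdT_def wt_lam intro!: star_free_lam)

lemma addT [simp]: "wt addT" "ttype addT = (N \<rightarrow> one)" "star_free_tm addT" "tvars addT = {}"
  by (auto simp: addT_def)

lemma monusT [simp]: "wt monusT" "ttype monusT = (N \<rightarrow> one)" "star_free_tm monusT" "tvars monusT = {}"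
  by (auto simp: monusT_def)

lemma condT [simp]: "wt condT" "ttype condT = (N \<rightarrow> N \<rightarrow> one)" "star_free_tm condT" "tvars condT = {}"
  by (auto simp: condT_def)

lemma triangleT [simp]: "wt triangleT" "ttype triangleT = one" "star_free_tm triangleT" "tvars triangleT = {}"
  by (auto simp: triangleT_def wt_lam intro!: star_free_lam)

lemma pairT [simp]: "wt pairT" "ttype pairT = (N \<rightarrow> one)" "star_free_tm pairT" "tvars pairT = {}"
  by (auto simp: pairT_def)

lemma diagT [simp]: "wt diagT" "ttype diagT = one" "star_free_tm diagT" "tvars diagT = {}"
  by (auto simp: diagT_def wt_lam intro!: star_free_lam)

lemma pfstT [simp]: "wt pfstT" "ttype pfstT = one" "star_free_tm pfstT" "tvars pfstT = {}"
  by (auto simp: pfstT_def wt_lam intro!: star_free_lam)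

lemma psndT [simp]: "wt psndT" "ttype psndT = one" "star_free_tm psndT" "tvars psndT = {}"
  by (auto simp: psndT_def wt_lam intro!: star_free_lam)

lemma skipT [simp]: "wt skipT" "ttype skipT = (N \<rightarrow> one)" "star_free_tm skipT" "tvars skipT = {}"
  by (auto simp: skipT_def)

lemma getT [simp]: "wt getT" "ttype getT = (N \<rightarrow> one)" "star_free_tm getT" "tvars getT = {}"
  by (auto simp: getT_def)

lemma updT [simp]: "wt updT" "ttype updT = (N \<rightarrow> N \<rightarrow> one)" "star_free_tm updT" "tvars updT = {}"
  by (auto simp: updT_def)

context calculus
begin

lemma ok_arith [simp]: "ok one prdT" "ok (N \<rightarrow> one) addT" "ok (N \<rightarrow> one) monusT" "ok (N \<rightarrow> N \<rightarrow> one) condT"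
  "ok one triangleT" "ok (N \<rightarrow> one) pairT" "ok one diagT" "ok one pfstT" "ok one psndT"
  "ok (N \<rightarrow> one) skipT" "ok (N \<rightarrow> one) getT" "ok (N \<rightarrow> N \<rightarrow> one) updT"
  by (rule ok_star_free; simp)+

lemma ok_app1: "ok one g \<Longrightarrow> ok N s \<Longrightarrow> ok N (g \<cdot> s)"
  by (rule ok_app)

lemma ok_app2: "ok (N \<rightarrow> one) g \<Longrightarrow> ok N s \<Longrightarrow> ok N t \<Longrightarrow> ok N (g \<cdot> s \<cdot> t)"
  by (intro ok_app1 ok_app[of N])

lemma ok_app3: "ok (N \<rightarrow> N \<rightarrow> one) g \<Longrightarrow> ok N s \<Longrightarrow> ok N t \<Longrightarrow> ok N u \<Longrightarrow> ok N (g \<cdot> s \<cdot> t \<cdot> u)"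
  by (intro ok_app1 ok_app[of N])

lemmas ok_arith_apps [simp] = ok_app1[OF ok_arith(1)] ok_app2[OF ok_arith(2)] ok_app2[OF ok_arith(3)]
  ok_app3[OF ok_arith(4)] ok_app1[OF ok_arith(5)] ok_app2[OF ok_arith(6)] ok_app1[OF ok_arith(7)]
  ok_app1[OF ok_arith(8)] ok_app1[OF ok_arith(9)] ok_app2[OF ok_arith(10)] ok_app2[OF ok_arith(11)]
  ok_app3[OF ok_arith(12)]

end

context world
begin

section \<open>Values of the arithmetic terms\<close>

abbreviation "prdV \<equiv> ap1 prdT"
abbreviation addV (infixl "\<oplus>" 65) where "a \<oplus> b \<equiv> ap2 addT a b"
abbreviation monusV (infixl "\<ominus>" 65) where "a \<ominus> b \<equiv> ap2 monusT a b"
abbreviation "condV \<equiv> ap3 condT"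
abbreviation "triangleV \<equiv> ap1 triangleT"
abbreviation "pairV \<equiv> ap2 pairT"
abbreviation "diagV \<equiv> ap1 diagT"
abbreviation "pfstV \<equiv> ap1 pfstT"
abbreviation "psndV \<equiv> ap1 psndT"
abbreviation "skipV \<equiv> ap2 skipT"
abbreviation "getV \<equiv> ap2 getT"
abbreviation "updV \<equiv> ap3 updT"

lemmas V_arith [simp] = V_ap1[OF ok_arith(1)] V_ap2[OF ok_arith(2)] V_ap2[OF ok_arith(3)]
  V_ap3[OF ok_arith(4)] V_ap1[OF ok_arith(5)] V_ap2[OF ok_arith(6)] V_ap1[OF ok_arith(7)]
  V_ap1[OF ok_arith(8)] V_ap1[OF ok_arith(9)] V_ap2[OF ok_arith(10)] V_ap2[OF ok_arith(11)]
  V_ap3[OF ok_arith(12)]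

lemmas arith_def_intros = tdef_ap1[OF ok_Succ] tdef_ap1[OF ok_arith(1)] tdef_ap2[OF ok_arith(2)] tdef_ap2[OF ok_arith(3)]
  tdef_ap3[OF ok_arith(4)] tdef_ap1[OF ok_arith(5)] tdef_ap2[OF ok_arith(6)] tdef_ap1[OF ok_arith(7)]
  tdef_ap1[OF ok_arith(8)] tdef_ap1[OF ok_arith(9)] tdef_ap2[OF ok_arith(10)] tdef_ap2[OF ok_arith(11)]
  tdef_ap3[OF ok_arith(12)]

lemmas definable = fdef_eq fdef_not fdef_imp fdef_or fdef_and arith_def_intros tdef_id tdef_const

lemma ap1_lam:
  assumes "wt b" "star_free_tm b" "ttype b = N"
  shows "ap1 (lam (i, N) b) x = V (sub (Var((i, N) := R x)) b)"
  using V_lams[OF assms, of "[(i, N)]" Var "[R x]"] by (simp add: ap1_def lams_def)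

lemma ap2_lams:
  assumes "wt b" "star_free_tm b" "ttype b = N" "oks \<sigma>"
  shows "ap2 (sub \<sigma> (lams [(i, N), (j, N)] b)) x y = V (sub (\<sigma>((i, N) := R x, (j, N) := R y)) b)"
  using V_lams[OF assms(1-3), of "[(i, N), (j, N)]" \<sigma> "[R x, R y]"] assms(4) by (simp add: ap2_def)

lemmas ap2_lams' = ap2_lams[OF _ _ _ oks_Var, unfolded sub_Var]

lemma ap3_lams:
  assumes "wt b" "star_free_tm b" "ttype b = N"
  shows "ap3 (lams [(i, N), (j, N), (k, N)] b) x y z = V (sub (Var((i, N) := R x, (j, N) := R y, (k, N) := R z)) b)"
  using V_lams[OF assms, of "[(i, N), (j, N), (k, N)]" Var "[R x, R y, R z]"] by (simp add: ap3_def)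

lemma ok_lams2: "wt b \<Longrightarrow> star_free_tm b \<Longrightarrow> ttype b = N \<Longrightarrow> ok (N \<rightarrow> one) (lams [(i, N), (j, N)] b)"
  by (rule ok_star_free) auto

lemmas ap_simps = ap1_lam ap2_lams ap2_lams' ap3_lams V_rec rc_Z rc_Sc ok_lams2 ok_sub oks_upd

lemma prdV [simp]: "prdV Z = Z" "prdV (Sc a) = a"
  by (simp_all add: prdT_def ap_simps)

lemma addV_rec [simp]: "a \<oplus> Z = a" "a \<oplus> Sc b = Sc (a \<oplus> b)"
  by (simp_all add: addT_def ap_simps)

lemma monusV_rec [simp]: "a \<ominus> Z = a" "a \<ominus> Sc b = prdV (a \<ominus> b)"
  by (simp_all add: monusT_def ap_simps)

lemma condV [simp]: "condV Z x y = x" "condV (Sc c) x y = y"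
  by (simp_all add: condT_def ap_simps)

lemma triangleV [simp]: "triangleV Z = Z" "triangleV (Sc w) = triangleV w \<oplus> Sc w"
  by (simp_all add: triangleT_def ap_simps)

lemma pairV: "pairV x y = triangleV (x \<oplus> y) \<oplus> x"
  by (simp add: pairT_def ap_simps)

lemma diagV: "diagV Z = Z"
  "diagV (Sc z) = condV (triangleV (Sc (diagV z)) \<ominus> Sc z) (Sc (diagV z)) (diagV z)"
  by (simp_all add: diagT_def ap_simps)

lemma pfstV: "pfstV x = x \<ominus> triangleV (diagV x)"
  by (simp add: pfstT_def ap_simps)

lemma psndV: "psndV x = diagV x \<ominus> pfstV x"
  by (simp add: psndT_def ap_simps)

lemma skipV [simp]: "skipV c Z = c" "skipV c (Sc i) = psndV (skipV c i)"
  by (simp_all add: skipT_def ap_simps)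

lemma getV: "getV c i = pfstV (skipV c i)"
  by (simp add: getT_def ap_simps)

text \<open>The positions 0 and 1 are those of the registers to which \<open>program\<close>
  writes.\<close>

lemma updV: "updV c Z x = pairV x (skipV c (Sc Z))"
  "updV c (Sc Z) x = pairV (getV c (Sc Z \<ominus> Sc Z)) (pairV x (skipV c (Sc (Sc Z))))"
  by (simp_all add: updT_def ap_simps)

text \<open>Values need not be those of numerals, so zero and successor are separated by induction.
  Naming the predecessor by \<open>prdV\<close> keeps the induction formula quantifier-free.\<close>

lemma value_cases: "a = Z \<or> a = Sc (prdV a)"
  by (rule quantifier_free_induct[of "\<lambda>a. a = Z \<or> a = Sc (prdV a)"]) (intro definable | simp)+

lemma add_0 [simp]: "Z \<oplus> a = a"
  by (rule quantifier_free_induct[of "\<lambda>a. Z \<oplus> a = a"]) (intro definable | simp)+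

lemma add_Sc [simp]: "Sc a \<oplus> b = Sc (a \<oplus> b)"
  by (rule quantifier_free_induct[of "\<lambda>b. Sc a \<oplus> b = Sc (a \<oplus> b)"]) (intro definable | simp)+

lemma monus_Sc_Sc [simp]: "Sc a \<ominus> Sc b = a \<ominus> b"
  by (rule quantifier_free_induct[of "\<lambda>b. Sc a \<ominus> Sc b = a \<ominus> b"]) (intro definable | simp)+

declare monusV_rec(2) [simp del]

lemma Z_monus [simp]: "Z \<ominus> b = Z"
  by (rule quantifier_free_induct[of "\<lambda>b. Z \<ominus> b = Z"]) (intro definable | simp add: monusV_rec)+

lemma add_monus_add [simp]: "(a \<oplus> b) \<ominus> (a \<oplus> c) = b \<ominus> c"
  by (rule quantifier_free_induct[of "\<lambda>a. (a \<oplus> b) \<ominus> (a \<oplus> c) = b \<ominus> c"]) (intro definable | simp)+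

lemma add_monus [simp]: "(a \<oplus> b) \<ominus> a = b"
  using add_monus_add[of a b Z] by simp

lemma monus_add [simp]: "a \<ominus> (a \<oplus> b) = Z"
  using add_monus_add[of a Z b] by simp

lemma monus_self [simp]: "a \<ominus> a = Z"
  using monus_add[of a Z] by simp

lemma add_eq_Z [simp]: "a \<oplus> b = Z \<longleftrightarrow> a = Z \<and> b = Z"
  using value_cases[of a] value_cases[of b] by (metis Sc_not_Z(1) addV_rec add_0)

section \<open>Order expressed by truncated subtraction\<close>

lemma monus_nonzero: "a \<ominus> b \<noteq> Z \<longrightarrow> b \<oplus> (a \<ominus> b) = a"
proof (rule quantifier_free_induct[of "\<lambda>b. a \<ominus> b \<noteq> Z \<longrightarrow> b \<oplus> (a \<ominus> b) = a"])
  fix b assume "a \<ominus> b \<noteq> Z \<longrightarrow> b \<oplus> (a \<ominus> b) = a"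
  then show "a \<ominus> Sc b \<noteq> Z \<longrightarrow> Sc b \<oplus> (a \<ominus> Sc b) = a"
    using value_cases[of "a \<ominus> b"] by (metis addV_rec(2) add_Sc monusV_rec(2) prdV)
qed (intro definable | simp)+

text \<open>The equation \<open>a \<ominus> b = Z\<close> serves as the quantifier-free form of
  \<open>a \<le> b\<close>; for the same reason the difference is exhibited as a term.\<close>

lemma monus_zero: "a \<ominus> b = Z \<longrightarrow> b = a \<oplus> (b \<ominus> a)"
proof (rule quantifier_free_induct[of "\<lambda>b. a \<ominus> b = Z \<longrightarrow> b = a \<oplus> (b \<ominus> a)"])
  fix b assume IH: "a \<ominus> b = Z \<longrightarrow> b = a \<oplus> (b \<ominus> a)"
  show "a \<ominus> Sc b = Z \<longrightarrow> Sc b = a \<oplus> (Sc b \<ominus> a)"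
  proof
    assume "a \<ominus> Sc b = Z"
    then consider "a \<ominus> b = Z" | "a \<ominus> b = Sc Z"
      using value_cases[of "a \<ominus> b"] by (auto simp: monusV_rec(2))
    then show "Sc b = a \<oplus> (Sc b \<ominus> a)"
    proof cases
      case 1
      then obtain c where "b = a \<oplus> c" using IH by blast
      then show ?thesis using add_monus[of a "Sc c"] by simp
    next
      case 2
      then have "a = Sc b" using monus_nonzero[of a b] by simp
      then show ?thesis by simp
    qed
  qed
qed (intro definable | simp)+

lemma Sc_monus_zero: "Sc a \<ominus> b = Z \<Longrightarrow> a \<ominus> b = Z"
  using monus_zero[of "Sc a" b] by (metis add_Sc addV_rec(2) monus_add)

lemma le_total: obtains c where "b = a \<oplus> c" | c where "a = b \<oplus> c"
  using monus_nonzero[of a b] monus_zero[of a b] by metis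

lemma monus_eq_iff [simp]: "(a \<ominus> b) \<oplus> (b \<ominus> a) = Z \<longleftrightarrow> a = b"
  using monus_zero[of a b] by auto

text \<open>This evaluates \<open>ifeq\<close>, whose test adds the two truncated
  differences.\<close>

lemma condV_eq [simp]: "condV ((a \<ominus> b) \<oplus> (b \<ominus> a)) x y = (if a = b then x else y)"
proof (cases "a = b")
  case False
  then obtain c where "(a \<ominus> b) \<oplus> (b \<ominus> a) = Sc c"
    using value_cases monus_eq_iff by metis
  then show ?thesis using False by simp
qed simp

section \<open>Pairing\<close>

text \<open>The numbers from \<open>triangle w\<close> to \<open>triangle w + w\<close> form one
  diagonal, on which \<open>diag\<close> is constant. That it has the right value at the beginning
  is kept as a premise: \<open>diag_triangle\<close> proves this by induction on \<open>w\<close>,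
  using the present lemma for the end of each diagonal.\<close>

lemma diag_add: "diagV (triangleV w) = w \<longrightarrow> x \<ominus> w = Z \<longrightarrow> diagV (triangleV w \<oplus> x) = w"
proof (rule quantifier_free_induct[of "\<lambda>x. diagV (triangleV w) = w \<longrightarrow> x \<ominus> w = Z \<longrightarrow> diagV (triangleV w \<oplus> x) = w"])
  fix x assume IH: "diagV (triangleV w) = w \<longrightarrow> x \<ominus> w = Z \<longrightarrow> diagV (triangleV w \<oplus> x) = w"
  show "diagV (triangleV w) = w \<longrightarrow> Sc x \<ominus> w = Z \<longrightarrow> diagV (triangleV w \<oplus> Sc x) = w"
  proof (intro impI)
    assume w: "diagV (triangleV w) = w" and "Sc x \<ominus> w = Z"
    then obtain c where c: "w = x \<oplus> Sc c" using monus_zero[of "Sc x" w] by auto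
    \<comment> \<open>The test in \<open>diagV\<close> compares \<open>triangle (w + 1)\<close> with
      \<open>triangle w + x + 1\<close>. The difference is \<open>w - x\<close>, which is nonzero,
      so the diagonal does not change.\<close>
    have "x \<ominus> w = Z" "w \<ominus> x = Sc c" using monus_add[of x "Sc c"] add_monus[of x "Sc c"] unfolding c by blast+
    moreover from this have "diagV (triangleV w \<oplus> x) = w" using IH w by blast
    ultimately show "diagV (triangleV w \<oplus> Sc x) = w" by (simp add: diagV(2))
  qed
qed (intro definable | simp)+

lemma diag_triangle [simp]: "diagV (triangleV w) = w"
proof (rule quantifier_free_induct[of "\<lambda>w. diagV (triangleV w) = w"])
  fix w assume w: "diagV (triangleV w) = w"
  then have "diagV (triangleV w \<oplus> w) = w" using diag_add[of w w] by simp
  then show "diagV (triangleV (Sc w)) = Sc w" by (simp add: diagV(2))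
qed (intro definable | simp add: diagV)+

lemma diag_pair [simp]: "diagV (pairV x y) = x \<oplus> y"
  using diag_add[of "x \<oplus> y" x] by (simp add: pairV)

lemma pfst_pair [simp]: "pfstV (pairV x y) = x"
  using diag_pair[of x y] by (simp add: pfstV) (simp add: pairV)

lemma psnd_pair [simp]: "psndV (pairV x y) = y"
  by (simp add: psndV)

lemma pair_Z [simp]: "pairV Z Z = Z"
  by (simp add: pairV)

lemma pfst_Z [simp]: "pfstV Z = Z" and psnd_Z [simp]: "psndV Z = Z"
  by (metis pair_Z pfst_pair) (metis pair_Z psnd_pair)

end

section \<open>The machine\<close>

lemma stepT [simp]: "wt stepT" "ttype stepT = (one \<rightarrow> N \<rightarrow> one)" "star_free_tm stepT" "tvars stepT = {}"
  by (auto simp: stepT_def Let_def)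

lemma runT [simp]: "wt runT" "ttype runT = (one \<rightarrow> N \<rightarrow> N \<rightarrow> one)" "star_free_tm runT" "tvars runT = {}"
  by (auto simp: runT_def)

lemma resultT [simp]: "wt resultT" "ttype resultT = (one \<rightarrow> N \<rightarrow> N \<rightarrow> one)" "star_free_tm resultT" "tvars resultT = {}"
  by (auto simp: resultT_def Let_def)

lemma segT [simp]: "wt segT" "ttype segT = (one \<rightarrow> one)" "star_free_tm segT" "tvars segT = {}"
  by (auto simp: segT_def)

text \<open>The candidate moves on to the current number until it is a zero of the function; so
  after \<open>n\<close> rounds it is the least zero not above \<open>n\<close>, or \<open>n\<close>
  itself if there is none.\<close>

definition "searchT = lams [fv 0, nv 0]
  (rec (nt 0) zero (lams [nv 1, nv 2] (cond (ft 0 \<cdot> nt 1) (nt 1) (suc (nt 2)))))"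

lemma searchT [simp]: "wt searchT" "ttype searchT = (one \<rightarrow> one)" "star_free_tm searchT" "tvars searchT = {}"
  by (auto simp: searchT_def)

text \<open>The oracle \<open>A\<close> of the overview, with \<open>f\<close> and \<open>c\<close>
  as arguments. A marker 1 distinct from \<open>c\<close> is used because the search of
  \<open>program\<close> has to stop even if \<open>c\<close> is 0.\<close>

definition "switchT = lams [fv 0, nv 0, nv 1]
  (cond (ft 0 \<cdot> nt 1) (nt 0) (cond (ft 0 \<cdot> suc (nt 1)) (suc zero) zero))"

lemma switchT [simp]: "wt switchT" "ttype switchT = (one \<rightarrow> N \<rightarrow> one)" "star_free_tm switchT" "tvars switchT = {}"
  by (auto simp: switchT_def)

abbreviation instr :: "nat \<Rightarrow> nat \<Rightarrow> nat \<Rightarrow> nat \<Rightarrow> tm" where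
  "instr i a b q \<equiv> pair (num i) (pair (num a) (pair (num b) (pair (num q) zero)))"

text \<open>\<open>R\<^sub>0 := 0\<close>; repeat \<open>R\<^sub>1 := R\<^sub>0\<close>, \<open>R\<^sub>1 := A(R\<^sub>1)\<close>, \<open>R\<^sub>0 := R\<^sub>0 + 1\<close> until \<open>R\<^sub>1 \<noteq> R\<^sub>2\<close>; \<open>R\<^sub>0 := A(R\<^sub>0)\<close>.
  The register \<open>R\<^sub>2\<close> remains \<open>0\<close>.\<close>

definition "program =
  pair (instr 1 0 0 0) (pair (instr 3 0 1 0) (pair (instr 5 1 0 0) (pair (instr 2 0 0 0)
    (pair (instr 4 1 2 1) (pair (instr 5 0 0 0) zero)))))"

lemma program [simp]: "wt program" "ttype program = N" "star_free_tm program" "tvars program = {}"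
  by (auto simp: program_def)

abbreviation "zeroT \<equiv> Cst (K N N) \<cdot> zero"

context calculus
begin

lemma ok_machine [simp]: "ok one A \<Longrightarrow> ok (N \<rightarrow> one) (stepT \<cdot> A)"
  "ok one A \<Longrightarrow> ok (N \<rightarrow> N \<rightarrow> one) (runT \<cdot> A)"
  "ok one A \<Longrightarrow> ok (N \<rightarrow> N \<rightarrow> one) (resultT \<cdot> A)"
  "ok one A \<Longrightarrow> ok one (segT \<cdot> A)"
  "ok one A \<Longrightarrow> ok one (searchT \<cdot> A)"
  "ok one A \<Longrightarrow> ok (N \<rightarrow> one) (switchT \<cdot> A)"
  by (simp_all add: ok_def)

lemma ok_switch [simp]: "ok one f \<Longrightarrow> ok N c \<Longrightarrow> ok one (switchT \<cdot> f \<cdot> c)"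
  by (rule ok_app[OF ok_machine(6)])

lemma ok_program [simp]: "ok N program" and ok_zeroT [simp]: "ok one zeroT"
  by (simp_all add: ok_def)

lemma ok_machine_apps [simp]:
  "ok one A \<Longrightarrow> ok N s \<Longrightarrow> ok N t \<Longrightarrow> ok N (stepT \<cdot> A \<cdot> s \<cdot> t)"
  "ok one A \<Longrightarrow> ok N s \<Longrightarrow> ok N t \<Longrightarrow> ok N u \<Longrightarrow> ok N (run A s t u)"
  "ok one A \<Longrightarrow> ok N s \<Longrightarrow> ok N t \<Longrightarrow> ok N u \<Longrightarrow> ok N (result A s t u)"
  "ok one A \<Longrightarrow> ok N s \<Longrightarrow> ok N (seg A s)"
  "ok one A \<Longrightarrow> ok N s \<Longrightarrow> ok N (searchT \<cdot> A \<cdot> s)"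
  "ok one A \<Longrightarrow> ok N s \<Longrightarrow> ok N (A \<cdot> s)"
  by (intro ok_app1 ok_app2 ok_app3; simp)+

end

context world
begin

section \<open>Values of the machine terms\<close>

lemma V_machine [simp]:
  "ok one A \<Longrightarrow> ok N s \<Longrightarrow> ok N t \<Longrightarrow> V (stepT \<cdot> A \<cdot> s \<cdot> t) = ap2 (stepT \<cdot> A) (V s) (V t)"
  "ok one A \<Longrightarrow> ok N s \<Longrightarrow> ok N t \<Longrightarrow> ok N u \<Longrightarrow> V (run A s t u) = ap3 (runT \<cdot> A) (V s) (V t) (V u)"
  "ok one A \<Longrightarrow> ok N s \<Longrightarrow> ok N t \<Longrightarrow> ok N u \<Longrightarrow> V (result A s t u) = ap3 (resultT \<cdot> A) (V s) (V t) (V u)"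
  "ok one A \<Longrightarrow> ok N s \<Longrightarrow> V (seg A s) = ap1 (segT \<cdot> A) (V s)"
  "ok one A \<Longrightarrow> ok N s \<Longrightarrow> V (searchT \<cdot> A \<cdot> s) = ap1 (searchT \<cdot> A) (V s)"
  "ok one A \<Longrightarrow> ok N s \<Longrightarrow> V (A \<cdot> s) = ap1 A (V s)"
  by (simp_all add: V_ap1 V_ap2 V_ap3)

lemma V_num: "V (num 1) = Sc Z" "V (num 2) = Sc (Sc Z)" "V (num 3) = Sc (Sc (Sc Z))"
  "V (num 4) = Sc (Sc (Sc (Sc Z)))" "V (num 5) = Sc (Sc (Sc (Sc (Sc Z))))"
  by (simp_all add: numeral_eq_Suc)

text \<open>The fields of an instruction are long terms that occur several times in
  \<open>step_body\<close>. Here they are variables, so that the case distinction is evaluated while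
  they are still opaque.\<close>

lemma V_step_cases:
  assumes "ok one A" "ok N r" "ok N pc" "ok N i" "ok N a" "ok N b" "ok N q" "ok N st"
  shows "V (ifeq i (num 1) (pair pc (upd r a zero))
       (ifeq i (num 2) (pair pc (upd r a (suc (get r a))))
       (ifeq i (num 3) (pair pc (upd r b (get r a)))
       (ifeq i (num 4) (ifeq (get r a) (get r b) (pair q r) (pair pc r))
       (ifeq i (num 5) (pair pc (upd r a (A \<cdot> get r a)))
        st))))) =
    (if V i = V (num 1) then pairV (V pc) (updV (V r) (V a) Z)
     else if V i = V (num 2) then pairV (V pc) (updV (V r) (V a) (Sc (getV (V r) (V a))))
     else if V i = V (num 3) then pairV (V pc) (updV (V r) (V b) (getV (V r) (V a)))
     else if V i = V (num 4) then
       (if getV (V r) (V a) = getV (V r) (V b) then pairV (V q) (V r) else pairV (V pc) (V r))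
     else if V i = V (num 5) then pairV (V pc) (updV (V r) (V a) (ap1 A (getV (V r) (V a))))
     else V st)"
  using assms by (simp del: num.simps)

lemma stepV:
  assumes "ok one A"
  shows "ap2 (stepT \<cdot> A) e st =
    (let r = psndV st; pc = pfstV st; i = getV e pc;
         op = getV i Z; a = getV i (V (num 1)); b = getV i (V (num 2)); q = getV i (V (num 3))
     in if op = V (num 1) then pairV (Sc pc) (updV r a Z)
        else if op = V (num 2) then pairV (Sc pc) (updV r a (Sc (getV r a)))
        else if op = V (num 3) then pairV (Sc pc) (updV r b (getV r a))
        else if op = V (num 4) then (if getV r a = getV r b then pairV q r else pairV (Sc pc) r)
        else if op = V (num 5) then pairV (Sc pc) (updV r a (ap1 A (getV r a)))
        else st)"
proof -
  let ?b = "step_body (ft 0) (nt 0) (nt 1)"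
  have wt: "wt ?b" "star_free_tm ?b" "ttype ?b = N" by (simp_all add: Let_def)
  have "ap2 (stepT \<cdot> A) e st = V (stepT \<cdot> A \<cdot> R e \<cdot> R st)" using assms by simp
  also have "\<dots> = V (sub (Var(fv 0 := A, nv 0 := R e, nv 1 := R st)) ?b)"
    using V_lams[OF wt, of "[fv 0, nv 0, nv 1]" Var "[A, R e, R st]"] assms by (simp add: stepT_def)
  also have "sub (Var(fv 0 := A, nv 0 := R e, nv 1 := R st)) ?b = step_body A (R e) (R st)"
    by (simp add: Let_def del: num.simps)
  also have "V (step_body A (R e) (R st)) = (let r = psndV st; pc = pfstV st; i = getV e pc;
         op = getV i Z; a = getV i (V (num 1)); b = getV i (V (num 2)); q = getV i (V (num 3))
     in if op = V (num 1) then pairV (Sc pc) (updV r a Z)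
        else if op = V (num 2) then pairV (Sc pc) (updV r a (Sc (getV r a)))
        else if op = V (num 3) then pairV (Sc pc) (updV r b (getV r a))
        else if op = V (num 4) then (if getV r a = getV r b then pairV q r else pairV (Sc pc) r)
        else if op = V (num 5) then pairV (Sc pc) (updV r a (ap1 A (getV r a)))
        else st)"
    unfolding Let_def using assms by (subst V_step_cases) (simp_all del: num.simps(2))
  finally show ?thesis .
qed

lemma runV:
  assumes "ok one A"
  shows "ap3 (runT \<cdot> A) e x Z = pairV Z (pairV x Z)"
    "ap3 (runT \<cdot> A) e x (Sc k) = ap2 (stepT \<cdot> A) e (ap3 (runT \<cdot> A) e x k)"
proof -
  \<comment> \<open>The step function of the recursion mentions the oracle and the program; fixing
    them by a substitution gives a term to which \<open>rc_Z\<close> and \<open>rc_Sc\<close>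
    apply.\<close>
  let ?s = "lams [nv 3, nv 4] (stepT \<cdot> ft 0 \<cdot> nt 0 \<cdot> nt 3)"
  let ?g = "sub (Var(fv 0 := A, nv 0 := R e)) ?s"
  have g: "ok (N \<rightarrow> one) ?g" using assms by (intro ok_sub oks_upd ok_lams2) auto
  have step: "ap2 ?g a b = ap2 (stepT \<cdot> A) e a" for a b
    using assms by (subst ap2_lams) (auto intro!: oks_upd)
  have run: "ap3 (runT \<cdot> A) e x k = rc ?g k (pairV Z (pairV x Z))" for k
  proof -
    have "sub (Var(fv 0 := A, nv 0 := R e, nv 1 := R x, nv 2 := R k)) ?s = ?g"
      by (rule sub_cong) auto
    then show ?thesis using g assms
        V_lams[of "rec (nt 2) (pair zero (pair (nt 1) zero)) ?s" "[fv 0, nv 0, nv 1, nv 2]" Var "[A, R e, R x, R k]"]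
      by (simp add: ap3_def runT_def V_rec)
  qed
  show "ap3 (runT \<cdot> A) e x Z = pairV Z (pairV x Z)"
    "ap3 (runT \<cdot> A) e x (Sc k) = ap2 (stepT \<cdot> A) e (ap3 (runT \<cdot> A) e x k)"
    unfolding run by (simp_all add: rc_Z rc_Sc g step)
qed

lemma resultV:
  assumes "ok one A"
  shows "ap3 (resultT \<cdot> A) e x k = (let st = ap3 (runT \<cdot> A) e x k
    in condV (getV (getV e (pfstV st)) Z) (Sc (getV (psndV st) Z)) Z)"
proof -
  let ?b = "let st = run (ft 0) (nt 0) (nt 1) (nt 2)
    in cond (field (nt 0) st 0) (suc (get (psnd st) zero)) zero"
  let ?s = "Var(fv 0 := A, nv 0 := R e, nv 1 := R x, nv 2 := R k)"
  have wt: "wt ?b" "star_free_tm ?b" "ttype ?b = N" by (simp_all add: Let_def)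
  have "ap3 (resultT \<cdot> A) e x k = V (result A (R e) (R x) (R k))" using assms by simp
  also have "\<dots> = V (sub ?s ?b)"
    using V_lams[OF wt, of "[fv 0, nv 0, nv 1, nv 2]" Var "[A, R e, R x, R k]"] assms
    by (simp add: resultT_def)
  also have "sub ?s ?b = (let st = run A (R e) (R x) (R k)
    in cond (field (R e) st 0) (suc (get (psnd st) zero)) zero)"
    by (simp add: Let_def)
  finally show ?thesis using assms by (simp add: Let_def)
qed

lemma segV:
  assumes "ok one g"
  shows "ap1 (segT \<cdot> g) Z = Z" "ap1 (segT \<cdot> g) (Sc k) = Sc (pairV (ap1 (segT \<cdot> g) k) (ap1 g k))"
proof -
  let ?s = "lams [nv 1, nv 2] (suc (pair (nt 1) (ft 0 \<cdot> nt 2)))"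
  let ?g = "sub (Var(fv 0 := g)) ?s"
  have g: "ok (N \<rightarrow> one) ?g" using assms by (intro ok_sub oks_upd ok_lams2) auto
  have step: "ap2 ?g a b = Sc (pairV a (ap1 g b))" for a b
    using assms by (subst ap2_lams) (auto intro!: oks_upd)
  have seg: "ap1 (segT \<cdot> g) k = rc ?g k Z" for k
  proof -
    have "sub (Var(fv 0 := g, nv 0 := R k)) ?s = ?g" by (rule sub_cong) auto
    then show ?thesis using g assms
        V_lams[of "rec (nt 0) zero ?s" "[fv 0, nv 0]" Var "[g, R k]"]
      by (simp add: ap1_def segT_def V_rec)
  qed
  show "ap1 (segT \<cdot> g) Z = Z" "ap1 (segT \<cdot> g) (Sc k) = Sc (pairV (ap1 (segT \<cdot> g) k) (ap1 g k))"
    unfolding seg rc_Z[OF g] rc_Sc[OF g] step by (rule refl)+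
qed

lemma searchV:
  assumes "ok one f"
  shows "ap1 (searchT \<cdot> f) Z = Z"
    "ap1 (searchT \<cdot> f) (Sc k) = condV (ap1 f (ap1 (searchT \<cdot> f) k)) (ap1 (searchT \<cdot> f) k) (Sc k)"
proof -
  let ?s = "lams [nv 1, nv 2] (cond (ft 0 \<cdot> nt 1) (nt 1) (suc (nt 2)))"
  let ?g = "sub (Var(fv 0 := f)) ?s"
  have g: "ok (N \<rightarrow> one) ?g" using assms by (intro ok_sub oks_upd ok_lams2) auto
  have step: "ap2 ?g a b = condV (ap1 f a) a (Sc b)" for a b
    using assms by (subst ap2_lams) (auto intro!: oks_upd)
  have search: "ap1 (searchT \<cdot> f) k = rc ?g k Z" for k
  proof -
    have "sub (Var(fv 0 := f, nv 0 := R k)) ?s = ?g" by (rule sub_cong) auto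
    then show ?thesis using g assms
        V_lams[of "rec (nt 0) zero ?s" "[fv 0, nv 0]" Var "[f, R k]"]
      by (simp add: ap1_def searchT_def V_rec)
  qed
  show "ap1 (searchT \<cdot> f) Z = Z"
    "ap1 (searchT \<cdot> f) (Sc k) = condV (ap1 f (ap1 (searchT \<cdot> f) k)) (ap1 (searchT \<cdot> f) k) (Sc k)"
    unfolding search rc_Z[OF g] rc_Sc[OF g] step by (rule refl)+
qed

lemma switchV:
  assumes "ok one f" "ok N c"
  shows "ap1 (switchT \<cdot> f \<cdot> c) n = condV (ap1 f n) (V c) (condV (ap1 f (Sc n)) (Sc Z) Z)"
  using V_lams[of "cond (ft 0 \<cdot> nt 1) (nt 0) (cond (ft 0 \<cdot> suc (nt 1)) (suc zero) zero)" "[fv 0, nv 0, nv 1]"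
      Var "[f, c, R n]"] assms
  unfolding ap1_def[of "switchT \<cdot> f \<cdot> c"] by (simp add: switchT_def)

lemma zeroV [simp]: "ap1 zeroT n = Z"
  unfolding ap1_def by (rule V_eqv, rule eqv_K) auto

lemma condV_nonzero: "c \<noteq> Z \<Longrightarrow> condV c x y = y"
  using value_cases[of c] by (metis condV(2))

text \<open>Operation 0 is not among the five cases in which \<open>stepV\<close> changes the state,
  so a machine that has halted stays as it is.\<close>

lemma result_Sc:
  assumes "ok one A" "ap3 (resultT \<cdot> A) e x k = Sc y"
  shows "ap3 (resultT \<cdot> A) e x (Sc k) = Sc y"
proof -
  let ?st = "ap3 (runT \<cdot> A) e x k"
  have "getV (getV e (pfstV ?st)) Z = Z"
    using assms condV_nonzero by (fastforce simp: resultV Let_def)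
  then have "ap3 (runT \<cdot> A) e x (Sc k) = ?st"
    using assms(1) by (simp add: runV stepV V_num Let_def)
  then show ?thesis using assms by (simp add: resultV)
qed

lemmas definable_oracle = tdef_ap1 tdef_ap3[OF ok_machine(2)] tdef_ap3[OF ok_machine(3)]
  tdef_ap1[OF ok_machine(4)] tdef_ap1[OF ok_machine(5)]

lemma result_mono:
  assumes "ok one A" "ap3 (resultT \<cdot> A) e x k = Sc y"
  shows "ap3 (resultT \<cdot> A) e x (k \<oplus> j) = Sc y"
  by (rule quantifier_free_induct[of "\<lambda>j. ap3 (resultT \<cdot> A) e x (k \<oplus> j) = Sc y"])
    (intro definable definable_oracle assms | simp add: assms result_Sc)+

lemma result_unique:
  assumes "ok one A" "ap3 (resultT \<cdot> A) e x k = Sc y" "ap3 (resultT \<cdot> A) e x k' = Sc y'"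
  shows "y = y'"
proof (rule le_total[of k' k])
  fix c assume "k' = k \<oplus> c"
  then show ?thesis using result_mono[OF assms(1,2), of c] assms(3) by simp
next
  fix c assume "k = k' \<oplus> c"
  then show ?thesis using result_mono[OF assms(1,3), of c] assms(2) by simp
qed

lemma V_program: "V program =
  pairV (V (instr 1 0 0 0)) (pairV (V (instr 3 0 1 0)) (pairV (V (instr 5 1 0 0)) (pairV (V (instr 2 0 0 0))
    (pairV (V (instr 4 1 2 1)) (pairV (V (instr 5 0 0 0)) Z)))))"
  by (simp add: program_def)

section \<open>Bounded search and the oracle built from a function\<close>

lemma search_correct:
  assumes "ok one f" "ap1 f i = Z" "i \<ominus> n = Z"
  shows "ap1 f (ap1 (searchT \<cdot> f) n) = Z"
proof -
  have "i \<ominus> n = Z \<longrightarrow> ap1 f (ap1 (searchT \<cdot> f) n) = Z"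
  proof (rule quantifier_free_induct[of "\<lambda>n. i \<ominus> n = Z \<longrightarrow> ap1 f (ap1 (searchT \<cdot> f) n) = Z"])
    show "i \<ominus> Z = Z \<longrightarrow> ap1 f (ap1 (searchT \<cdot> f) Z) = Z" using assms(1,2) by (auto simp: searchV)
    fix n assume IH: "i \<ominus> n = Z \<longrightarrow> ap1 f (ap1 (searchT \<cdot> f) n) = Z"
    show "i \<ominus> Sc n = Z \<longrightarrow> ap1 f (ap1 (searchT \<cdot> f) (Sc n)) = Z"
    proof
      assume "i \<ominus> Sc n = Z"
      then consider "i \<ominus> n = Z" | "i \<ominus> n = Sc Z"
        using value_cases[of "i \<ominus> n"] by (auto simp: monusV_rec(2))
      then show "ap1 f (ap1 (searchT \<cdot> f) (Sc n)) = Z"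
      proof cases
        case 1
        then show ?thesis using IH assms(1) by (simp add: searchV)
      next
        case 2
        then have "i = Sc n" using monus_nonzero[of i n] by simp
        \<comment> \<open>If the current candidate is not a zero, the search moves on to
          \<open>Sc n\<close>, which is \<open>i\<close>.\<close>
        then show ?thesis using assms(1,2) condV_nonzero
          by (cases "ap1 f (ap1 (searchT \<cdot> f) n) = Z") (simp_all add: searchV)
      qed
    qed
  qed (intro definable definable_oracle assms(1))
  then show ?thesis using assms(3) by simp
qed

text \<open>The oracle at \<open>k\<close> depends on \<open>f\<close> at \<open>k\<close> and
  \<open>k + 1\<close>. For \<open>k\<close> below \<open>m\<close> both arguments are in the range
  without zeros, so only the default value 0 is left.\<close>

lemma seg_switch:
  assumes "ok one f" "ok N c" "\<And>i. i \<ominus> Sc m = Z \<Longrightarrow> ap1 f i \<noteq> Z"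
  shows "ap1 (segT \<cdot> (switchT \<cdot> f \<cdot> c)) m = ap1 (segT \<cdot> zeroT) m"
proof -
  have "k \<ominus> m = Z \<longrightarrow> ap1 (segT \<cdot> (switchT \<cdot> f \<cdot> c)) k = ap1 (segT \<cdot> zeroT) k" for k
  proof (rule quantifier_free_induct[of "\<lambda>k. k \<ominus> m = Z \<longrightarrow>
      ap1 (segT \<cdot> (switchT \<cdot> f \<cdot> c)) k = ap1 (segT \<cdot> zeroT) k"])
    fix k assume IH: "k \<ominus> m = Z \<longrightarrow> ap1 (segT \<cdot> (switchT \<cdot> f \<cdot> c)) k = ap1 (segT \<cdot> zeroT) k"
    show "Sc k \<ominus> m = Z \<longrightarrow> ap1 (segT \<cdot> (switchT \<cdot> f \<cdot> c)) (Sc k) = ap1 (segT \<cdot> zeroT) (Sc k)"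
    proof
      assume "Sc k \<ominus> m = Z"
      then obtain d where d: "m = k \<oplus> Sc d" using monus_zero[of "Sc k" m] by auto
      have le: "k \<ominus> m = Z" using \<open>Sc k \<ominus> m = Z\<close> by (rule Sc_monus_zero)
      have "k \<ominus> Sc m = Z" using monus_add[of k "Sc (Sc d)"] unfolding d by simp
      then have "ap1 f k \<noteq> Z" "ap1 f (Sc k) \<noteq> Z" using assms(3)[of k] assms(3)[of "Sc k"] le by auto
      then have "ap1 (switchT \<cdot> f \<cdot> c) k = Z" using assms by (simp add: switchV condV_nonzero)
      then show "ap1 (segT \<cdot> (switchT \<cdot> f \<cdot> c)) (Sc k) = ap1 (segT \<cdot> zeroT) (Sc k)"
        using IH le assms by (simp add: segV)
    qed
  qed (intro definable definable_oracle assms ok_switch ok_zeroT | simp add: segV assms)+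
  then show ?thesis by simp
qed

text \<open>A segment of length \<open>k + 1\<close> ends with the value at \<open>k\<close>. This
  is why \<open>muT\<close> asks \<open>\<Phi>\<close> about the length
  \<open>suc program\<close>.\<close>

lemma seg_Sc_eq:
  assumes "ok one f" "ok one g" "ap1 (segT \<cdot> f) (Sc k) = ap1 (segT \<cdot> g) (Sc k)"
  shows "ap1 f k = ap1 g k"
proof -
  have "pairV (ap1 (segT \<cdot> f) k) (ap1 f k) = pairV (ap1 (segT \<cdot> g) k) (ap1 g k)"
    using assms by (simp add: segV)
  then show ?thesis by (metis psnd_pair)
qed

text \<open>One round of the loop takes four steps: copy, query, increment, conditional jump. If the
  answer was 0, then the second register is 0 again and the state has its initial form; otherwise
  one more query is made and the program runs off its end.\<close>

lemma program_steps:
  assumes A: "ok one A" and st: "ap3 (runT \<cdot> A) (V program) x j = pairV (Sc Z) (pairV k Z)"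
  shows "ap1 A k = Z \<Longrightarrow> ap3 (runT \<cdot> A) (V program) x (Sc (Sc (Sc (Sc j)))) = pairV (Sc Z) (pairV (Sc k) Z)"
    "ap1 A k \<noteq> Z \<Longrightarrow> ap3 (resultT \<cdot> A) (V program) x (Sc (Sc (Sc (Sc (Sc j))))) = Sc (ap1 A (Sc k))"
proof -
  let ?run = "ap3 (runT \<cdot> A) (V program) x"
  have 1: "?run (Sc j) = pairV (Sc (Sc Z)) (pairV k (pairV k Z))"
    by (subst runV(2)[OF A], subst st) (simp add: stepV[OF A] V_program getV updV V_num Let_def)
  have 2: "?run (Sc (Sc j)) = pairV (Sc (Sc (Sc Z))) (pairV k (pairV (ap1 A k) Z))"
    by (subst runV(2)[OF A], subst 1) (simp add: stepV[OF A] V_program getV updV V_num Let_def)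
  have 3: "?run (Sc (Sc (Sc j))) = pairV (Sc (Sc (Sc (Sc Z)))) (pairV (Sc k) (pairV (ap1 A k) Z))"
    by (subst runV(2)[OF A], subst 2) (simp add: stepV[OF A] V_program getV updV V_num Let_def)
  have 4: "?run (Sc (Sc (Sc (Sc j)))) =
      pairV (if ap1 A k = Z then Sc Z else Sc (Sc (Sc (Sc (Sc Z))))) (pairV (Sc k) (pairV (ap1 A k) Z))"
    by (subst runV(2)[OF A], subst 3) (simp add: stepV[OF A] V_program getV updV V_num Let_def)
  show "ap1 A k = Z \<Longrightarrow> ?run (Sc (Sc (Sc (Sc j)))) = pairV (Sc Z) (pairV (Sc k) Z)"
    by (simp add: 4)
  assume "ap1 A k \<noteq> Z"
  then have 5: "?run (Sc (Sc (Sc (Sc (Sc j))))) =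
      pairV (Sc (Sc (Sc (Sc (Sc (Sc Z)))))) (pairV (ap1 A (Sc k)) (pairV (ap1 A k) Z))"
    by (subst runV(2)[OF A], subst 4) (simp add: stepV[OF A] V_program getV updV V_num Let_def)
  show "ap3 (resultT \<cdot> A) (V program) x (Sc (Sc (Sc (Sc (Sc j))))) = Sc (ap1 A (Sc k))"
    by (subst resultV[OF A], subst 5) (simp add: V_program getV V_num Let_def)
qed

text \<open>The input \<open>x\<close> is arbitrary because the first instruction erases it.\<close>

lemma program_halts:
  assumes "ok one f" "ok N c" "ap1 f Z \<noteq> Z" "ap1 f n = Z"
  shows "\<exists>k. ap3 (resultT \<cdot> (switchT \<cdot> f \<cdot> c)) (V program) x k = Sc (V c)"
proof -
  let ?A = "switchT \<cdot> f \<cdot> c"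
  \<comment> \<open>Erasing the input takes one step and each round four, so the loop is entered
    with counter \<open>k\<close> after \<open>4 k + 1\<close> steps.\<close>
  let ?T = "\<lambda>k. Sc (k \<oplus> k \<oplus> k \<oplus> k)"
  \<comment> \<open>To keep the induction quantifier-free, halting is stated for an explicit time.
    If \<open>k + 1\<close> is the first zero of \<open>f\<close>, then the output appears five
    steps after \<open>?T k\<close>, that is, at \<open>Sc (?T (Sc k))\<close>.\<close>
  let ?P = "\<lambda>k. ap3 (resultT \<cdot> ?A) (V program) x (Sc (?T k)) = Sc (V c) \<or>
    ap3 (runT \<cdot> ?A) (V program) x (?T k) = pairV (Sc Z) (pairV k Z) \<and> ap1 f k \<noteq> Z"
  have A: "ok one ?A" using assms by simp
  have "?P n"
  proof (rule quantifier_free_induct[of ?P])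
    show "fdef ?P" by (intro definable definable_oracle A assms)
    have "ap3 (runT \<cdot> ?A) (V program) x (Sc Z) = pairV (Sc Z) Z"
      by (subst runV(2)[OF A], subst runV(1)[OF A]) (simp add: stepV[OF A] V_program getV updV V_num Let_def)
    then show "?P Z" using assms(3) by simp
    fix k assume "?P k"
    then show "?P (Sc k)"
    proof
      assume "ap3 (resultT \<cdot> ?A) (V program) x (Sc (?T k)) = Sc (V c)"
      then show ?thesis by (simp add: result_Sc[OF A])
    next
      assume k: "ap3 (runT \<cdot> ?A) (V program) x (?T k) = pairV (Sc Z) (pairV k Z) \<and> ap1 f k \<noteq> Z"
      show ?thesis
      proof (cases "ap1 f (Sc k) = Z")
        case True
        then have "ap1 ?A k = Sc Z" "ap1 ?A (Sc k) = V c" using k assms by (simp_all add: switchV condV_nonzero)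
        then show ?thesis using program_steps(2)[OF A, of x "?T k" k] k by simp
      next
        case False
        then have "ap1 ?A k = Z" using k assms by (simp add: switchV condV_nonzero)
        then show ?thesis using program_steps(1)[OF A, of x "?T k" k] k False by simp
      qed
    qed
  qed
  \<comment> \<open>The zero of \<open>f\<close> at \<open>n\<close> rules out the second
    alternative.\<close>
  then show ?thesis using assms(4) by blast
qed

end

section \<open>The formulas in a world\<close>

text \<open>Terms that can be substituted into the formulas of interest without capture.\<close>

definition big :: "tm \<Rightarrow> bool" where
  "big t \<longleftrightarrow> (\<forall>v\<in>tvars t. 100 \<le> fst v)"

lemma big_closed [simp]: "tvars t = {} \<Longrightarrow> big t"
  by (simp add: big_def)

lemma big_Var [simp]: "big (Var v) \<longleftrightarrow> 100 \<le> fst v"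
  by (simp add: big_def)

lemma big_App [simp]: "big (s \<cdot> t) \<longleftrightarrow> big s \<and> big t"
  by (auto simp: big_def)

lemma big_notin [simp]: "big t \<Longrightarrow> n < 100 \<Longrightarrow> (n, \<rho>) \<notin> tvars t"
  by (auto simp: big_def)

text \<open>Turns halting into vanishing, the form in which \<open>\<mu>\<close> can search for
  it.\<close>

definition "haltT = lams [fv 0, nv 0, nv 1] (monus (suc zero) (result (ft 0) (nt 0) (nt 0) (nt 1)))"

lemma haltT [simp]: "wt haltT" "ttype haltT = (one \<rightarrow> N \<rightarrow> one)" "star_free_tm haltT" "tvars haltT = {}"
  by (auto simp: haltT_def)

text \<open>\<open>findT \<mu> A e\<close> is a step at which the computation has halted, if there is one.\<close>

definition "findT = lams [\<mu>_var, fv 0, nv 0] (Var \<mu>_var \<cdot> (haltT \<cdot> ft 0 \<cdot> nt 0))"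

lemma findT [simp]: "wt findT" "ttype findT = (two \<rightarrow> one \<rightarrow> one)" "star_free_tm findT" "tvars findT = {}"
  by (auto simp: findT_def)

text \<open>The successor that makes the value differ from the output is already contained in
  \<open>result\<close>.\<close>

definition "dnrT = lams [\<mu>_var, fv 0, nv 0] (result (ft 0) (nt 0) (nt 0) (findT \<cdot> Var \<mu>_var \<cdot> ft 0 \<cdot> nt 0))"

lemma dnrT [simp]: "wt dnrT" "ttype dnrT = (two \<rightarrow> one \<rightarrow> one)" "star_free_tm dnrT" "tvars dnrT = {}"
  by (auto simp: dnrT_def)

text \<open>If the values of \<open>\<Psi>\<close> at \<open>program\<close> differ for the zero
  function and for the oracle, then these two differ below the length that \<open>\<Phi>\<close>
  provides. A nonzero value of the oracle at \<open>k\<close> means a zero of \<open>f\<close> at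
  \<open>k\<close> or \<open>k + 1\<close>, which is within reach of the search.\<close>

definition "muT = lams [\<Psi>_var, \<Phi>_var, fv 0]
  (searchT \<cdot> ft 0 \<cdot> suc (Var \<Phi>_var \<cdot> zeroT \<cdot> (switchT \<cdot> ft 0 \<cdot> (Var \<Psi>_var \<cdot> zeroT \<cdot> program)) \<cdot> suc program))"

lemma muT [simp]: "wt muT" "ttype muT = ((one \<rightarrow> one) \<rightarrow> (one \<rightarrow> one \<rightarrow> N \<rightarrow> N) \<rightarrow> two)"
  "star_free_tm muT" "tvars muT = {}"
  by (auto simp: muT_def)

lemma fsubst_MU: "fst v = 0 \<Longrightarrow> v \<noteq> fv 0 \<Longrightarrow> v \<noteq> nv 0 \<Longrightarrow> fsubst v r (MU \<mu>) = MU (tsubst v r \<mu>)"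
  by (cases v) (simp add: MU_def)

lemma fsubst_UDNR: "fst v = 0 \<Longrightarrow> v \<noteq> fv 0 \<Longrightarrow> v \<noteq> nv 0 \<Longrightarrow> fsubst v r (UDNR \<Psi>) = UDNR (tsubst v r \<Psi>)"
  by (cases v) (auto simp: UDNR_def differs_def computes_def)

lemma fsubst_extensionality_functional:
  "fst v = 0 \<Longrightarrow> v \<noteq> fv 0 \<Longrightarrow> v \<noteq> nv 0 \<Longrightarrow>
    fsubst v r (extensionality_functional \<Xi> \<phi>) = extensionality_functional (tsubst v r \<Xi>) (tsubst v r \<phi>)"
  by (cases v) (auto simp: extensionality_functional_def)

context calculus
begin

lemma okv_star_free [simp]: "star_free \<rho> \<Longrightarrow> okv (i, \<rho>)"
  by (simp add: okv_def)

declare ok_Var [simp]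

lemma ok_MU_app [simp]: "ok two \<mu> \<Longrightarrow> ok one f \<Longrightarrow> ok N (\<mu> \<cdot> f)"
  by (rule ok_app)

lemma ok_dnr_app [simp]: "ok (one \<rightarrow> one) \<Psi> \<Longrightarrow> ok one f \<Longrightarrow> ok one (\<Psi> \<cdot> f)"
  by (rule ok_app)

lemma ok_halt [simp]: "ok one A \<Longrightarrow> ok N e \<Longrightarrow> ok one (haltT \<cdot> A \<cdot> e)"
  by (simp add: ok_def)

lemma ok_find [simp]: "ok two \<mu> \<Longrightarrow> ok one A \<Longrightarrow> ok one (findT \<cdot> \<mu> \<cdot> A)"
  by (simp add: ok_def)

lemma ok_dnr [simp]: "ok two \<mu> \<Longrightarrow> ok (one \<rightarrow> one) (dnrT \<cdot> \<mu>)"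
  by (simp add: ok_def)

lemma ok_ext_app [simp]: "ok (one \<rightarrow> one \<rightarrow> N \<rightarrow> N) \<Phi> \<Longrightarrow> ok one C \<Longrightarrow> ok one D \<Longrightarrow> ok N k \<Longrightarrow> ok N (\<Phi> \<cdot> C \<cdot> D \<cdot> k)"
  by (simp add: ok_def)

lemma ok_mu [simp]: "ok (one \<rightarrow> one) \<Psi> \<Longrightarrow> ok (one \<rightarrow> one \<rightarrow> N \<rightarrow> N) \<Phi> \<Longrightarrow> ok two (muT \<cdot> \<Psi> \<cdot> \<Phi>)"
  by (simp add: ok_def)

lemma differs_L: "ok N z \<Longrightarrow> ok one A \<Longrightarrow> ok N e \<Longrightarrow> ok N x \<Longrightarrow> differs z A e x \<in> L"
  by (simp add: differs_def computes_def L_All L_Eq)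

lemma MU_L: "ok two \<mu> \<Longrightarrow> MU \<mu> \<in> L"
  by (simp add: MU_def L_All L_Eq)

lemma UDNR_L: "ok (one \<rightarrow> one) \<Psi> \<Longrightarrow> UDNR \<Psi> \<in> L"
  by (simp add: UDNR_def L_All differs_L)

lemma extensionality_functional_L:
  "ok (one \<rightarrow> one \<rightarrow> N \<rightarrow> N) \<Phi> \<Longrightarrow> ok (one \<rightarrow> one) \<Psi> \<Longrightarrow> extensionality_functional \<Phi> \<Psi> \<in> L"
  by (simp add: extensionality_functional_def L_All L_Eq)

end

context world
begin

lemma W_AllI:
  "All v \<phi> \<in> L \<Longrightarrow> (\<And>n. 100 \<le> n \<Longrightarrow> fsubst v (Var (n, snd v)) \<phi> \<in> W) \<Longrightarrow> All v \<phi> \<in> W"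
  using W_witness by blast

lemma W_ExI:
  assumes "Ex v \<phi> \<in> L" "fsubst v t \<phi> \<in> W" "ok (snd v) t" "free_for t v \<phi>"
  shows "Ex v \<phi> \<in> W"
proof -
  have "fsubst v t (Neg \<phi>) \<in> W" if "All v (Neg \<phi>) \<in> W"
    using W_inst[OF that assms(3)] assms(4) by simp
  moreover have "fsubst v t \<phi> \<in> L" using W_L assms(2) by blast
  ultimately show ?thesis using assms by auto
qed

lemma W_ExE:
  assumes "Ex v \<phi> \<in> W"
  obtains n where "100 \<le> n" "fsubst v (Var (n, snd v)) \<phi> \<in> W"
proof -
  have L: "All v (Neg \<phi>) \<in> L" using assms W_L by auto
  then have "All v (Neg \<phi>) \<notin> W" using W_mp[OF assms] by auto
  then obtain n where n: "100 \<le> n" "fsubst v (Var (n, snd v)) (Neg \<phi>) \<notin> W" using W_witness L by blast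
  moreover have "fsubst v (Var (n, snd v)) \<phi> \<in> L" using L L_fsubst_Var[of v "Neg \<phi>" "(n, snd v)"] by simp
  ultimately show thesis using that by auto
qed

lemma W_Eq [simp]: "ok N s \<Longrightarrow> ok N t \<Longrightarrow> Eq s t \<in> W \<longleftrightarrow> V s = V t"
  by (simp add: V_eq_iff)

lemma computes_iff:
  assumes "ok one A" "ok N e" "ok N x" "ok N y" "big A" "big e" "big x" "nv 2 \<notin> tvars y"
  shows "computes A e x y \<in> W \<longleftrightarrow> (\<exists>k. ap3 (resultT \<cdot> A) (V e) (V x) k = Sc (V y))"
proof
  assume "computes A e x y \<in> W"
  then obtain n where "fsubst (nv 2) (Var (n, N)) (Eq (result A e x (nt 2)) (suc y)) \<in> W"
    unfolding computes_def by (elim W_ExE) simp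
  then show "\<exists>k. ap3 (resultT \<cdot> A) (V e) (V x) k = Sc (V y)" using assms by auto
next
  assume "\<exists>k. ap3 (resultT \<cdot> A) (V e) (V x) k = Sc (V y)"
  then obtain k where "ap3 (resultT \<cdot> A) (V e) (V x) k = Sc (V y)" by blast
  then show "computes A e x y \<in> W"
    unfolding computes_def using assms by (intro W_ExI[where t = "R k"]) (simp_all add: L_All L_Eq)
qed

text \<open>Only the output \<open>y = z\<close> can violate the formula, so the quantifier over
  \<open>y\<close> disappears.\<close>

lemma differs_iff:
  assumes "ok N z" "ok one A" "ok N e" "ok N x" "big z" "big A" "big e" "big x"
  shows "differs z A e x \<in> W \<longleftrightarrow> (\<forall>k. ap3 (resultT \<cdot> A) (V e) (V x) k \<noteq> Sc (V z))"
proof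
  have *: "fsubst (nv 1) t (computes A e x (nt 1) \<^bold>\<longrightarrow> Neg (Eq z (nt 1))) =
      (computes A e x t \<^bold>\<longrightarrow> Neg (Eq z t))" for t
    using assms by (simp add: computes_def)
  have L: "computes A e x t \<in> L" if "ok N t" for t
    using assms that by (simp add: computes_def L_All L_Eq)
  show "\<forall>k. ap3 (resultT \<cdot> A) (V e) (V x) k \<noteq> Sc (V z)" if "differs z A e x \<in> W"
  proof -
    have "fsubst (nv 1) z (computes A e x (nt 1) \<^bold>\<longrightarrow> Neg (Eq z (nt 1))) \<in> W"
      using that assms unfolding differs_def by (intro W_inst) (simp_all add: computes_def)
    then have "(computes A e x z \<^bold>\<longrightarrow> Neg (Eq z z)) \<in> W" unfolding * .
    then show ?thesis using assms L[of z] by (simp add: L_Eq computes_iff)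
  qed
  show "differs z A e x \<in> W" if ne: "\<forall>k. ap3 (resultT \<cdot> A) (V e) (V x) k \<noteq> Sc (V z)"
  proof -
    have "fsubst (nv 1) (Var (n, N)) (computes A e x (nt 1) \<^bold>\<longrightarrow> Neg (Eq z (nt 1))) \<in> W" if "100 \<le> n" for n
      unfolding * using assms ne that L[of "Var (n, N)"] by (auto simp: L_Eq computes_iff)
    then show ?thesis using differs_L assms unfolding differs_def by (intro W_AllI) auto
  qed
qed

section \<open>The internal principles read in a world\<close>

lemma UDNR_D:
  assumes "UDNR \<Psi> \<in> W" "ok (one \<rightarrow> one) \<Psi>" "ok one A" "ok N e" "big \<Psi>" "big A" "big e"
  shows "ap3 (resultT \<cdot> A) (V e) (V e) k \<noteq> Sc (V (\<Psi> \<cdot> A \<cdot> e))"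
proof -
  have "fsubst (fv 0) A (All (nv 0) (differs (\<Psi> \<cdot> ft 0 \<cdot> nt 0) (ft 0) (nt 0) (nt 0))) \<in> W"
    using assms unfolding UDNR_def by (intro W_inst) (simp_all add: differs_def computes_def)
  then have "All (nv 0) (differs (\<Psi> \<cdot> A \<cdot> nt 0) A (nt 0) (nt 0)) \<in> W"
    using assms by (simp add: differs_def computes_def)
  then have "fsubst (nv 0) e (differs (\<Psi> \<cdot> A \<cdot> nt 0) A (nt 0) (nt 0)) \<in> W"
    using assms by (intro W_inst) (simp_all add: differs_def computes_def)
  then have "differs (\<Psi> \<cdot> A \<cdot> e) A e e \<in> W"
    using assms by (simp add: differs_def computes_def)
  then show ?thesis using assms by (simp add: differs_iff del: V_machine)
qed

lemma UDNR_I: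
  assumes "ok (one \<rightarrow> one) \<Psi>" "big \<Psi>"
    and "\<And>A e k. ok one A \<Longrightarrow> ok N e \<Longrightarrow> big A \<Longrightarrow> big e \<Longrightarrow>
      ap3 (resultT \<cdot> A) (V e) (V e) k \<noteq> Sc (V (\<Psi> \<cdot> A \<cdot> e))"
  shows "UDNR \<Psi> \<in> W"
proof -
  have "fsubst (nv 0) (Var (m, N)) (differs (\<Psi> \<cdot> Var (n, one) \<cdot> nt 0) (Var (n, one)) (nt 0) (nt 0)) \<in> W"
    if "100 \<le> n" "100 \<le> m" for m n
  proof -
    have "differs (\<Psi> \<cdot> Var (n, one) \<cdot> Var (m, N)) (Var (n, one)) (Var (m, N)) (Var (m, N)) \<in> W"
      using that assms by (subst differs_iff) simp_all
    then show ?thesis using assms that by (simp add: differs_def computes_def)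
  qed
  then have "All (nv 0) (differs (\<Psi> \<cdot> Var (n, one) \<cdot> nt 0) (Var (n, one)) (nt 0) (nt 0)) \<in> W"
    if "100 \<le> n" for n
    using that assms by (intro W_AllI) (simp_all add: L_All differs_L)
  then have "fsubst (fv 0) (Var (n, one)) (All (nv 0) (differs (\<Psi> \<cdot> ft 0 \<cdot> nt 0) (ft 0) (nt 0) (nt 0))) \<in> W"
    if "100 \<le> n" for n
    using that assms by (simp add: differs_def computes_def)
  then show ?thesis using UDNR_L[OF assms(1)] unfolding UDNR_def by (intro W_AllI) simp_all
qed

lemma MU_D:
  assumes "MU \<mu> \<in> W" "ok two \<mu>" "ok one f" "big \<mu>" "big f" "ap1 f i = Z"
  shows "ap1 f (V (\<mu> \<cdot> f)) = Z"
proof -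
  have "fsubst (fv 0) f (Ex (nv 0) (Eq (ft 0 \<cdot> nt 0) zero) \<^bold>\<longrightarrow> Eq (ft 0 \<cdot> (\<mu> \<cdot> ft 0)) zero) \<in> W"
    using assms unfolding MU_def by (intro W_inst) simp_all
  then have "(Ex (nv 0) (Eq (f \<cdot> nt 0) zero) \<^bold>\<longrightarrow> Eq (f \<cdot> (\<mu> \<cdot> f)) zero) \<in> W" using assms by simp
  moreover have "Ex (nv 0) (Eq (f \<cdot> nt 0) zero) \<in> W"
    using assms by (intro W_ExI[where t = "R i"]) (simp_all add: L_All L_Eq)
  ultimately have "Eq (f \<cdot> (\<mu> \<cdot> f)) zero \<in> W" by (rule W_mp)
  moreover have "V (f \<cdot> (\<mu> \<cdot> f)) = ap1 f (V (\<mu> \<cdot> f))" using assms by (intro V_ap1) simp_all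
  ultimately show ?thesis using assms by (simp del: V_machine)
qed

lemma MU_I:
  assumes "ok two \<mu>" "big \<mu>"
    and "\<And>f i. ok one f \<Longrightarrow> big f \<Longrightarrow> ap1 f i = Z \<Longrightarrow> ap1 f (V (\<mu> \<cdot> f)) = Z"
  shows "MU \<mu> \<in> W"
proof -
  have "(Ex (nv 0) (Eq (Var (n, one) \<cdot> nt 0) zero) \<^bold>\<longrightarrow> Eq (Var (n, one) \<cdot> (\<mu> \<cdot> Var (n, one))) zero) \<in> W"
    if n: "100 \<le> n" for n
  proof -
    let ?f = "Var (n, one)"
    have "Eq (?f \<cdot> (\<mu> \<cdot> ?f)) zero \<in> W" if ex: "Ex (nv 0) (Eq (?f \<cdot> nt 0) zero) \<in> W"
    proof -
      obtain m where "fsubst (nv 0) (Var (m, N)) (Eq (?f \<cdot> nt 0) zero) \<in> W"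
        using ex by (elim W_ExE) simp
      then have "ap1 ?f (V (Var (m, N))) = Z" using n by simp
      then have "ap1 ?f (V (\<mu> \<cdot> ?f)) = Z" using n by (intro assms(3)) simp_all
      moreover have "V (?f \<cdot> (\<mu> \<cdot> ?f)) = ap1 ?f (V (\<mu> \<cdot> ?f))" using assms by (intro V_ap1) simp_all
      ultimately show ?thesis using assms by (simp del: V_machine)
    qed
    then show ?thesis using assms by (simp add: L_All L_Eq del: W_Eq)
  qed
  then show ?thesis using assms MU_L[OF assms(1)] unfolding MU_def by (intro W_AllI) simp_all
qed

lemma extensionality_functional_D:
  assumes "extensionality_functional \<Phi> \<Psi> \<in> W" "ok (one \<rightarrow> one \<rightarrow> N \<rightarrow> N) \<Phi>" "ok (one \<rightarrow> one) \<Psi>"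
    "ok one C" "ok one D" "ok N k" "big \<Phi>" "big \<Psi>" "big C" "big D" "big k"
    "V (seg C (\<Phi> \<cdot> C \<cdot> D \<cdot> k)) = V (seg D (\<Phi> \<cdot> C \<cdot> D \<cdot> k))"
  shows "V (seg (\<Psi> \<cdot> C) k) = V (seg (\<Psi> \<cdot> D) k)"
proof -
  let ?\<phi> = "\<lambda>k C D. Eq (seg C (\<Phi> \<cdot> C \<cdot> D \<cdot> k)) (seg D (\<Phi> \<cdot> C \<cdot> D \<cdot> k)) \<^bold>\<longrightarrow> Eq (seg (\<Psi> \<cdot> C) k) (seg (\<Psi> \<cdot> D) k)"
  have "fsubst (nv 0) k (All (fv 0) (All (fv 1) (?\<phi> (nt 0) (ft 0) (ft 1)))) \<in> W"
    using assms(1-11) unfolding extensionality_functional_def by (intro W_inst) simp_all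
  then have "All (fv 0) (All (fv 1) (?\<phi> k (ft 0) (ft 1))) \<in> W" using assms(2-11) by simp
  then have "fsubst (fv 0) C (All (fv 1) (?\<phi> k (ft 0) (ft 1))) \<in> W"
    using assms(2-11) by (intro W_inst) simp_all
  then have "All (fv 1) (?\<phi> k C (ft 1)) \<in> W" using assms(2-11) by simp
  then have "fsubst (fv 1) D (?\<phi> k C (ft 1)) \<in> W"
    using assms(2-11) by (intro W_inst) simp_all
  then have "?\<phi> k C D \<in> W" using assms(2-11) by simp
  then show ?thesis using assms(2-6,12) by (simp add: L_Eq del: V_machine)
qed

section \<open>A diagonally nonrecursive functional from the mu-operator\<close>

lemma haltV: "ok one A \<Longrightarrow> ok N e \<Longrightarrow> ap1 (haltT \<cdot> A \<cdot> e) k = Sc Z \<ominus> ap3 (resultT \<cdot> A) (V e) (V e) k"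
  using V_lams[of "monus (suc zero) (result (ft 0) (nt 0) (nt 0) (nt 1))" "[fv 0, nv 0, nv 1]" Var "[A, e, R k]"]
  unfolding ap1_def[of "haltT \<cdot> A \<cdot> e"] by (simp add: haltT_def)

lemma Sc_Z_monus: "Sc Z \<ominus> a = Z \<longleftrightarrow> a \<noteq> Z"
  using value_cases[of a] by (metis Sc_not_Z(1) Z_monus monusV_rec(1) monus_Sc_Sc)

lemma findV:
  assumes "ok two \<mu>" "ok one A" "ok N e"
  shows "ap1 (findT \<cdot> \<mu> \<cdot> A) (V e) = V (\<mu> \<cdot> (haltT \<cdot> A \<cdot> e))"
proof -
  have "ap1 (findT \<cdot> \<mu> \<cdot> A) (V e) = V (findT \<cdot> \<mu> \<cdot> A \<cdot> e)" using assms by simp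
  also have "\<dots> = V (\<mu> \<cdot> (haltT \<cdot> A \<cdot> e))"
    using V_lams[of "Var \<mu>_var \<cdot> (haltT \<cdot> ft 0 \<cdot> nt 0)" "[\<mu>_var, fv 0, nv 0]" Var "[\<mu>, A, e]"] assms
    by (simp add: findT_def del: V_machine)
  finally show ?thesis .
qed

lemma dnrV:
  assumes "ok two \<mu>" "ok one A" "ok N e"
  shows "V (dnrT \<cdot> \<mu> \<cdot> A \<cdot> e) = ap3 (resultT \<cdot> A) (V e) (V e) (ap1 (findT \<cdot> \<mu> \<cdot> A) (V e))"
proof -
  have "V (dnrT \<cdot> \<mu> \<cdot> A \<cdot> e) = V (result A e e (findT \<cdot> \<mu> \<cdot> A \<cdot> e))"
    using V_lams[of "result (ft 0) (nt 0) (nt 0) (findT \<cdot> Var \<mu>_var \<cdot> ft 0 \<cdot> nt 0)" "[\<mu>_var, fv 0, nv 0]" Var "[\<mu>, A, e]"] assms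
    by (simp add: dnrT_def del: V_machine)
  then show ?thesis using assms by simp
qed

text \<open>\<open>Sc\<close> is not the successor of type \<open>nat\<close> but an operation on
  the enumerated classes, so even this is proved by induction in the world.\<close>

lemma Sc_neq [simp]: "Sc a \<noteq> a"
  by (rule quantifier_free_induct[of "\<lambda>a. Sc a \<noteq> a"]) (intro definable | simp)+

text \<open>If the machine has halted after \<open>findT \<mu> A e\<close> steps, then \<open>dnrT \<mu> A e\<close> is the successor of its output.\<close>

lemma dnr_differs:
  assumes "ok two \<mu>" "ok one A" "ok N e"
    and "ap3 (resultT \<cdot> A) (V e) (V e) k \<noteq> Z \<Longrightarrow>
      ap3 (resultT \<cdot> A) (V e) (V e) (ap1 (findT \<cdot> \<mu> \<cdot> A) (V e)) \<noteq> Z"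
  shows "ap3 (resultT \<cdot> A) (V e) (V e) k \<noteq> Sc (V (dnrT \<cdot> \<mu> \<cdot> A \<cdot> e))"
proof
  let ?r = "ap3 (resultT \<cdot> A) (V e) (V e)" and ?y = "V (dnrT \<cdot> \<mu> \<cdot> A \<cdot> e)"
  assume k: "?r k = Sc ?y"
  then have "?y \<noteq> Z" using assms dnrV by simp
  then obtain y where "?y = Sc y" using value_cases by metis
  then have "?r (ap1 (findT \<cdot> \<mu> \<cdot> A) (V e)) = Sc y" using dnrV[OF assms(1-3)] by simp
  \<comment> \<open>Both steps display the output of one computation, so the output would be its own
    successor.\<close>
  then have "y = ?y" using result_unique[OF assms(2) _ k] by simp
  then show False using \<open>?y = Sc y\<close> Sc_neq[of y] by metis
qed

lemma MU_imp_UDNR: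
  assumes "ok two \<mu>" "big \<mu>" "MU \<mu> \<in> W"
  shows "UDNR (dnrT \<cdot> \<mu>) \<in> W"
proof (rule UDNR_I)
  fix A e k assume A: "ok one A" "ok N e" "big A" "big e"
  show "ap3 (resultT \<cdot> A) (V e) (V e) k \<noteq> Sc (V (dnrT \<cdot> \<mu> \<cdot> A \<cdot> e))"
  proof (rule dnr_differs[OF assms(1) A(1,2)])
    assume "ap3 (resultT \<cdot> A) (V e) (V e) k \<noteq> Z"
    then have "ap1 (haltT \<cdot> A \<cdot> e) k = Z" using A by (simp add: haltV Sc_Z_monus)
    then have "ap1 (haltT \<cdot> A \<cdot> e) (V (\<mu> \<cdot> (haltT \<cdot> A \<cdot> e))) = Z"
      using MU_D[OF assms(3,1), of "haltT \<cdot> A \<cdot> e"] assms A by simp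
    then show "ap3 (resultT \<cdot> A) (V e) (V e) (ap1 (findT \<cdot> \<mu> \<cdot> A) (V e)) \<noteq> Z"
      using assms A by (simp add: haltV Sc_Z_monus findV)
  qed
qed (use assms in auto)

section \<open>The mu-operator from a diagonally nonrecursive functional\<close>

lemma UDNR_imp_MU:
  assumes ok: "ok (one \<rightarrow> one) \<Psi>" "ok (one \<rightarrow> one \<rightarrow> N \<rightarrow> N) \<Phi>" and big: "big \<Psi>" "big \<Phi>"
    and UDNR: "UDNR \<Psi> \<in> W" and ext: "extensionality_functional \<Phi> \<Psi> \<in> W"
  shows "MU (muT \<cdot> \<Psi> \<cdot> \<Phi>) \<in> W"
proof (rule MU_I)
  fix f i assume f: "ok one f" "big f" "ap1 f i = Z"
  let ?c = "\<Psi> \<cdot> zeroT \<cdot> program"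
  let ?A = "switchT \<cdot> f \<cdot> ?c"
  let ?m = "\<Phi> \<cdot> zeroT \<cdot> ?A \<cdot> suc program"
  have okc: "ok N ?c" "ok one ?A" "ok N ?m" using ok f by simp_all
  have val: "V (muT \<cdot> \<Psi> \<cdot> \<Phi> \<cdot> f) = ap1 (searchT \<cdot> f) (Sc (V ?m))"
  proof -
    have "V (muT \<cdot> \<Psi> \<cdot> \<Phi> \<cdot> f) = V (searchT \<cdot> f \<cdot> suc ?m)"
      using V_lams[of "searchT \<cdot> ft 0 \<cdot> suc (Var \<Phi>_var \<cdot> zeroT \<cdot> (switchT \<cdot> ft 0 \<cdot> (Var \<Psi>_var \<cdot> zeroT \<cdot> program)) \<cdot> suc program)"
          "[\<Psi>_var, \<Phi>_var, fv 0]" Var "[\<Psi>, \<Phi>, f]"] ok f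
      by (simp add: muT_def del: V_machine)
    then show ?thesis using f okc by simp
  qed
  show "ap1 f (V (muT \<cdot> \<Psi> \<cdot> \<Phi> \<cdot> f)) = Z"
  proof (rule ccontr)
    assume "ap1 f (V (muT \<cdot> \<Psi> \<cdot> \<Phi> \<cdot> f)) \<noteq> Z"
    \<comment> \<open>If the search fails, then the zero \<open>i\<close> lies beyond its bound, and
      the oracle agrees with the zero function on the segment that \<open>\<Phi>\<close>
      compares.\<close>
    then have none: "ap1 f j \<noteq> Z" if "j \<ominus> Sc (V ?m) = Z" for j
      using search_correct[OF f(1) _ that] val by auto
    have "V (seg zeroT ?m) = V (seg ?A ?m)"
      using seg_switch[OF f(1) okc(1) none] okc by simp
    then have "V (seg (\<Psi> \<cdot> zeroT) (suc program)) = V (seg (\<Psi> \<cdot> ?A) (suc program))"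
      using ok big f okc by (intro extensionality_functional_D[OF ext]) simp_all
    then have "ap1 (\<Psi> \<cdot> zeroT) (V program) = ap1 (\<Psi> \<cdot> ?A) (V program)"
      using seg_Sc_eq[of "\<Psi> \<cdot> zeroT" "\<Psi> \<cdot> ?A" "V program"] ok okc by simp
    then have c: "V (\<Psi> \<cdot> ?A \<cdot> program) = V ?c" using ok okc by simp
    \<comment> \<open>That \<open>f\<close> does not vanish at 0 is part of the failure of the
      search, which begins there.\<close>
    obtain k where "ap3 (resultT \<cdot> ?A) (V program) (V program) k = Sc (V ?c)"
      using program_halts[OF f(1) okc(1) none[of Z] f(3)] by auto
    then show False using UDNR_D[OF UDNR ok(1) okc(2), of program k] big f c by simp
  qed
qed (use ok big in auto)

end

section \<open>The nonstandard equivalence\<close>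

text \<open>Exchanges zeros and nonzero values: by transfer for \<open>notT \<cdot> f\<close>, a
  standard \<open>f\<close> that has a zero has a standard one.\<close>

definition "notT = lams [fv 0, nv 0] (monus (suc zero) (ft 0 \<cdot> nt 0))"

lemma notT [simp]: "wt notT" "ttype notT = (one \<rightarrow> one)" "star_free_tm notT" "tvars notT = {}"
  by (auto simp: notT_def)

text \<open>Vanishes exactly where the two functions agree, so that transfer, which is stated for
  zeros, applies to agreement.\<close>

definition "distT = lams [fv 0, fv 1, nv 0]
  (add (monus (ft 0 \<cdot> nt 0) (ft 1 \<cdot> nt 0)) (monus (ft 1 \<cdot> nt 0) (ft 0 \<cdot> nt 0)))"

lemma distT [simp]: "wt distT" "ttype distT = (one \<rightarrow> one \<rightarrow> one)" "star_free_tm distT" "tvars distT = {}"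
  by (auto simp: distT_def)

definition "compT = lams [fv 0, fv 1, nv 0] (ft 0 \<cdot> (ft 1 \<cdot> nt 0))"

lemma compT [simp]: "wt compT" "ttype compT = (one \<rightarrow> one \<rightarrow> one)" "star_free_tm compT" "tvars compT = {}"
  by (auto simp: compT_def)

text \<open>If \<open>G f 0, \<dots>, G f (l f - 1)\<close> contain a zero of \<open>f\<close>, then \<open>pickT l G f\<close> is a zero of \<open>f\<close>.\<close>

definition "pickT = lams [(0, two), (0, one \<rightarrow> one), fv 0]
  (Var (0, one \<rightarrow> one) \<cdot> ft 0 \<cdot> (searchT \<cdot> (compT \<cdot> ft 0 \<cdot> (Var (0, one \<rightarrow> one) \<cdot> ft 0)) \<cdot> (Var (0, two) \<cdot> ft 0)))"

lemma pickT [simp]: "wt pickT" "ttype pickT = (two \<rightarrow> (one \<rightarrow> one) \<rightarrow> two)" "star_free_tm pickT" "tvars pickT = {}"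
  by (auto simp: pickT_def)

text \<open>\<open>checkT \<mu> A\<close> vanishes if and only if \<open>findT \<mu> A\<close> is correct at every program \<open>e\<close>. It serves to
  transfer this from the standard \<open>e\<close> to all \<open>e\<close>.\<close>

definition "checkT = lams [\<mu>_var, fv 0, nv 0]
  (cond (result (ft 0) (pfst (nt 0)) (pfst (nt 0)) (psnd (nt 0))) zero
    (cond (result (ft 0) (pfst (nt 0)) (pfst (nt 0)) (findT \<cdot> Var \<mu>_var \<cdot> ft 0 \<cdot> pfst (nt 0))) (suc zero) zero))"

lemma checkT [simp]: "wt checkT" "ttype checkT = (two \<rightarrow> one \<rightarrow> one)" "star_free_tm checkT" "tvars checkT = {}"
  by (auto simp: checkT_def)

text \<open>Written directly with the combinators, since \<open>beta_lams\<close> is restricted to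
  star-free bodies.\<close>

definition seqlenT :: "tm \<Rightarrow> tm" where
  "seqlenT F = Cst (S one (Seq N) N) \<cdot> (Cst (K (Seq N \<rightarrow> N) one) \<cdot> Cst (Len N)) \<cdot> F"

definition seqgetT :: "tm \<Rightarrow> tm" where
  "seqgetT F = Cst (S one (Seq N) one) \<cdot> (Cst (K (Seq N \<rightarrow> one) one) \<cdot> Cst (Get N)) \<cdot> F"

definition UDNR_plus_body :: "tm \<Rightarrow> fm" where
  "UDNR_plus_body \<Psi> =
    (All_st (fv 0) (All (nv 0) (differs (\<Psi> \<cdot> ft 0 \<cdot> nt 0) (ft 0) (nt 0) (nt 0))) \<^bold>\<and>
     All_st (fv 0) (All_st (fv 1) (approx (ft 0) (ft 1) \<^bold>\<longrightarrow> approx (\<Psi> \<cdot> ft 0) (\<Psi> \<cdot> ft 1))))"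

locale full_calculus = calculus False Ax for Ax
begin

lemma okv [simp]: "okv v"
  by (simp add: okv_def)

lemma L_St [simp]: "St t \<in> L \<longleftrightarrow> wt t"
  by (simp add: L_def)

lemma approx_L: "ok one C \<Longrightarrow> ok one D \<Longrightarrow> approx C D \<in> L"
  by (simp add: approx_def L_All L_Eq)

lemma TRANS_L: "Pi01_TRANS \<in> L"
  by (simp add: Pi01_TRANS_def L_All L_Eq)

lemma UDNR_plus_body_L: "ok (one \<rightarrow> one) \<Psi> \<Longrightarrow> UDNR_plus_body \<Psi> \<in> L"
  by (simp add: UDNR_plus_body_def L_All differs_L approx_L)

lemma UDNR_plus_L: "UDNR_plus \<in> L"
  using UDNR_plus_body_L[of "Var \<Psi>_var"] by (simp add: UDNR_plus_def UDNR_plus_body_def L_All)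

end

locale nonstandard_world = world False Ax W + full_calculus Ax for Ax W +
  assumes nonstandard: "Standardness \<union> HAC_int \<subseteq> Ax"
begin

notation addV (infixl "\<oplus>" 65) and monusV (infixl "\<ominus>" 65)


section \<open>Standard terms and the nonstandard principles in a world\<close>

lemma ok_wt: "ok \<rho> t \<Longrightarrow> wt t"
  by (simp add: ok_def)

lemma W_nonstandard: "\<phi> \<in> Standardness \<union> HAC_int \<Longrightarrow> \<phi> \<in> L \<Longrightarrow> \<phi> \<in> W"
  using nonstandard by (intro W_prv derivable.axiom) auto

lemma W_conjD: "(\<phi> \<^bold>\<and> \<psi>) \<in> W \<Longrightarrow> \<phi> \<in> W \<and> \<psi> \<in> W"
  using subsetD[OF W_L, of "\<phi> \<^bold>\<and> \<psi>"] by simp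

lemma St_closed: "tvars t = {} \<Longrightarrow> wt t \<Longrightarrow> St t \<in> W"
  by (intro W_nonstandard) (auto intro: Standardness.intros)

lemma St_app:
  assumes "St s \<in> W" "St t \<in> W" "wt (s \<cdot> t)"
  shows "St (s \<cdot> t) \<in> W"
proof -
  have L: "(St s \<^bold>\<and> St t \<^bold>\<longrightarrow> St (s \<cdot> t)) \<in> L" using assms(3) by simp
  then have "(St s \<^bold>\<and> St t \<^bold>\<longrightarrow> St (s \<cdot> t)) \<in> W" by (intro W_nonstandard) (auto intro: Standardness.intros)
  then show ?thesis using assms L by simp
qed

lemmas St_simps = St_app St_closed ok_def

lemma approx_D:
  assumes "approx C D \<in> W" "ok one C" "ok one D" "big C" "big D" "ok N t" "St t \<in> W"
  shows "ap1 C (V t) = ap1 D (V t)"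
proof -
  have "fsubst (nv 0) t (St (nt 0) \<^bold>\<longrightarrow> Eq (C \<cdot> nt 0) (D \<cdot> nt 0)) \<in> W"
    using assms unfolding approx_def by (intro W_inst) simp_all
  then show ?thesis using assms ok_wt[of N t] by (simp add: L_Eq)
qed

lemma approx_I:
  assumes "ok one C" "ok one D" "big C" "big D"
    and "\<And>t. ok N t \<Longrightarrow> big t \<Longrightarrow> St t \<in> W \<Longrightarrow> ap1 C (V t) = ap1 D (V t)"
  shows "approx C D \<in> W"
proof -
  have "fsubst (nv 0) (Var (n, N)) (St (nt 0) \<^bold>\<longrightarrow> Eq (C \<cdot> nt 0) (D \<cdot> nt 0)) \<in> W" if "100 \<le> n" for n
    using assms(1-4) assms(5)[of "Var (n, N)"] that by (simp add: L_Eq)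
  then show ?thesis using approx_L assms unfolding approx_def by (intro W_AllI) auto
qed

lemma TRANS_D:
  assumes "Pi01_TRANS \<in> W" "ok one f" "big f" "St f \<in> W"
    and "\<And>t. ok N t \<Longrightarrow> big t \<Longrightarrow> St t \<in> W \<Longrightarrow> ap1 f (V t) = Z"
  shows "ap1 f a = Z"
proof -
  let ?\<phi> = "\<lambda>f. All_st (nv 0) (Eq (f \<cdot> nt 0) zero)" and ?\<psi> = "\<lambda>f. All (nv 1) (Eq (f \<cdot> nt 1) zero)"
  have L: "?\<phi> f \<in> L" "?\<psi> f \<in> L" "wt f" using assms(2) ok_wt by (simp_all add: L_All L_Eq)
  have "fsubst (fv 0) f (St (ft 0) \<^bold>\<longrightarrow> ?\<phi> (ft 0) \<^bold>\<longrightarrow> ?\<psi> (ft 0)) \<in> W"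
    using assms(1-3) unfolding Pi01_TRANS_def by (intro W_inst) simp_all
  then have "(St f \<^bold>\<longrightarrow> ?\<phi> f \<^bold>\<longrightarrow> ?\<psi> f) \<in> W" using assms(3) by simp
  then have "(?\<phi> f \<^bold>\<longrightarrow> ?\<psi> f) \<in> W" using assms(4) by (rule W_mp)
  moreover have "fsubst (nv 0) (Var (n, N)) (St (nt 0) \<^bold>\<longrightarrow> Eq (f \<cdot> nt 0) zero) \<in> W" if "100 \<le> n" for n
    using assms(2,3) assms(5)[of "Var (n, N)"] that by (simp add: L_Eq)
  then have "?\<phi> f \<in> W" using L by (intro W_AllI) auto
  ultimately have "?\<psi> f \<in> W" by (rule W_mp)
  then have "fsubst (nv 1) (R a) (Eq (f \<cdot> nt 1) zero) \<in> W" by (intro W_inst) simp_all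
  then show ?thesis using assms(2,3) by simp
qed

lemma TRANS_I:
  assumes "\<And>f a. ok one f \<Longrightarrow> big f \<Longrightarrow> St f \<in> W \<Longrightarrow>
    (\<And>t. ok N t \<Longrightarrow> St t \<in> W \<Longrightarrow> ap1 f (V t) = Z) \<Longrightarrow> ap1 f a = Z"
  shows "Pi01_TRANS \<in> W"
proof -
  let ?\<phi> = "\<lambda>f. All_st (nv 0) (Eq (f \<cdot> nt 0) zero)" and ?\<psi> = "\<lambda>f. All (nv 1) (Eq (f \<cdot> nt 1) zero)"
  have "fsubst (fv 0) (Var (n, one)) (St (ft 0) \<^bold>\<longrightarrow> ?\<phi> (ft 0) \<^bold>\<longrightarrow> ?\<psi> (ft 0)) \<in> W" if n: "100 \<le> n" for n
  proof -
    let ?f = "Var (n, one)"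
    have L: "?\<phi> ?f \<in> L" "?\<psi> ?f \<in> L" by (simp_all add: L_All L_Eq)
    have "?\<psi> ?f \<in> W" if st: "St ?f \<in> W" "?\<phi> ?f \<in> W"
    proof -
      have "ap1 ?f (V t) = Z" if t: "ok N t" "St t \<in> W" for t
      proof -
        have "fsubst (nv 0) t (St (nt 0) \<^bold>\<longrightarrow> Eq (?f \<cdot> nt 0) zero) \<in> W"
          using st(2) t by (intro W_inst) simp_all
        then show ?thesis using t ok_wt n by (simp add: L_Eq)
      qed
      then have "ap1 ?f a = Z" for a using assms[of ?f] st n by simp
      then show ?thesis using L n by (intro W_AllI) simp_all
    qed
    then show ?thesis using L by simp
  qed
  then show ?thesis using TRANS_L unfolding Pi01_TRANS_def by (intro W_AllI) auto
qed

lemma UDNR_plus_body_D1: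
  assumes "UDNR_plus_body \<Psi> \<in> W" "ok (one \<rightarrow> one) \<Psi>" "big \<Psi>" "ok one A" "big A" "St A \<in> W" "ok N e" "big e"
  shows "ap3 (resultT \<cdot> A) (V e) (V e) k \<noteq> Sc (V (\<Psi> \<cdot> A \<cdot> e))"
proof -
  let ?\<phi> = "\<lambda>A. All (nv 0) (differs (\<Psi> \<cdot> A \<cdot> nt 0) A (nt 0) (nt 0))"
  have "All_st (fv 0) (?\<phi> (ft 0)) \<in> W"
    using assms(1,2) unfolding UDNR_plus_body_def by (simp add: L_All differs_L approx_L)
  then have "fsubst (fv 0) A (St (ft 0) \<^bold>\<longrightarrow> ?\<phi> (ft 0)) \<in> W"
    using assms by (intro W_inst) (simp_all add: differs_def computes_def)
  then have "(St A \<^bold>\<longrightarrow> ?\<phi> A) \<in> W" using assms by (simp add: differs_def computes_def)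
  then have "?\<phi> A \<in> W" using assms(6) by (rule W_mp)
  then have "fsubst (nv 0) e (differs (\<Psi> \<cdot> A \<cdot> nt 0) A (nt 0) (nt 0)) \<in> W"
    using assms by (intro W_inst) (simp_all add: differs_def computes_def)
  then have "differs (\<Psi> \<cdot> A \<cdot> e) A e e \<in> W"
    using assms by (simp add: differs_def computes_def)
  then show ?thesis using assms by (simp add: differs_iff del: V_machine)
qed

lemma UDNR_plus_body_D2:
  assumes "UDNR_plus_body \<Psi> \<in> W" "ok (one \<rightarrow> one) \<Psi>" "big \<Psi>" "ok one C" "big C" "St C \<in> W"
    "ok one D" "big D" "St D \<in> W" "approx C D \<in> W"
  shows "approx (\<Psi> \<cdot> C) (\<Psi> \<cdot> D) \<in> W"
proof -
  let ?\<phi> = "\<lambda>C D. approx C D \<^bold>\<longrightarrow> approx (\<Psi> \<cdot> C) (\<Psi> \<cdot> D)"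
  have "All_st (fv 0) (All_st (fv 1) (?\<phi> (ft 0) (ft 1))) \<in> W"
    using assms(1,2) unfolding UDNR_plus_body_def by (simp add: L_All differs_L approx_L)
  then have "fsubst (fv 0) C (St (ft 0) \<^bold>\<longrightarrow> All_st (fv 1) (?\<phi> (ft 0) (ft 1))) \<in> W"
    using assms by (intro W_inst) (simp_all add: approx_def)
  then have "(St C \<^bold>\<longrightarrow> All_st (fv 1) (?\<phi> C (ft 1))) \<in> W" using assms by (simp add: approx_def)
  then have "All_st (fv 1) (?\<phi> C (ft 1)) \<in> W" using assms(6) by (rule W_mp)
  then have "fsubst (fv 1) D (St (ft 1) \<^bold>\<longrightarrow> ?\<phi> C (ft 1)) \<in> W"
    using assms by (intro W_inst) (simp_all add: approx_def)
  then have "(St D \<^bold>\<longrightarrow> ?\<phi> C D) \<in> W" using assms by (simp add: approx_def)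
  then have "?\<phi> C D \<in> W" using assms(9) by (rule W_mp)
  then show ?thesis using assms(10) by (rule W_mp)
qed

lemma UDNR_plus_D:
  assumes "UDNR_plus \<in> W"
  obtains \<Psi> where "ok (one \<rightarrow> one) \<Psi>" "big \<Psi>" "St \<Psi> \<in> W" "UDNR_plus_body \<Psi> \<in> W"
proof -
  have "Ex_st \<Psi>_var (UDNR_plus_body (Var \<Psi>_var)) \<in> W"
    using assms by (simp add: UDNR_plus_def UDNR_plus_body_def)
  then obtain n where n: "100 \<le> n"
    "fsubst \<Psi>_var (Var (n, one \<rightarrow> one)) (St (Var \<Psi>_var) \<^bold>\<and> UDNR_plus_body (Var \<Psi>_var)) \<in> W"
    by (elim W_ExE) simp
  let ?\<Psi> = "Var (n, one \<rightarrow> one)"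
  have "(St ?\<Psi> \<^bold>\<and> UDNR_plus_body ?\<Psi>) \<in> W"
    using n(2) by (simp add: UDNR_plus_body_def differs_def computes_def approx_def)
  then have "St ?\<Psi> \<in> W" "UDNR_plus_body ?\<Psi> \<in> W" using UDNR_plus_body_L[of ?\<Psi>] by simp_all
  then show thesis using that[of ?\<Psi>] n by simp
qed

lemma UDNR_plus_I:
  assumes \<Psi>: "ok (one \<rightarrow> one) \<Psi>" "big \<Psi>" "St \<Psi> \<in> W"
    and dnr: "\<And>A e k. ok one A \<Longrightarrow> big A \<Longrightarrow> St A \<in> W \<Longrightarrow> ok N e \<Longrightarrow> big e \<Longrightarrow>
      ap3 (resultT \<cdot> A) (V e) (V e) k \<noteq> Sc (V (\<Psi> \<cdot> A \<cdot> e))"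
    and ext: "\<And>C D. ok one C \<Longrightarrow> big C \<Longrightarrow> St C \<in> W \<Longrightarrow> ok one D \<Longrightarrow> big D \<Longrightarrow> St D \<in> W \<Longrightarrow>
      approx C D \<in> W \<Longrightarrow> approx (\<Psi> \<cdot> C) (\<Psi> \<cdot> D) \<in> W"
  shows "UDNR_plus \<in> W"
proof -
  let ?d = "\<lambda>A. All (nv 0) (differs (\<Psi> \<cdot> A \<cdot> nt 0) A (nt 0) (nt 0))"
  let ?e = "\<lambda>C D. approx C D \<^bold>\<longrightarrow> approx (\<Psi> \<cdot> C) (\<Psi> \<cdot> D)"
  have dL: "?d A \<in> L" if "ok one A" for A using that \<Psi> by (simp add: L_All differs_L)
  have eL: "?e C D \<in> L" if "ok one C" "ok one D" for C D using that \<Psi> by (simp add: approx_L)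
  have "fsubst (fv 0) (Var (n, one)) (St (ft 0) \<^bold>\<longrightarrow> ?d (ft 0)) \<in> W" if n: "100 \<le> n" for n
  proof -
    let ?A = "Var (n, one)"
    have "?d ?A \<in> W" if "St ?A \<in> W"
    proof (rule W_AllI)
      fix m :: nat assume m: "100 \<le> m"
      have "differs (\<Psi> \<cdot> ?A \<cdot> Var (m, N)) ?A (Var (m, N)) (Var (m, N)) \<in> W"
        using that n m \<Psi> dnr by (subst differs_iff) simp_all
      then show "fsubst (nv 0) (Var (m, snd (nv 0))) (differs (\<Psi> \<cdot> ?A \<cdot> nt 0) ?A (nt 0) (nt 0)) \<in> W"
        using \<Psi> n m by (simp add: differs_def computes_def)
    qed (rule dL, simp)
    then have "(St ?A \<^bold>\<longrightarrow> ?d ?A) \<in> W" using dL[of ?A] by simp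
    then show ?thesis using \<Psi> by (simp add: differs_def computes_def)
  qed
  then have 1: "All_st (fv 0) (?d (ft 0)) \<in> W" using dL[of "ft 0"] by (intro W_AllI) (simp_all add: L_All[of "fv 0"])
  have "fsubst (fv 0) (Var (n, one)) (St (ft 0) \<^bold>\<longrightarrow> All_st (fv 1) (?e (ft 0) (ft 1))) \<in> W" if n: "100 \<le> n" for n
  proof -
    let ?C = "Var (n, one)"
    have "All_st (fv 1) (?e ?C (ft 1)) \<in> W" if C: "St ?C \<in> W"
    proof (rule W_AllI)
      fix m :: nat assume m: "100 \<le> m"
      let ?D = "Var (m, one)"
      have "(St ?D \<^bold>\<longrightarrow> ?e ?C ?D) \<in> W" using ext[of ?C ?D] C n m \<Psi> by (simp add: approx_L)
      then show "fsubst (fv 1) (Var (m, snd (fv 1))) (St (ft 1) \<^bold>\<longrightarrow> ?e ?C (ft 1)) \<in> W"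
        using \<Psi> n m by (simp add: approx_def)
    qed (use eL[of ?C "ft 1"] in \<open>simp add: L_All\<close>)
    then have "(St ?C \<^bold>\<longrightarrow> All_st (fv 1) (?e ?C (ft 1))) \<in> W" using eL[of ?C "ft 1"] by (simp add: L_All)
    then show ?thesis using \<Psi> by (simp add: approx_def)
  qed
  then have 2: "All_st (fv 0) (All_st (fv 1) (?e (ft 0) (ft 1))) \<in> W"
    using eL[of "ft 0" "ft 1"] by (intro W_AllI) (simp_all add: L_All)
  have "UDNR_plus_body \<Psi> \<in> W" using 1 2 W_L unfolding UDNR_plus_body_def by (subst W_Imp) auto
  then have body: "(St \<Psi> \<^bold>\<and> UDNR_plus_body \<Psi>) \<in> W"
    using \<Psi> UDNR_plus_body_L by (simp add: ok_wt)
  have sub: "fsubst \<Psi>_var \<Psi> (St (Var \<Psi>_var) \<^bold>\<and> UDNR_plus_body (Var \<Psi>_var)) = (St \<Psi> \<^bold>\<and> UDNR_plus_body \<Psi>)"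
    by (simp add: UDNR_plus_body_def differs_def computes_def approx_def)
  have "Ex_st \<Psi>_var (UDNR_plus_body (Var \<Psi>_var)) \<in> W"
  proof (rule W_ExI)
    show "Ex_st \<Psi>_var (UDNR_plus_body (Var \<Psi>_var)) \<in> L"
      using UDNR_plus_body_L[of "Var \<Psi>_var"] by (simp add: L_All)
    show "fsubst \<Psi>_var \<Psi> (St (Var \<Psi>_var) \<^bold>\<and> UDNR_plus_body (Var \<Psi>_var)) \<in> W" unfolding sub by (rule body)
    show "ok (snd \<Psi>_var) \<Psi>" using \<Psi> by simp
    show "free_for \<Psi> \<Psi>_var (St (Var \<Psi>_var) \<^bold>\<and> UDNR_plus_body (Var \<Psi>_var))"
      using \<Psi> by (simp add: UDNR_plus_body_def differs_def computes_def approx_def)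
  qed
  then show ?thesis by (simp add: UDNR_plus_def UDNR_plus_body_def)
qed

section \<open>Values of the auxiliary functionals\<close>

lemma notV: "ok one f \<Longrightarrow> ap1 (notT \<cdot> f) k = Sc Z \<ominus> ap1 f k"
  using V_lams[of "monus (suc zero) (ft 0 \<cdot> nt 0)" "[fv 0, nv 0]" Var "[f, R k]"]
  unfolding ap1_def[of "notT \<cdot> f"] by (simp add: notT_def)

lemma distV: "ok one C \<Longrightarrow> ok one D \<Longrightarrow> 
    ap1 (distT \<cdot> C \<cdot> D) k = (ap1 C k \<ominus> ap1 D k) \<oplus> (ap1 D k \<ominus> ap1 C k)"
  using V_lams[of "add (monus (ft 0 \<cdot> nt 0) (ft 1 \<cdot> nt 0)) (monus (ft 1 \<cdot> nt 0) (ft 0 \<cdot> nt 0))"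
      "[fv 0, fv 1, nv 0]" Var "[C, D, R k]"]
  unfolding ap1_def[of "distT \<cdot> C \<cdot> D"] by (simp add: distT_def)

lemma compV: "ok one f \<Longrightarrow> ok one g \<Longrightarrow> ap1 (compT \<cdot> f \<cdot> g) k = ap1 f (ap1 g k)"
  using V_lams[of "ft 0 \<cdot> (ft 1 \<cdot> nt 0)" "[fv 0, fv 1, nv 0]" Var "[f, g, R k]"]
  unfolding ap1_def[of "compT \<cdot> f \<cdot> g"] by (simp add: compT_def)

lemma ok_nonstandard [simp]:
  "ok one f \<Longrightarrow> ok one (notT \<cdot> f)"
  "ok one f \<Longrightarrow> ok one g \<Longrightarrow> ok one (distT \<cdot> f \<cdot> g)"
  "ok one f \<Longrightarrow> ok one g \<Longrightarrow> ok one (compT \<cdot> f \<cdot> g)"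
  "ok two l \<Longrightarrow> ok (one \<rightarrow> one) G \<Longrightarrow> ok two (pickT \<cdot> l \<cdot> G)"
  "ok two l \<Longrightarrow> ok one f \<Longrightarrow> ok one (checkT \<cdot> l \<cdot> f)"
  "ok (one \<rightarrow> Seq N) F \<Longrightarrow> ok two (seqlenT F)"
  "ok (one \<rightarrow> Seq N) F \<Longrightarrow> ok (one \<rightarrow> one) (seqgetT F)"
  by (simp_all add: ok_def seqlenT_def seqgetT_def)

lemma pickV:
  assumes "ok two l" "ok (one \<rightarrow> one) G" "ok one f"
  shows "V (pickT \<cdot> l \<cdot> G \<cdot> f) = ap1 (G \<cdot> f) (ap1 (searchT \<cdot> (compT \<cdot> f \<cdot> (G \<cdot> f))) (V (l \<cdot> f)))"
proof -
  have "V (pickT \<cdot> l \<cdot> G \<cdot> f) = V (G \<cdot> f \<cdot> (searchT \<cdot> (compT \<cdot> f \<cdot> (G \<cdot> f)) \<cdot> (l \<cdot> f)))"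
    using V_lams[of "Var (0, one \<rightarrow> one) \<cdot> ft 0 \<cdot>
        (searchT \<cdot> (compT \<cdot> ft 0 \<cdot> (Var (0, one \<rightarrow> one) \<cdot> ft 0)) \<cdot> (Var (0, two) \<cdot> ft 0))"
        "[(0, two), (0, one \<rightarrow> one), fv 0]" Var "[l, G, f]"] assms
    by (simp add: pickT_def del: V_machine)
  then show ?thesis using assms by simp
qed

lemma checkV:
  assumes "ok two \<mu>" "ok one A"
  shows "ap1 (checkT \<cdot> \<mu> \<cdot> A) a =
    condV (ap3 (resultT \<cdot> A) (pfstV a) (pfstV a) (psndV a)) Z
      (condV (ap3 (resultT \<cdot> A) (pfstV a) (pfstV a) (ap1 (findT \<cdot> \<mu> \<cdot> A) (pfstV a))) (Sc Z) Z)"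
  using V_lams[of "cond (result (ft 0) (pfst (nt 0)) (pfst (nt 0)) (psnd (nt 0))) zero
      (cond (result (ft 0) (pfst (nt 0)) (pfst (nt 0)) (findT \<cdot> Var \<mu>_var \<cdot> ft 0 \<cdot> pfst (nt 0))) (suc zero) zero)"
      "[\<mu>_var, fv 0, nv 0]" Var "[\<mu>, A, R a]"] assms
  unfolding ap1_def[of "checkT \<cdot> \<mu> \<cdot> A"] by (simp add: checkT_def)

lemma seqlenV:
  assumes "ok (one \<rightarrow> Seq N) F" "ok one f"
  shows "V (seqlenT F \<cdot> f) = V (len N (F \<cdot> f))"
proof -
  have ok: "ok (one \<rightarrow> Seq N \<rightarrow> N) (Cst (K (Seq N \<rightarrow> N) one) \<cdot> Cst (Len N))" "ok (Seq N \<rightarrow> N) (Cst (Len N))"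
    by (simp_all add: ok_def)
  have "V (seqlenT F \<cdot> f) = V (Cst (K (Seq N \<rightarrow> N) one) \<cdot> Cst (Len N) \<cdot> f \<cdot> (F \<cdot> f))"
    unfolding seqlenT_def by (rule V_eqv, rule eqv_S) (use ok assms in auto)
  moreover have "eqv (Seq N \<rightarrow> N) (Cst (K (Seq N \<rightarrow> N) one) \<cdot> Cst (Len N) \<cdot> f) (Cst (Len N))"
    by (rule eqv_K) (use ok assms in auto)
  ultimately show ?thesis using V_eqv assms ok_app[of one "Seq N" F f] by auto
qed

lemma seqgetV:
  assumes "ok (one \<rightarrow> Seq N) F" "ok one f" "ok N t"
  shows "ap1 (seqgetT F \<cdot> f) (V t) = V (entry N (F \<cdot> f) t)"
proof -
  have ok: "ok (one \<rightarrow> Seq N \<rightarrow> one) (Cst (K (Seq N \<rightarrow> one) one) \<cdot> Cst (Get N))" "ok (Seq N \<rightarrow> one) (Cst (Get N))"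
    by (simp_all add: ok_def)
  have F: "ok (Seq N) (F \<cdot> f)" using assms by (intro ok_app)
  have "eqv one (seqgetT F \<cdot> f) (Cst (K (Seq N \<rightarrow> one) one) \<cdot> Cst (Get N) \<cdot> f \<cdot> (F \<cdot> f))"
    unfolding seqgetT_def by (rule eqv_S) (use ok assms in auto)
  then have "V (seqgetT F \<cdot> f \<cdot> t) = V (Cst (K (Seq N \<rightarrow> one) one) \<cdot> Cst (Get N) \<cdot> f \<cdot> (F \<cdot> f) \<cdot> t)"
    using V_eqv assms(3) by simp
  moreover have "eqv (Seq N \<rightarrow> one) (Cst (K (Seq N \<rightarrow> one) one) \<cdot> Cst (Get N) \<cdot> f) (Cst (Get N))"
    by (rule eqv_K) (use ok assms in auto)
  then have "V (Cst (K (Seq N \<rightarrow> one) one) \<cdot> Cst (Get N) \<cdot> f \<cdot> (F \<cdot> f) \<cdot> t) = V (entry N (F \<cdot> f) t)"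
    using V_eqv F assms(3) by simp
  ultimately show ?thesis using assms by simp
qed

section \<open>Transfer from the uniform nonstandard principle\<close>

lemma UDNR_plus_imp_TRANS:
  assumes "UDNR_plus \<in> W"
  shows "Pi01_TRANS \<in> W"
proof -
  obtain \<Psi> where \<Psi>: "ok (one \<rightarrow> one) \<Psi>" "big \<Psi>" "St \<Psi> \<in> W" "UDNR_plus_body \<Psi> \<in> W"
    using assms UDNR_plus_D by blast
  let ?c = "\<Psi> \<cdot> zeroT \<cdot> program"
  have st0: "St zeroT \<in> W" "St program \<in> W" "St zero \<in> W" by (rule St_closed; simp)+
  have c: "ok N ?c" "St ?c \<in> W"
    using \<Psi> st0 by (simp_all add: St_simps)
  show ?thesis
  proof (rule TRANS_I, rule ccontr)
    fix f m
    assume f: "ok one f" "big f" "St f \<in> W" and zero: "\<And>t. ok N t \<Longrightarrow> St t \<in> W \<Longrightarrow> ap1 f (V t) = Z"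
      and m: "ap1 f m \<noteq> Z"
    \<comment> \<open>The zeros of \<open>?g\<close> are the arguments at which \<open>f\<close>
      does not vanish; none of them is standard, but \<open>m\<close> is one.\<close>
    let ?g = "notT \<cdot> f"
    let ?A = "switchT \<cdot> ?g \<cdot> ?c"
    have A: "St ?A \<in> W" using f c by (simp add: St_simps)
    have g: "ap1 ?g (V t) = Sc Z" if "ok N t" "St t \<in> W" for t
      using zero[OF that] f by (simp add: notV)
    have "St (suc t) \<in> W" if "ok N t" "St t \<in> W" for t
      using that by (simp add: St_simps)
    \<comment> \<open>At \<open>t\<close> and at its successor, which is standard too,
      \<open>?g\<close> has the value 1, so the oracle takes its default value.\<close>
    then have "ap1 ?A (V t) = Z" if "ok N t" "St t \<in> W" for t
      using that f c g[of t] g[of "suc t"] by (simp add: switchV)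
    then have "approx zeroT ?A \<in> W"
      using f c \<Psi> by (intro approx_I) simp_all
    then have "approx (\<Psi> \<cdot> zeroT) (\<Psi> \<cdot> ?A) \<in> W"
      using f c \<Psi> A st0 by (intro UDNR_plus_body_D2) simp_all
    then have "ap1 (\<Psi> \<cdot> zeroT) (V program) = ap1 (\<Psi> \<cdot> ?A) (V program)"
      using f c \<Psi> st0 by (intro approx_D) simp_all
    then have eq: "V (\<Psi> \<cdot> ?A \<cdot> program) = V ?c" using \<Psi> f c by simp
    have "ap1 ?g Z \<noteq> Z" "ap1 ?g m = Z" using g[of zero] st0 m f by (simp_all add: notV Sc_Z_monus)
    \<comment> \<open>Halting is understood in the world, where the number of steps may be
      nonstandard; \<open>UDNR_plus\<close> covers such computations as well.\<close>
    then obtain k where "ap3 (resultT \<cdot> ?A) (V program) (V program) k = Sc (V ?c)"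
      using program_halts[of ?g ?c] f c by auto
    then show False using UDNR_plus_body_D1[OF \<Psi>(4,1,2), of ?A program k] A f c \<Psi> eq by simp
  qed
qed

text \<open>Transfer gives every standard \<open>f\<close> with a zero a standard one, and
  \<open>HAC_int\<close> collects finitely many candidates for each \<open>f\<close> in a standard
  functional. As zeros are decidable, the right candidate can be picked by a bounded search.\<close>

lemma TRANS_functional:
  assumes "Pi01_TRANS \<in> W"
  obtains \<mu> where "ok two \<mu>" "big \<mu>" "St \<mu> \<in> W"
    "\<And>f i. ok one f \<Longrightarrow> big f \<Longrightarrow> St f \<in> W \<Longrightarrow> ap1 f i = Z \<Longrightarrow> ap1 f (V (\<mu> \<cdot> f)) = Z"
proof -
  \<comment> \<open>The existence of a zero is stated here without \<open>St\<close>. This makes the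
    formula internal, as \<open>HAC_int\<close> demands, and satisfiable also for functions without
    zeros.\<close>
  let ?\<phi> = "\<lambda>f t. Ex (nv 1) (Eq (f \<cdot> nt 1) zero) \<^bold>\<longrightarrow> Eq (f \<cdot> t) zero"
  let ?F = "(0, one \<rightarrow> Seq N)"
  let ?m = "\<lambda>f F y. Ex (nv 1) (less (nt 1) (len N (F \<cdot> f)) \<^bold>\<and> Eq y (entry N (F \<cdot> f) (nt 1)))"
  let ?P = "All_st (fv 0) (Ex_st (nv 0) (?\<phi> (ft 0) (nt 0)))"
  let ?Q = "\<lambda>F. All_st (fv 0) (Ex (nv 0) (?m (ft 0) F (nt 0) \<^bold>\<and> ?\<phi> (ft 0) (nt 0)))"
  have okm: "ok N (len N (F \<cdot> f)) \<and> ok N (entry N (F \<cdot> f) t)"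
    if "ok (one \<rightarrow> Seq N) F" "ok one f" "ok N t" for F f t
    using that by (simp add: ok_def)
  have \<phi>L: "?\<phi> f t \<in> L" if "ok one f" "ok N t" for f t using that by (simp add: L_All L_Eq)
  have mL: "?m f F t \<in> L" if "ok (one \<rightarrow> Seq N) F" "ok one f" "ok N t" for f F t
    using that okm[OF that(1,2)] by (simp add: L_All L_Eq less_def)
  have "ok (one \<rightarrow> Seq N) (Var ?F)" by simp
  then have QL: "?Q (Var ?F) \<in> L"
    using \<phi>L[of "ft 0" "nt 0"] mL[of "Var ?F" "ft 0" "nt 0"] by (simp add: L_All)
  have PL: "?P \<in> L" using \<phi>L[of "ft 0" "nt 0"] by (simp add: L_All)
  have mem: "mem N (nt 0) (Var ?F \<cdot> ft 0) = ?m (ft 0) (Var ?F) (nt 0)"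
    by (simp add: mem_def fresh_def Let_def)
  have "(?P \<^bold>\<longrightarrow> Ex_st ?F (?Q (Var ?F))) \<in> W"
  proof (rule W_nonstandard)
    have "(All_st (fv 0) (Ex_st (nv 0) (?\<phi> (ft 0) (nt 0))) \<^bold>\<longrightarrow>
     Ex_st ?F (All_st (fv 0) (Ex (nv 0) (mem (snd (nv 0)) (nt 0) (Var ?F \<cdot> ft 0) \<^bold>\<and> ?\<phi> (ft 0) (nt 0))))) \<in> HAC_int"
      by (rule HAC_int.intros) simp_all
    then show "(?P \<^bold>\<longrightarrow> Ex_st ?F (?Q (Var ?F))) \<in> Standardness \<union> HAC_int" by (simp add: mem)
    show "(?P \<^bold>\<longrightarrow> Ex_st ?F (?Q (Var ?F))) \<in> L" using PL QL by (simp add: L_All)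
  qed
  moreover have "?P \<in> W"
  proof (rule W_AllI[OF PL])
    fix n :: nat assume n: "100 \<le> n"
    let ?f = "Var (n, one)"
    have EL: "Ex_st (nv 0) (?\<phi> ?f (nt 0)) \<in> L" using \<phi>L[of ?f "nt 0"] by (simp add: L_All)
    have intro: "Ex_st (nv 0) (?\<phi> ?f (nt 0)) \<in> W" if "ok N t" "big t" "St t \<in> W" "?\<phi> ?f t \<in> W" for t
    proof (rule W_ExI[where t = t])
      have "(St t \<^bold>\<and> ?\<phi> ?f t) \<in> W" using that(1,3,4) \<phi>L[of ?f t] ok_wt by simp
      then show "fsubst (nv 0) t (St (nt 0) \<^bold>\<and> ?\<phi> ?f (nt 0)) \<in> W" using n by simp
      show "free_for t (nv 0) (St (nt 0) \<^bold>\<and> ?\<phi> ?f (nt 0))" using that by simp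
    qed (use that EL in auto)
    have "Ex_st (nv 0) (?\<phi> ?f (nt 0)) \<in> W" if st: "St ?f \<in> W"
    proof (cases "\<exists>i. ap1 ?f i = Z")
      case True
      then obtain i where i: "ap1 ?f i = Z" by blast
      have "St (notT \<cdot> ?f) \<in> W" using st by (simp add: St_simps)
      moreover have "ap1 (notT \<cdot> ?f) i \<noteq> Z" using i by (simp add: notV)
      ultimately obtain t where t: "ok N t" "big t" "St t \<in> W" "ap1 (notT \<cdot> ?f) (V t) \<noteq> Z"
        using TRANS_D[OF assms, of "notT \<cdot> ?f" i] n by auto
      then have "ap1 ?f (V t) = Z" by (simp add: notV Sc_Z_monus)
      then have "Eq (?f \<cdot> t) zero \<in> W" using t by simp
      then have "?\<phi> ?f t \<in> W" using \<phi>L[of ?f t] t(1) by simp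
      then show ?thesis using intro t by blast
    next
      case False
      have "Ex (nv 1) (Eq (?f \<cdot> nt 1) zero) \<notin> W"
      proof
        assume "Ex (nv 1) (Eq (?f \<cdot> nt 1) zero) \<in> W"
        then obtain k where "fsubst (nv 1) (Var (k, N)) (Eq (?f \<cdot> nt 1) zero) \<in> W" by (elim W_ExE) simp
        then show False using False n by auto
      qed
      \<comment> \<open>Without a zero of \<open>?f\<close> the implication is vacuous, and 0 is
        taken as a standard default.\<close>
      then have "?\<phi> ?f zero \<in> W" using \<phi>L[of ?f zero] by simp
      from intro[OF ok_zero _ St_closed this] show ?thesis by simp
    qed
    then have "(St ?f \<^bold>\<longrightarrow> Ex_st (nv 0) (?\<phi> ?f (nt 0))) \<in> W" using EL by simp
    then show "fsubst (fv 0) (Var (n, snd (fv 0))) (St (ft 0) \<^bold>\<longrightarrow> Ex_st (nv 0) (?\<phi> (ft 0) (nt 0))) \<in> W"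
      by simp
  qed
  ultimately have "Ex_st ?F (?Q (Var ?F)) \<in> W" by (rule W_mp)
  then obtain n where n: "100 \<le> n"
    "fsubst ?F (Var (n, one \<rightarrow> Seq N)) (St (Var ?F) \<^bold>\<and> ?Q (Var ?F)) \<in> W" by (elim W_ExE) simp
  let ?G = "Var (n, one \<rightarrow> Seq N)"
  have G: "ok (one \<rightarrow> Seq N) ?G" by simp
  have "(St ?G \<^bold>\<and> ?Q ?G) \<in> W" using n(2) by (simp add: less_def)
  moreover have "?Q ?G \<in> L"
    using \<phi>L[of "ft 0" "nt 0"] mL[of ?G "ft 0" "nt 0"] G by (simp add: L_All)
  ultimately have StG: "St ?G \<in> W" and QG: "?Q ?G \<in> W" by simp_all
  \<comment> \<open>The sequences are read through their lengths and entries, two functionals of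
    star-free type to which the search in \<open>pickT\<close> applies.\<close>
  define \<mu> where "\<mu> = pickT \<cdot> seqlenT ?G \<cdot> seqgetT ?G"
  have stl: "St (seqlenT ?G) \<in> W" "St (seqgetT ?G) \<in> W"
    unfolding seqlenT_def seqgetT_def using StG by (simp_all add: St_simps)
  show thesis
  proof (rule that[of \<mu>])
    show ok\<mu>: "ok two \<mu>" by (simp add: \<mu>_def)
    show "big \<mu>" using n by (simp add: \<mu>_def seqlenT_def seqgetT_def)
    show "St \<mu> \<in> W" using stl ok\<mu> unfolding \<mu>_def by (simp add: St_simps)
    fix f i assume f: "ok one f" "big f" "St f \<in> W" "ap1 f i = Z"
    have "fsubst (fv 0) f (St (ft 0) \<^bold>\<longrightarrow> Ex (nv 0) (?m (ft 0) ?G (nt 0) \<^bold>\<and> ?\<phi> (ft 0) (nt 0))) \<in> W"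
      using QG f by (intro W_inst) (simp_all add: less_def)
    then have "(St f \<^bold>\<longrightarrow> Ex (nv 0) (?m f ?G (nt 0) \<^bold>\<and> ?\<phi> f (nt 0))) \<in> W" using f by (simp add: less_def)
    then have "Ex (nv 0) (?m f ?G (nt 0) \<^bold>\<and> ?\<phi> f (nt 0)) \<in> W" using f(3) by (rule W_mp)
    then obtain y where y: "100 \<le> y" "fsubst (nv 0) (Var (y, N)) (?m f ?G (nt 0) \<^bold>\<and> ?\<phi> f (nt 0)) \<in> W"
      by (elim W_ExE) simp
    let ?y = "Var (y, N)"
    have "(?m f ?G ?y \<^bold>\<and> ?\<phi> f ?y) \<in> W" using y f by (simp add: less_def)
    then have m: "?m f ?G ?y \<in> W" and \<phi>: "?\<phi> f ?y \<in> W"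
      by (blast dest: W_conjD)+
    have "Ex (nv 1) (Eq (f \<cdot> nt 1) zero) \<in> W"
      using f by (intro W_ExI[where t = "R i"]) (simp_all add: L_All L_Eq)
    then have "Eq (f \<cdot> ?y) zero \<in> W" using W_mp[OF \<phi>] by blast
    then have fy: "ap1 f (V ?y) = Z" using f by simp
    obtain j where j: "100 \<le> j"
      "fsubst (nv 1) (Var (j, N)) (less (nt 1) (len N (?G \<cdot> f)) \<^bold>\<and> Eq ?y (entry N (?G \<cdot> f) (nt 1))) \<in> W"
      using m by (elim W_ExE) simp
    let ?j = "Var (j, N)"
    have okj: "ok N (len N (?G \<cdot> f))" "ok N (entry N (?G \<cdot> f) ?j)" using okm[OF G f(1), of ?j] by simp_all
    have "Eq (monus (suc ?j) (len N (?G \<cdot> f))) zero \<in> W" "Eq ?y (entry N (?G \<cdot> f) ?j) \<in> W"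
      using j f n y okj by (simp_all add: less_def L_Eq)
    then have lt: "Sc (V ?j) \<ominus> V (len N (?G \<cdot> f)) = Z" and ent: "V ?y = V (entry N (?G \<cdot> f) ?j)"
      using okj by (simp_all del: V_machine(6))
    \<comment> \<open>The search covers the positions up to and including the length, hence the
      position \<open>?j\<close> of the correct candidate.\<close>
    have le: "V ?j \<ominus> V (len N (?G \<cdot> f)) = Z" using lt by (rule Sc_monus_zero)
    have okGf: "ok one (seqgetT ?G \<cdot> f)" using f by (intro ok_dnr_app) simp_all
    have "ap1 (compT \<cdot> f \<cdot> (seqgetT ?G \<cdot> f)) (V ?j) = Z"
      using f fy ent okGf seqgetV[OF G f(1), of ?j] by (simp add: compV)
    then have "ap1 (compT \<cdot> f \<cdot> (seqgetT ?G \<cdot> f))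
        (ap1 (searchT \<cdot> (compT \<cdot> f \<cdot> (seqgetT ?G \<cdot> f))) (V (seqlenT ?G \<cdot> f))) = Z"
      using le f okGf seqlenV[OF G f(1)] by (intro search_correct) simp_all
    then show "ap1 f (V (\<mu> \<cdot> f)) = Z"
      unfolding \<mu>_def using f okGf by (simp add: pickV compV)
  qed
qed

text \<open>For standard \<open>A\<close>, the function \<open>haltT \<cdot> A \<cdot> e\<close> is
  known to be standard only when \<open>e\<close> is, so \<open>\<mu>\<close> can be trusted only
  there. The vanishing of \<open>checkT\<close> expresses this correctness without quantifiers at a
  coded pair of a program and a step, and transfer extends it to all pairs.\<close>

lemma TRANS_imp_UDNR_plus:
  assumes TRANS: "Pi01_TRANS \<in> W"
  shows "UDNR_plus \<in> W"
proof -
  obtain \<mu> where \<mu>: "ok two \<mu>" "big \<mu>" "St \<mu> \<in> W"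
    and zero: "\<And>f i. ok one f \<Longrightarrow> big f \<Longrightarrow> St f \<in> W \<Longrightarrow> ap1 f i = Z \<Longrightarrow> ap1 f (V (\<mu> \<cdot> f)) = Z"
    using TRANS_functional[OF TRANS] by blast
  show ?thesis
  proof (rule UDNR_plus_I[of "dnrT \<cdot> \<mu>"])
    show "St (dnrT \<cdot> \<mu>) \<in> W"
      using \<mu> by (simp add: St_simps)
    fix A e k
    assume A: "ok one A" "big A" "St A \<in> W" and e: "ok N e" "big e"
    have check: "ap1 (checkT \<cdot> \<mu> \<cdot> A) a = Z" for a
    proof (rule TRANS_D[OF TRANS])
      show "St (checkT \<cdot> \<mu> \<cdot> A) \<in> W" using \<mu> A
        by (simp add: St_simps)
      fix t assume t: "ok N t" "big t" "St t \<in> W"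
      let ?e = "pfst t"
      have "St ?e \<in> W" using t by (simp add: St_simps)
      then have st: "St (haltT \<cdot> A \<cdot> ?e) \<in> W" using A t
        by (simp add: St_simps)
      have "ap3 (resultT \<cdot> A) (pfstV (V t)) (pfstV (V t)) (ap1 (findT \<cdot> \<mu> \<cdot> A) (pfstV (V t))) \<noteq> Z"
        if "ap3 (resultT \<cdot> A) (pfstV (V t)) (pfstV (V t)) (psndV (V t)) \<noteq> Z"
      proof -
        have "ap1 (haltT \<cdot> A \<cdot> ?e) (psndV (V t)) = Z" using that A t by (simp add: haltV Sc_Z_monus)
        then have "ap1 (haltT \<cdot> A \<cdot> ?e) (V (\<mu> \<cdot> (haltT \<cdot> A \<cdot> ?e))) = Z"
          using zero[of "haltT \<cdot> A \<cdot> ?e"] st A t by simp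
        then show ?thesis using findV[OF \<mu>(1) A(1), of ?e] A t by (simp add: haltV Sc_Z_monus)
      qed
      then show "ap1 (checkT \<cdot> \<mu> \<cdot> A) (V t) = Z"
        using \<mu> A by (cases "ap3 (resultT \<cdot> A) (pfstV (V t)) (pfstV (V t)) (psndV (V t)) = Z")
          (simp_all add: checkV condV_nonzero)
    qed (use \<mu> A in auto)
    show "ap3 (resultT \<cdot> A) (V e) (V e) k \<noteq> Sc (V (dnrT \<cdot> \<mu> \<cdot> A \<cdot> e))"
    proof (rule dnr_differs[OF \<mu>(1) A(1) e(1)])
      assume "ap3 (resultT \<cdot> A) (V e) (V e) k \<noteq> Z"
      \<comment> \<open>The transferred check is read at the code of the pair of \<open>e\<close>
        and \<open>k\<close>, standard or not.\<close>
      then show "ap3 (resultT \<cdot> A) (V e) (V e) (ap1 (findT \<cdot> \<mu> \<cdot> A) (V e)) \<noteq> Z"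
        using check[of "pairV (V e) k"] \<mu> A by (auto simp: checkV condV_nonzero)
    qed
  next
    fix C D
    assume C: "ok one C" "big C" "St C \<in> W" and D: "ok one D" "big D" "St D \<in> W" and "approx C D \<in> W"
    then have "ap1 C (V t) = ap1 D (V t)" if "ok N t" "St t \<in> W" for t
      using that by (intro approx_D)
    then have dist: "ap1 (distT \<cdot> C \<cdot> D) (V t) = Z" if "ok N t" "St t \<in> W" for t
      using that unfolding distV[OF C(1) D(1)] monus_eq_iff by blast
    \<comment> \<open>By transfer, standard functions that agree at standard arguments agree
      everywhere; the second clause of \<open>UDNR_plus\<close> then follows from the axiom of
      extensionality.\<close>
    have St: "St (distT \<cdot> C \<cdot> D) \<in> W" using C D by (simp add: St_simps)
    have "ap1 (distT \<cdot> C \<cdot> D) a = Z" for a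
      by (rule TRANS_D[OF TRANS _ _ St dist]) (use C D in simp_all)
    then have CD: "ap1 C a = ap1 D a" for a unfolding distV[OF C(1) D(1)] monus_eq_iff .
    let ?\<Psi> = "dnrT \<cdot> \<mu>"
    have L: "eq one C D \<in> L" "eq one (?\<Psi> \<cdot> C) (?\<Psi> \<cdot> D) \<in> L" by (rule eq_L; use C D \<mu> in simp)+
    have "(eq one C D \<^bold>\<longrightarrow> eq one (?\<Psi> \<cdot> C) (?\<Psi> \<cdot> D)) \<in> W"
      using L by (intro W_ax E_PRA.extensionality) simp
    moreover have "eq one C D \<in> W"
    proof -
      let ?v = "nv (fresh C D)"
      have "All ?v (Eq (C \<cdot> Var ?v) (D \<cdot> Var ?v)) \<in> W"
        using L(1) C D CD by (intro W_AllI) (simp_all add: Let_def fresh)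
      then show ?thesis by (simp add: Let_def)
    qed
    ultimately have eq: "eq one (?\<Psi> \<cdot> C) (?\<Psi> \<cdot> D) \<in> W" by (rule W_mp)
    have "ap1 (?\<Psi> \<cdot> C) a = ap1 (?\<Psi> \<cdot> D) a" for a
    proof -
      let ?v = "nv (fresh (?\<Psi> \<cdot> C) (?\<Psi> \<cdot> D))"
      have "fsubst ?v (R a) (Eq (?\<Psi> \<cdot> C \<cdot> Var ?v) (?\<Psi> \<cdot> D \<cdot> Var ?v)) \<in> W"
        using eq by (intro W_inst) (simp_all add: Let_def)
      moreover have "tsubst ?v (R a) (?\<Psi> \<cdot> C) = ?\<Psi> \<cdot> C" "tsubst ?v (R a) (?\<Psi> \<cdot> D) = ?\<Psi> \<cdot> D"
        by (rule tsubst_fresh, rule fresh)+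
      ultimately have "Eq (?\<Psi> \<cdot> C \<cdot> R a) (?\<Psi> \<cdot> D \<cdot> R a) \<in> W" by simp
      then show ?thesis using C D \<mu> by simp
    qed
    then show "approx (?\<Psi> \<cdot> C) (?\<Psi> \<cdot> D) \<in> W" using C D \<mu> by (intro approx_I) simp_all
  qed (use \<mu> in auto)
qed

lemma UDNR_plus_iff_TRANS: "(UDNR_plus \<^bold>\<longleftrightarrow> Pi01_TRANS) \<in> W"
  using UDNR_plus_L TRANS_L UDNR_plus_imp_TRANS TRANS_imp_UDNR_plus by simp

end

theorem theorem3p3:
  shows "RCA0_Lambda (UDNR_plus \<^bold>\<longleftrightarrow> Pi01_TRANS) \<and>
    (\<exists>s u. closed_term (two \<rightarrow> one \<rightarrow> one) s \<and>
      closed_term ((one \<rightarrow> one) \<rightarrow> (one \<rightarrow> one \<rightarrow> N \<rightarrow> N) \<rightarrow> two) u \<and>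
      RCA0_omega
        (All \<mu>_var (MU (Var \<mu>_var) \<^bold>\<longrightarrow> UDNR (s \<cdot> Var \<mu>_var)) \<^bold>\<and>
         All \<Psi>_var (All \<Phi>_var
           (UDNR (Var \<Psi>_var) \<^bold>\<and> extensionality_functional (Var \<Phi>_var) (Var \<Psi>_var) \<^bold>\<longrightarrow>
            MU (u \<cdot> Var \<Psi>_var \<cdot> Var \<Phi>_var)))))"
proof (intro conjI exI)
  let ?Ax = "E_PRA \<union> QF_AC \<union> Sequences \<union> Standardness \<union> HAC_int \<union> Idealisation"
  interpret ns: full_calculus ?Ax by unfold_locales auto
  have "(UDNR_plus \<^bold>\<longleftrightarrow> Pi01_TRANS) \<in> W" if "world False ?Ax W" for W
  proof -
    interpret world False ?Ax W by fact
    interpret nonstandard_world ?Ax W by unfold_locales auto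
    show ?thesis by (rule UDNR_plus_iff_TRANS)
  qed
  moreover have "(UDNR_plus \<^bold>\<longleftrightarrow> Pi01_TRANS) \<in> ns.L" using ns.UDNR_plus_L ns.TRANS_L by simp
  ultimately show "RCA0_Lambda (UDNR_plus \<^bold>\<longleftrightarrow> Pi01_TRANS)"
    using ns.completeness unfolding RCA0_Lambda_def ns.L_def by simp
next
  \<comment> \<open>These two goals fix the unknown terms \<open>s\<close> and
    \<open>u\<close>.\<close>
  show "closed_term (two \<rightarrow> one \<rightarrow> one) dnrT"
    "closed_term ((one \<rightarrow> one) \<rightarrow> (one \<rightarrow> one \<rightarrow> N \<rightarrow> N) \<rightarrow> two) muT"
    by (simp_all add: closed_term_def)
next
  let ?Ax = "E_PRA \<union> QF_AC"
  let ?to = "\<lambda>\<mu>. MU \<mu> \<^bold>\<longrightarrow> UDNR (dnrT \<cdot> \<mu>)"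
  let ?from = "\<lambda>\<Psi> \<Phi>. UDNR \<Psi> \<^bold>\<and> extensionality_functional \<Phi> \<Psi> \<^bold>\<longrightarrow> MU (muT \<cdot> \<Psi> \<cdot> \<Phi>)"
  let ?\<phi> = "All \<mu>_var (?to (Var \<mu>_var)) \<^bold>\<and> All \<Psi>_var (All \<Phi>_var (?from (Var \<Psi>_var) (Var \<Phi>_var)))"
  interpret om: calculus True ?Ax by unfold_locales auto
  have L1: "?to \<mu> \<in> om.L" if "om.ok two \<mu>" for \<mu>
    using that by (simp add: om.MU_L om.UDNR_L)
  have L2: "?from \<Psi> \<Phi> \<in> om.L" if "om.ok (one \<rightarrow> one) \<Psi>" "om.ok (one \<rightarrow> one \<rightarrow> N \<rightarrow> N) \<Phi>" for \<Psi> \<Phi>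
    using that by (simp add: om.MU_L om.UDNR_L om.extensionality_functional_L)
  have L: "All \<mu>_var (?to (Var \<mu>_var)) \<in> om.L" "All \<Psi>_var (All \<Phi>_var (?from (Var \<Psi>_var) (Var \<Phi>_var))) \<in> om.L"
    using L1[of "Var \<mu>_var"] L2[of "Var \<Psi>_var" "Var \<Phi>_var"] by (simp_all add: om.L_All)
  have "?\<phi> \<in> W" if "world True ?Ax W" for W
  proof -
    interpret world True ?Ax W by fact
    have "All \<mu>_var (?to (Var \<mu>_var)) \<in> W"
    proof (rule W_AllI[OF L(1)])
      fix n :: nat assume "100 \<le> n"
      then have "?to (Var (n, two)) \<in> W"
        using MU_imp_UDNR[of "Var (n, two)"] by (simp add: om.MU_L om.UDNR_L)
      then show "fsubst \<mu>_var (Var (n, snd \<mu>_var)) (?to (Var \<mu>_var)) \<in> W"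
        by (simp add: fsubst_MU fsubst_UDNR)
    qed
    moreover have "All \<Psi>_var (All \<Phi>_var (?from (Var \<Psi>_var) (Var \<Phi>_var))) \<in> W"
    proof (rule W_AllI[OF L(2)])
      fix m :: nat assume m: "100 \<le> m"
      let ?\<Psi> = "Var (m, one \<rightarrow> one)"
      have "All \<Phi>_var (?from ?\<Psi> (Var \<Phi>_var)) \<in> W"
      proof (rule W_AllI)
        show "All \<Phi>_var (?from ?\<Psi> (Var \<Phi>_var)) \<in> om.L"
          using L2[of ?\<Psi> "Var \<Phi>_var"] by (simp add: om.L_All)
        fix n :: nat assume n: "100 \<le> n"
        let ?\<Phi> = "Var (n, one \<rightarrow> one \<rightarrow> N \<rightarrow> N)"
        have "?from ?\<Psi> ?\<Phi> \<in> W"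
          using UDNR_imp_MU[of ?\<Psi> ?\<Phi>] m n by (simp add: om.MU_L om.UDNR_L om.extensionality_functional_L)
        then show "fsubst \<Phi>_var (Var (n, snd \<Phi>_var)) (?from ?\<Psi> (Var \<Phi>_var)) \<in> W"
          by (simp add: fsubst_MU fsubst_UDNR fsubst_extensionality_functional)
      qed
      then show "fsubst \<Psi>_var (Var (m, snd \<Psi>_var)) (All \<Phi>_var (?from (Var \<Psi>_var) (Var \<Phi>_var))) \<in> W"
        by (simp add: fsubst_MU fsubst_UDNR fsubst_extensionality_functional)
    qed
    ultimately show ?thesis using L by simp
  qed
  moreover have "?\<phi> \<in> om.L" using L by simp
  ultimately show "RCA0_omega ?\<phi>"
    using om.completeness unfolding RCA0_omega_def om.L_def by simp
qed

end
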